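(* The Riemann Hypothesis holds if and only if the constant function $\mathbf{1}$ on $(0,1)$ belongs to the closure in $L^2((0,1),du)$ of $\{T(\phi):\ \phi\in\mathcal{S}^0_{\le1}\}$.
   Context: $\mathcal{S}^0_{\le1}$ is the vector space of smooth functions $\phi$ on $\mathbb{R}$ with compact support contained in $[0,1]$ and $\int_0^1\phi(x)\,dx=0$. For such $\phi$, $T(\phi)(u)=\sum_{n\ge1}\phi(nu)$ for $u>0$; it is a smooth function supported in $(0,1]$, regarded as an element of $L^2((0,1),du)$. The Riemann Hypothesis asserts that the Riemann zeta function has no zeros with $\mathrm{Re}(s)>\frac12$. *)

theory Defs
  imports "HOL-Complex_Analysis.Complex_Analysis"
begin

text \<open>
  The Riemann zeta function is the holomorphic continuation to \<open>- {1}\<close> of the Dirichlet series.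
  The condition at the pole \<open>1\<close> only fixes a value there, as functions are total;
  \<open>riemann_zeta_ex1\<close> below shows that exactly one function satisfies the description.
\<close>

definition riemann_zeta :: "complex \<Rightarrow> complex" where
  "riemann_zeta = (THE f. f holomorphic_on - {1} \<and>
     (\<forall>s. Re s > 1 \<longrightarrow> (\<lambda>n. 1 / of_nat (Suc n) powr s) sums f s) \<and> f 1 = 0)"

definition riemann_hypothesis :: bool where
  "riemann_hypothesis \<longleftrightarrow> (\<forall>s. Re s > 1/2 \<and> s \<noteq> 1 \<longrightarrow> riemann_zeta s \<noteq> 0)"

definition smooth :: "(real \<Rightarrow> complex) \<Rightarrow> bool" where
  "smooth \<phi> \<longleftrightarrow> (\<forall>n. ((\<lambda>g x. vector_derivative g (at x)) ^^ n) \<phi> differentiable_on UNIV)"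

definition S0_le1 :: "(real \<Rightarrow> complex) set" where
  "S0_le1 = {\<phi>. smooth \<phi> \<and> closure {x. \<phi> x \<noteq> 0} \<subseteq> {0..1} \<and> integral {0..1} \<phi> = 0}"

text \<open>For \<open>u > 0\<close> and \<open>\<phi>\<close> in \<open>S0_le1\<close> only the finitely many terms with
  \<open>(n + 1) * u \<le> 1\<close> can be nonzero; the values at \<open>u \<le> 0\<close> are irrelevant.\<close>

definition T_op :: "(real \<Rightarrow> complex) \<Rightarrow> real \<Rightarrow> complex" where
  "T_op \<phi> u = (\<Sum>n. \<phi> (real (Suc n) * u))"

text \<open>
  Elements of \<open>L2\<close> are represented by square-integrable functions; two representatives of the
  same class are at distance \<open>0\<close>, so membership in \<open>L2_closure\<close> does not depend on the
  representative. The approximants are required to be in \<open>L2_space\<close> because the integral of a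
  non-integrable function is \<open>0\<close> by convention; for the sets used here this removes nothing,
  see \<open>T_op_in_L2\<close>.
\<close>

definition L2_space :: "'a measure \<Rightarrow> ('a \<Rightarrow> complex) set" where
  "L2_space M = {f. f \<in> borel_measurable M \<and> integrable M (\<lambda>x. (norm (f x))\<^sup>2)}"

definition L2_dist :: "'a measure \<Rightarrow> ('a \<Rightarrow> complex) \<Rightarrow> ('a \<Rightarrow> complex) \<Rightarrow> real" where
  "L2_dist M f g = sqrt (\<integral>x. (norm (f x - g x))\<^sup>2 \<partial>M)"

definition L2_closure :: "'a measure \<Rightarrow> ('a \<Rightarrow> complex) set \<Rightarrow> ('a \<Rightarrow> complex) set" where
  "L2_closure M A = {f \<in> L2_space M. \<forall>\<epsilon>>0. \<exists>g \<in> A \<inter> L2_space M. L2_dist M f g < \<epsilon>}"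


subsection \<open>Existence and uniqueness of the zeta function\<close>

lemma holomorphic_integral_param:
  fixes f :: "complex \<Rightarrow> real \<Rightarrow> complex"
  assumes S: "open S"
    and cont: "continuous_on (S \<times> {0..1}) (\<lambda>(z,t). f z t)"
    and hol: "\<And>t. t \<in> {0..1} \<Longrightarrow> (\<lambda>z. f z t) holomorphic_on S"
  shows "(\<lambda>z. integral {0..1} (f z)) holomorphic_on S"
proof -
  have eq: "integral {0..1} (f z) = contour_integral (linepath 0 1) (\<lambda>w. f z (Re w))" for z
    by (simp add: contour_integral_integral linepath_def vector_derivative_linepath_at)
  have 1: "continuous_on S (\<lambda>z. integral {0..1} (f z))"
    using integral_continuous_on_param[of S 0 1 f] cont by simp
  have 2: "contour_integral (linepath a b) (\<lambda>z. integral {0..1} (f z)) =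
     contour_integral (linepath 0 1) (\<lambda>w. contour_integral (linepath a b) (\<lambda>z. f z (Re w)))"
    if ab: "closed_segment a b \<subseteq> S" for a b
    unfolding eq
  proof (rule contour_integral_swap)
    have "continuous_on (path_image (linepath a b) \<times> path_image (linepath 0 1)) 
       (\<lambda>p. (\<lambda>(z,t). f z t) (fst p, Re (snd p)))"
      by (rule continuous_on_compose2[OF cont]) 
         (use ab in \<open>auto intro!: continuous_intros simp: closed_segment_def\<close>)
    then show "continuous_on (path_image (linepath a b) \<times> path_image (linepath 0 1))
     (\<lambda>(y1, y2). f y1 (Re y2))"
      by (simp add: case_prod_unfold)
  qed (auto intro!: continuous_intros)
  have 3: "(\<lambda>w. contour_integral (linepath a b) (\<lambda>z. f z (Re w))) contour_integrable_on linepath 0 1"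
    if ab: "closed_segment a b \<subseteq> S" for a b
  proof -
    have c: "continuous_on (closed_segment 0 (1::complex)) (\<lambda>w. integral (cbox 0 1) (\<lambda>x. f (linepath a b x) (Re w) * (b - a)))"
    proof (rule integral_continuous_on_param)
      have "continuous_on (closed_segment 0 (1::complex) \<times> cbox 0 1)
         (\<lambda>p. (\<lambda>(z,t). f z t) (linepath a b (snd p), Re (fst p)))"
      proof (rule continuous_on_compose2[OF cont])
        show "continuous_on (closed_segment 0 (1::complex) \<times> cbox 0 1) (\<lambda>p. (linepath a b (snd p), Re (fst p)))"
          by (auto intro!: continuous_intros simp: linepath_def)
        show "(\<lambda>p. (linepath a b (snd p), Re (fst p))) ` (closed_segment 0 1 \<times> cbox 0 1) \<subseteq> S \<times> {0..1}"
          using ab by (auto simp: linepath_in_path subset_iff closed_segment_def[of 0 1])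
      qed
      then have "continuous_on (closed_segment 0 (1::complex) \<times> cbox 0 1)
         (\<lambda>p. f (linepath a b (snd p)) (Re (fst p)))" by simp
      then show "continuous_on (closed_segment 0 (1::complex) \<times> cbox 0 1)
         (\<lambda>(w, x). f (linepath a b x) (Re w) * (b - a))"
        unfolding case_prod_unfold by (intro continuous_on_mult continuous_on_const)
    qed
    show ?thesis
      by (rule contour_integrable_continuous_linepath)
         (use c in \<open>simp add: contour_integral_integral vector_derivative_linepath_at\<close>)
  qed
  show ?thesis
  proof (rule analytic_imp_holomorphic, rule Morera_triangle[OF 1 S], intro impI)
    fix a b c assume abc: "convex hull {a, b, c} \<subseteq> S"
    have seg: "closed_segment a b \<subseteq> S" "closed_segment b c \<subseteq> S" "closed_segment c a \<subseteq> S"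
      using abc segments_subset_convex_hull by (metis subset_trans)+
    let ?I = "\<lambda>a b w. contour_integral (linepath a b) (\<lambda>z. f z (Re w))"
    have z: "?I a b w + ?I b c w + ?I c a w = 0" if "w \<in> closed_segment 0 1" for w :: complex
    proof -
      have w: "Re w \<in> {0..1}" using that by (auto simp: closed_segment_def)
      have h: "(\<lambda>z. f z (Re w)) holomorphic_on convex hull {a,b,c}"
        using hol[OF w] abc holomorphic_on_subset by blast
      have ci: "(\<lambda>z. f z (Re w)) contour_integrable_on linepath x y" if "closed_segment x y \<subseteq> S" for x y
        using holomorphic_on_subset[OF hol[OF w] that]
        by (intro contour_integrable_continuous_linepath holomorphic_on_imp_continuous_on)
      have "contour_integral (linepath a b +++ linepath b c +++ linepath c a) (\<lambda>z. f z (Re w)) = 0"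
        using Cauchy_theorem_triangle[OF h] contour_integral_unique by blast
      then show ?thesis using ci[OF seg(1)] ci[OF seg(2)] ci[OF seg(3)] by (simp add: add.assoc)
    qed
    have "contour_integral (linepath 0 1) (?I a b) + contour_integral (linepath 0 1) (?I b c)
        + contour_integral (linepath 0 1) (?I c a)
        = contour_integral (linepath 0 1) (\<lambda>w. ?I a b w + ?I b c w + ?I c a w)"
      using 3[OF seg(1)] 3[OF seg(2)] 3[OF seg(3)]
      by (simp add: contour_integral_add contour_integrable_add)
    also have "\<dots> = contour_integral (linepath 0 1) (\<lambda>w. 0)"
      by (rule contour_integral_cong) (use z in auto)
    finally show "contour_integral (linepath a b) (\<lambda>z. integral {0..1} (f z)) +
       contour_integral (linepath b c) (\<lambda>z. integral {0..1} (f z)) +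
       contour_integral (linepath c a) (\<lambda>z. integral {0..1} (f z)) = 0"
      by (simp add: 2 seg)
  qed
qed

definition pw :: "complex \<Rightarrow> real \<Rightarrow> complex" where
  "pw s b = exp (- s * of_real (ln b))"

lemma pw_eq_powr: "b > 0 \<Longrightarrow> pw s b = of_real b powr (- s)"
  by (simp add: pw_def powr_def Ln_of_real)

lemma norm_pw: "b > 0 \<Longrightarrow> norm (pw s b) = b powr (- Re s)"
  by (simp add: pw_def powr_def)

lemma pw_deriv:
  assumes "b + t > 0"
  shows "((\<lambda>t. pw s (b + t)) has_vector_derivative (- s * pw (s + 1) (b + t))) (at t within T)"
proof -
  have e: "exp (- of_real (ln (b + t))) = (1 / of_real (b + t) :: complex)"
    using assms by (simp add: exp_minus exp_of_real divide_inverse del: of_real_add)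
  have "((\<lambda>t. ln (b + t)) has_real_derivative (1 / (b + t))) (at t within T)"
    using assms by (auto intro!: derivative_eq_intros)
  then have 0: "((\<lambda>t. - s * of_real (ln (b + t))) has_vector_derivative (- s * of_real (1 / (b + t)))) (at t within T)"
    by (intro has_vector_derivative_mult_right has_vector_derivative_of_real)
       (simp add: has_real_derivative_iff_has_vector_derivative)
  have "((exp \<circ> (\<lambda>t. - s * of_real (ln (b + t)))) has_vector_derivative
     ((- s * of_real (1 / (b + t))) * exp (- s * of_real (ln (b + t))))) (at t within T)"
    by (rule field_vector_diff_chain_within[OF 0]) (auto intro!: derivative_eq_intros)
  moreover have "pw (s + 1) (b + t) = of_real (1 / (b + t)) * exp (- s * of_real (ln (b + t)))"
    using e by (simp add: pw_def algebra_simps exp_diff exp_minus exp_add divide_inverse)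
  ultimately show ?thesis by (simp add: o_def pw_def algebra_simps)
qed

lemma continuous_on_pw [continuous_intros]:
  fixes f :: "'a::t2_space \<Rightarrow> complex"
  assumes "continuous_on A f" "continuous_on A g" "\<And>x. x \<in> A \<Longrightarrow> g x > 0"
  shows "continuous_on A (\<lambda>x. pw (f x) (g x))"
  unfolding pw_def using assms by (auto intro!: continuous_intros simp: less_imp_neq[symmetric])

lemma holomorphic_on_pw [holomorphic_intros]:
  "f holomorphic_on A \<Longrightarrow> (\<lambda>x. pw (f x) b) holomorphic_on A"
  unfolding pw_def by (auto intro!: holomorphic_intros)

lemma summable_pw_bound: "\<sigma> > 1 \<Longrightarrow> summable (\<lambda>n. (real n + 1) powr (- \<sigma>))"
  using summable_real_powr_iff[of "- \<sigma>"] summable_Suc_iff[of "\<lambda>n. real n powr (- \<sigma>)"]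
  by (simp add: add.commute)

lemma pw_bound:
  assumes "\<sigma> > 1" "Re s \<ge> \<sigma>" "a \<ge> 1"
  shows "norm (pw s (real n + a)) \<le> (real n + 1) powr (- \<sigma>)"
proof -
  have "(real n + a) powr (- Re s) \<le> (real n + a) powr (- \<sigma>)"
    using assms by (intro powr_mono) auto
  also have "\<dots> \<le> (real n + 1) powr (- \<sigma>)"
    using assms by (intro powr_mono2') auto
  finally show ?thesis using assms by (simp add: norm_pw)
qed

lemma summable_pw: "Re s > 1 \<Longrightarrow> a \<ge> 1 \<Longrightarrow> summable (\<lambda>n. pw s (real n + a))"
  by (rule summable_comparison_test'[OF summable_pw_bound[of "Re s"]]) (auto intro!: pw_bound)

lemma uniform_limit_pw:
  assumes "\<sigma> > 1"
  shows "uniform_limit ({s. Re s > \<sigma>} \<times> {1..}) (\<lambda>N p. \<Sum>n<N. pw (fst p) (real n + snd p))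
           (\<lambda>p. \<Sum>n. pw (fst p) (real n + snd p)) sequentially"
  by (rule Weierstrass_m_test[OF _ summable_pw_bound[OF assms]])
     (use assms in \<open>auto intro!: pw_bound\<close>)

text \<open>
  \<open>hz k s a\<close> is the Hurwitz zeta function \<open>\<zeta>(s, a)\<close> minus \<open>a powr (1 - s) / (s - 1)\<close>, for
  \<open>Re s > 1 - k\<close> and \<open>a \<ge> 1\<close>. The recursion comes from integrating by parts:
  \<open>\<zeta>(s, a) - a powr (1 - s) / (s - 1)\<close> is the integral of \<open>(1 - t) * s * \<zeta>(s + 1, a + t)\<close>
  over \<open>t\<close> in \<open>{0..1}\<close>.
\<close>

fun hz :: "nat \<Rightarrow> complex \<Rightarrow> real \<Rightarrow> complex" where
  "hz 0 s a = (\<Sum>n. pw s (real n + a)) - pw (s - 1) a / (s - 1)"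
| "hz (Suc k) s a = integral {0..1} (\<lambda>t. of_real (1 - t) * (s * hz k (s + 1) (a + t) + pw s (a + t)))"

lemma hz_regular:
  assumes "\<sigma> > 1"
  shows "continuous_on ({s. Re s > \<sigma> - real k} \<times> {1..}) (\<lambda>(s,a). hz k s a)
    \<and> (\<forall>a\<ge>1. (\<lambda>s. hz k s a) holomorphic_on {s. Re s > \<sigma> - real k})"
proof (induction k)
  case 0
  have 1: "continuous_on ({s. Re s > \<sigma>} \<times> {1..}) (\<lambda>p. \<Sum>n. pw (fst p) (real n + snd p))"
    by (rule uniform_limit_theorem[OF _ uniform_limit_pw[OF assms]])
       (auto intro!: always_eventually continuous_intros)
  have 2: "(\<lambda>s. \<Sum>n. pw s (real n + a)) holomorphic_on {s. Re s > \<sigma>}" if "a \<ge> 1" for a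
  proof (rule holomorphic_uniform_sequence)
    show "open {s. \<sigma> < Re s}" by (simp add: open_halfspace_Re_gt)
    show "(\<lambda>s. \<Sum>n<N. pw s (real n + a)) holomorphic_on {s. \<sigma> < Re s}" for N
      by (intro holomorphic_intros)
    fix x assume "x \<in> {s. \<sigma> < Re s}"
    then obtain d where d: "d > 0" "cball x d \<subseteq> {s. \<sigma> < Re s}"
      using open_contains_cball open_halfspace_Re_gt by blast
    have "uniform_limit (cball x d) (\<lambda>N s. \<Sum>n<N. pw s (real n + a)) (\<lambda>s. \<Sum>n. pw s (real n + a)) sequentially"
      by (rule Weierstrass_m_test[OF _ summable_pw_bound[OF assms]])
         (use assms d that in \<open>auto intro!: pw_bound\<close>)
    then show "\<exists>d>0. cball x d \<subseteq> {s. \<sigma> < Re s} \<and>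
      uniform_limit (cball x d) (\<lambda>N s. \<Sum>n<N. pw s (real n + a)) (\<lambda>s. \<Sum>n. pw s (real n + a)) sequentially"
      using d by blast
  qed
  have "continuous_on ({s. Re s > \<sigma>} \<times> {1..}) (\<lambda>(s,a). hz 0 s a)"
    unfolding case_prod_unfold hz.simps using assms
    by (intro continuous_intros 1) auto
  moreover have "(\<lambda>s. hz 0 s a) holomorphic_on {s. Re s > \<sigma>}" if "a \<ge> 1" for a
    unfolding hz.simps using assms by (intro holomorphic_intros 2 that) auto
  ultimately show ?case by simp
next
  case (Suc k)
  let ?S = "{s. Re s > \<sigma> - real (Suc k)}"
  have c: "continuous_on ({s. Re s > \<sigma> - real k} \<times> {1..}) (\<lambda>(s,a). hz k s a)"
    and h: "\<And>a. a \<ge> 1 \<Longrightarrow> (\<lambda>s. hz k s a) holomorphic_on {s. Re s > \<sigma> - real k}"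
    using Suc.IH by auto
  have "continuous_on ((?S \<times> {1..}) \<times> cbox 0 1) (\<lambda>p. (\<lambda>(s,a). hz k s a) (fst (fst p) + 1, snd (fst p) + snd p))"
    by (rule continuous_on_compose2[OF c]) (auto intro!: continuous_intros)
  then have c': "continuous_on ((?S \<times> {1..}) \<times> cbox 0 1) (\<lambda>p. hz k (fst (fst p) + 1) (snd (fst p) + snd p))"
    by simp
  have 1: "continuous_on ((?S \<times> {1..}) \<times> cbox 0 1)
      (\<lambda>(p,t). of_real (1 - t) * (fst p * hz k (fst p + 1) (snd p + t) + pw (fst p) (snd p + t)))"
    unfolding case_prod_unfold by (intro continuous_intros c') auto
  have 2: "continuous_on (?S \<times> {1..}) (\<lambda>(s,a). hz (Suc k) s a)"
    using integral_continuous_on_param[OF 1] by (simp add: case_prod_unfold)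
  have 3: "(\<lambda>s. hz (Suc k) s a) holomorphic_on ?S" if a: "a \<ge> 1" for a
    unfolding hz.simps
  proof (rule holomorphic_integral_param)
    show "open ?S" by (simp add: open_halfspace_Re_gt)
    have "continuous_on (?S \<times> {0..1}) (\<lambda>q. (\<lambda>(p,t). of_real (1 - t) * (fst p * hz k (fst p + 1) (snd p + t) + pw (fst p) (snd p + t))) ((fst q, a), snd q))"
      by (rule continuous_on_compose2[OF 1]) (use a in \<open>auto intro!: continuous_intros\<close>)
    then show "continuous_on (?S \<times> {0..1}) (\<lambda>(s,t). of_real (1 - t) * (s * hz k (s + 1) (a + t) + pw s (a + t)))"
      by (simp add: case_prod_unfold)
    fix t :: real assume t: "t \<in> {0..1}"
    have "((\<lambda>s. hz k s (a + t)) \<circ> (\<lambda>s. s + 1)) holomorphic_on ?S"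
      by (rule holomorphic_on_compose_gen[OF _ h]) (use a t in \<open>auto intro!: holomorphic_intros\<close>)
    then show "(\<lambda>s. of_real (1 - t) * (s * hz k (s + 1) (a + t) + pw s (a + t))) holomorphic_on ?S"
      by (intro holomorphic_intros) (simp add: o_def)
  qed
  show ?case using 2 3 by blast
qed

lemma hz_step_0:
  assumes s: "Re s > 1" and a: "a \<ge> 1"
  shows "hz (Suc 0) s a = hz 0 s a"
proof -
  have s1: "s \<noteq> 1" "s \<noteq> 0" using s by auto
  define G where "G = (\<lambda>N t. \<Sum>n<N. of_real (1 - t) * s * pw (s + 1) (real n + (a + t)))"
  define J where "J = (\<lambda>N. (\<Sum>n<N. pw s (real n + a)) - (pw (s - 1) a - pw (s - 1) (real N + a)) / (s - 1))"
  have term1: "((\<lambda>t. of_real (1 - t) * s * pw (s + 1) (b + t) + pw s (b + t)) has_integral pw s b) {0..1}"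
    if b: "b > 0" for b
  proof -
    have "((\<lambda>t. of_real (1 - t) * s * pw (s + 1) (b + t) + pw s (b + t)) has_integral 
       ((- of_real (1 - 1)) * pw s (b + 1) - (- of_real (1 - 0)) * pw s (b + 0))) {0..1}"
    proof (rule fundamental_theorem_of_calculus)
      fix t :: real assume t: "t \<in> {0..1}"
      have "((\<lambda>t. (- of_real (1 - t)) :: complex) has_vector_derivative 1) (at t within {0..1})"
        by (auto intro!: derivative_eq_intros)
      from has_vector_derivative_mult[OF this pw_deriv[of b t s]]
      show "((\<lambda>t. - of_real (1 - t) * pw s (b + t)) has_vector_derivative
        of_real (1 - t) * s * pw (s + 1) (b + t) + pw s (b + t)) (at t within {0..1})"
        using b t by (simp add: algebra_simps)
    qed simp
    then show ?thesis by simp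
  qed
  have term2: "((\<lambda>t. pw s (b + t)) has_integral (pw (s - 1) b - pw (s - 1) (b + 1)) / (s - 1)) {0..1}"
    if b: "b > 0" for b
  proof -
    have "((\<lambda>t. pw s (b + t)) has_integral (- 1 / (s - 1)) * pw (s - 1) (b + 1) - (- 1 / (s - 1)) * pw (s - 1) (b + 0)) {0..1}"
    proof (rule fundamental_theorem_of_calculus)
      fix t :: real assume t: "t \<in> {0..1}"
      from has_vector_derivative_mult_right[OF pw_deriv[of b t "s - 1" "{0..1}"], of "- 1 / (s - 1)"]
      show "((\<lambda>t. - 1 / (s - 1) * pw (s - 1) (b + t)) has_vector_derivative pw s (b + t)) (at t within {0..1})"
        using b t s1 by (simp add: divide_simps minus_diff_eq[of s 1, symmetric] del: minus_diff_eq)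
    qed simp
    moreover have "(- 1 / (s - 1)) * pw (s - 1) (b + 1) - (- 1 / (s - 1)) * pw (s - 1) (b + 0)
      = (pw (s - 1) b - pw (s - 1) (b + 1)) / (s - 1)"
      using s1 by (simp add: divide_simps)
    ultimately show ?thesis by simp
  qed
  have G_int: "(G N has_integral J N) {0..1}" for N
  proof -
    have "((\<lambda>t. of_real (1 - t) * s * pw (s + 1) (real n + (a + t))) has_integral
        pw s (real n + a) - (pw (s - 1) (real n + a) - pw (s - 1) (real (Suc n) + a)) / (s - 1)) {0..1}" for n
      using has_integral_diff[OF term1[of "real n + a"] term2[of "real n + a"]] a
      by (simp add: add_ac)
    then have "(G N has_integral (\<Sum>n<N. pw s (real n + a) - (pw (s - 1) (real n + a) - pw (s - 1) (real (Suc n) + a)) / (s - 1))) {0..1}"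
      unfolding G_def by (intro has_integral_sum) auto
    also have "(\<Sum>n<N. pw s (real n + a) - (pw (s - 1) (real n + a) - pw (s - 1) (real (Suc n) + a)) / (s - 1)) = J N"
      using sum_lessThan_telescope'[of "\<lambda>n. pw (s - 1) (real n + a)" N]
      by (simp only: J_def sum_subtractf sum_divide_distrib[symmetric]) simp
    finally show ?thesis .
  qed
  have "uniform_limit {0..1} G (\<lambda>t. \<Sum>n. of_real (1 - t) * s * pw (s + 1) (real n + (a + t))) sequentially"
    unfolding G_def
  proof (rule Weierstrass_m_test)
    show "summable (\<lambda>n. norm s * (real n + 1) powr (- (Re s + 1)))"
      using s by (intro summable_mult summable_pw_bound) auto
    fix n and t :: real assume t: "t \<in> {0..1}"
    have "norm (of_real (1 - t) * s * pw (s + 1) (real n + (a + t)))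
       = \<bar>1 - t\<bar> * (norm s * norm (pw (s + 1) (real n + (a + t))))"
      unfolding norm_mult norm_of_real by simp
    also have "\<dots> \<le> 1 * (norm s * (real n + 1) powr (- (Re s + 1)))"
      using t a s by (intro mult_mono pw_bound) auto
    finally show "norm (of_real (1 - t) * s * pw (s + 1) (real n + (a + t))) 
       \<le> norm s * (real n + 1) powr (- (Re s + 1))" by simp
  qed
  moreover have "continuous_on {0..1} (G N)" for N
    unfolding G_def using a by (intro continuous_intros) auto
  ultimately obtain I K where IK: "\<And>N. (G N has_integral I N) {0..1}"
    "((\<lambda>t. \<Sum>n. of_real (1 - t) * s * pw (s + 1) (real n + (a + t))) has_integral K) {0..1}" "I \<longlonglongrightarrow> K"
    by (rule uniform_limit_integral) auto
  have "I = J" using IK(1) G_int has_integral_unique by blast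
  moreover have "J \<longlonglongrightarrow> (\<Sum>n. pw s (real n + a)) - (pw (s - 1) a - 0) / (s - 1)"
    unfolding J_def
  proof (intro tendsto_intros)
    show "(\<lambda>N. \<Sum>n<N. pw s (real n + a)) \<longlonglongrightarrow> (\<Sum>n. pw s (real n + a))"
      by (rule summable_LIMSEQ[OF summable_pw[OF s a]])
    have "(\<lambda>N. (real N + a) powr (- Re (s - 1))) \<longlonglongrightarrow> 0"
    proof (rule tendsto_neg_powr)
      show "filterlim (\<lambda>N. real N + a) at_top sequentially"
        by (simp add: filterlim_at_top_add_at_top filterlim_real_sequentially
            filterlim_tendsto_add_at_top[OF tendsto_const] add.commute)
    qed (use s in auto)
    then show "(\<lambda>N. pw (s - 1) (real N + a)) \<longlonglongrightarrow> 0"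
      by (subst tendsto_norm_zero_iff[symmetric]) (use a in \<open>simp add: norm_pw\<close>)
  qed (use s1 in auto)
  ultimately have K: "K = hz 0 s a"
    using IK(3) LIMSEQ_unique by fastforce
  have "of_real (1 - t) * (s * hz 0 (s + 1) (a + t) + pw s (a + t)) =
     (\<Sum>n. of_real (1 - t) * s * pw (s + 1) (real n + (a + t)))" if "t \<in> {0..1}" for t
    using suminf_mult[OF summable_pw[of "s + 1" "a + t"], of "of_real (1 - t) * s"] that s a s1
    by (simp add: algebra_simps)
  then have "hz (Suc 0) s a = integral {0..1} (\<lambda>t. \<Sum>n. of_real (1 - t) * s * pw (s + 1) (real n + (a + t)))"
    unfolding hz.simps(2) by (intro integral_cong) auto
  with IK(2) K show ?thesis by (simp add: integral_unique)
qed

lemma hz_step: "Re s > 1 - real k \<Longrightarrow> a \<ge> 1 \<Longrightarrow> hz (Suc k) s a = hz k s a"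
proof (induction k arbitrary: s a)
  case 0
  then show ?case using hz_step_0 by simp
next
  case (Suc k)
  have "hz (Suc (Suc k)) s a = integral {0..1} (\<lambda>t. of_real (1 - t) * (s * hz (Suc k) (s + 1) (a + t) + pw s (a + t)))"
    by (rule hz.simps(2))
  also have "\<dots> = integral {0..1} (\<lambda>t. of_real (1 - t) * (s * hz k (s + 1) (a + t) + pw s (a + t)))"
    by (rule integral_cong) (use Suc in \<open>auto simp del: hz.simps\<close>)
  finally show ?case by (simp only: hz.simps(2))
qed

lemma hz_stable:
  assumes "k \<le> j" "Re s > 1 - real k"
  shows "hz j s 1 = hz k s 1"
  using assms by (induction j rule: dec_induct) (auto simp: hz_step simp del: hz.simps)

lemma zeta_exists:
  "\<exists>f. f holomorphic_on - {1} \<and> (\<forall>s. Re s > 1 \<longrightarrow> (\<lambda>n. 1 / of_nat (Suc n) powr s) sums f s) \<and> f 1 = 0"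
proof -
  define f where "f = (\<lambda>s. if s = 1 then 0 else 1 / (s - 1) + hz (nat \<lceil>2 - Re s\<rceil>) s 1)"
  have eq: "f s = 1 / (s - 1) + hz k s 1" if "s \<noteq> 1" "Re s > 1 - real k" for s k
  proof -
    have "Re s > 1 - real (nat \<lceil>2 - Re s\<rceil>)" by linarith
    then have "hz (nat \<lceil>2 - Re s\<rceil>) s 1 = hz k s 1"
      using hz_stable that by (metis linear)
    then show ?thesis using that by (simp add: f_def)
  qed
  have 1: "f holomorphic_on {s. Re s > 2 - real k} - {1}" for k
  proof (rule holomorphic_transform)
    have "(\<lambda>s. hz k s 1) holomorphic_on {s. Re s > 2 - real k}"
      using hz_regular[of 2 k] by auto
    then show "(\<lambda>s. 1 / (s - 1) + hz k s 1) holomorphic_on {s. Re s > 2 - real k} - {1}"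
      by (intro holomorphic_intros) (auto elim: holomorphic_on_subset)
  qed (simp add: eq[symmetric] del: hz.simps)
  have "f holomorphic_on (\<Union>k. {s. Re s > 2 - real k} - {1})"
    by (rule holomorphic_on_UN_open) (use 1 in \<open>auto intro!: open_Diff simp: open_halfspace_Re_gt\<close>)
  moreover have "(\<Union>k. {s. Re s > 2 - real k} - {1}) = - {1}"
  proof -
    have "\<exists>k. Re s > 2 - real k" for s
      using reals_Archimedean2[of "2 - Re s"] by (auto simp: algebra_simps)
    then show ?thesis by auto
  qed
  ultimately have "f holomorphic_on - {1}" by simp
  moreover have "(\<lambda>n. 1 / of_nat (Suc n) powr s) sums f s" if s: "Re s > 1" for s
  proof -
    have "1 / of_nat (Suc n) powr s = pw s (real n + 1)" for n
      by (simp add: pw_eq_powr powr_minus divide_inverse add.commute)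
    moreover have "f s = (\<Sum>n. pw s (real n + 1))"
      using eq[of s 0] s by (cases "s = 1") (auto simp: pw_def)
    ultimately show ?thesis using summable_sums[OF summable_pw[OF s, of 1]] by simp
  qed
  ultimately show ?thesis by (intro exI[of _ f]) (simp add: f_def)
qed

lemma riemann_zeta_ex1:
  "\<exists>!f. f holomorphic_on - {1} \<and>
     (\<forall>s. Re s > 1 \<longrightarrow> (\<lambda>n. 1 / of_nat (Suc n) powr s) sums f s) \<and> f 1 = 0"
proof (rule ex_ex1I[OF zeta_exists])
  fix f g :: "complex \<Rightarrow> complex"
  assume f: "f holomorphic_on - {1} \<and> (\<forall>s. Re s > 1 \<longrightarrow> (\<lambda>n. 1 / of_nat (Suc n) powr s) sums f s) \<and> f 1 = 0"
    and g: "g holomorphic_on - {1} \<and> (\<forall>s. Re s > 1 \<longrightarrow> (\<lambda>n. 1 / of_nat (Suc n) powr s) sums g s) \<and> g 1 = 0"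
  have "f z = g z" if "z \<noteq> 1" for z
  proof (rule analytic_continuation_open[of "{s. Re s > 1}" "- {1}" f g z])
    have "2 \<in> {s. Re s > 1}" by simp
    then show "{s. Re s > 1} \<noteq> {}" by blast
    show "f w = g w" if "w \<in> {s. Re s > 1}" for w
      using that f g sums_unique2 by blast
  qed (use f g that in \<open>auto simp: open_halfspace_Re_gt connected_punctured_universe\<close>)
  then show "f = g" using f g by (metis ext)
qed

lemma
  shows riemann_zeta_holomorphic: "riemann_zeta holomorphic_on - {1}"
    and riemann_zeta_sums: "Re s > 1 \<Longrightarrow> (\<lambda>n. 1 / of_nat (Suc n) powr s) sums riemann_zeta s"
  using theI'[OF riemann_zeta_ex1] unfolding riemann_zeta_def[symmetric] by auto


subsection \<open>The functions \<open>T_op \<phi>\<close> are square-integrable\<close>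

lemma T_op_in_L2:
  assumes "\<phi> \<in> S0_le1"
  shows "T_op \<phi> \<in> L2_space (lebesgue_on {0<..<1})"
proof -
  let ?D = "\<lambda>x. vector_derivative \<phi> (at x)"
  have "\<phi> differentiable_on UNIV" "?D differentiable_on UNIV"
    using assms spec[of "\<lambda>n. ((\<lambda>g x. vector_derivative g (at x)) ^^ n) \<phi> differentiable_on UNIV" 0]
      spec[of "\<lambda>n. ((\<lambda>g x. vector_derivative g (at x)) ^^ n) \<phi> differentiable_on UNIV" 1]
    by (auto simp: S0_le1_def smooth_def)
  then have der: "(\<phi> has_vector_derivative ?D x) (at x)"
    and cD: "continuous_on UNIV ?D" and c\<phi>: "continuous_on UNIV \<phi>" for x
    by (auto simp: differentiable_on_def vector_derivative_works[symmetric] intro: differentiable_imp_continuous_on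
        simp: differentiable_imp_continuous_on)
  have int0: "integral {0..1} \<phi> = 0" using assms by (simp add: S0_le1_def)
  have van: "\<phi> x = 0" if "x > 1" for x
  proof (rule ccontr)
    assume "\<phi> x \<noteq> 0"
    then have "x \<in> closure {x. \<phi> x \<noteq> 0}" using closure_subset by fastforce
    with that assms show False by (auto simp: S0_le1_def)
  qed
  have integ: "\<phi> integrable_on {a..b}" for a b
    using integrable_continuous_interval continuous_on_subset[OF c\<phi>] by blast
  have "compact (?D ` {0..2})"
    using compact_continuous_image continuous_on_subset[OF cD] by blast
  then have "bounded (?D ` {0..2})" by (rule compact_imp_bounded)
  then obtain M where "\<forall>y \<in> ?D ` {0..2}. norm y \<le> M"
    by (auto simp only: bounded_iff)
  then have M: "\<And>x. x \<in> {0..2} \<Longrightarrow> norm (?D x) \<le> M" by simp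
  have M0: "M \<ge> 0" using order_trans[OF norm_ge_zero M[of 0]] by simp
  have lip: "norm (\<phi> x - \<phi> y) \<le> M * \<bar>x - y\<bar>" if "x \<in> {0..2}" "y \<in> {0..2}" for x y
  proof -
    have "norm (\<phi> x - \<phi> y) \<le> M * norm (x - y)"
  proof (rule differentiable_bound[where S="{0..2}" and f'="\<lambda>x h. h *\<^sub>R ?D x"])
    show "(\<phi> has_derivative (\<lambda>h. h *\<^sub>R ?D x)) (at x within {0..2})" for x
      using der[of x] unfolding has_vector_derivative_def by (rule has_derivative_at_withinI)
    show "onorm (\<lambda>h. h *\<^sub>R ?D x) \<le> M" if "x \<in> {0..2}" for x
      by (rule onorm_le) (use mult_left_mono[OF M[OF that] abs_ge_zero] in \<open>simp add: mult.commute\<close>)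
  qed (use that in auto)
    then show ?thesis by simp
  qed
  have bound: "norm (T_op \<phi> u) \<le> 2 * M" if u: "u \<in> {0<..<1}" for u
  proof -
    define N where "N = nat \<lceil>1 / u\<rceil>"
    have "1 / u > 0" using u by simp
    then have "1 / u \<le> real N" "real N < 1 / u + 1" unfolding N_def by linarith+
    then have Nu: "1 \<le> real N * u" "real N * u < 1 + u"
      using u by (auto simp: field_simps)
    have T: "T_op \<phi> u = (\<Sum>n<N. \<phi> (real (Suc n) * u))"
      unfolding T_op_def
    proof (rule suminf_finite)
      fix n assume "n \<notin> {..<N}"
      then have "real N * u < real (Suc n) * u" using u by simp
      then show "\<phi> (real (Suc n) * u) = 0" using Nu by (intro van) linarith
    qed simp
    have split: "integral {0..real m * u} \<phi> = (\<Sum>n<m. integral {real n * u..real (Suc n) * u} \<phi>)" for m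
    proof (induction m)
      case (Suc m)
      have "integral {0..real m * u} \<phi> + integral {real m * u..real (Suc m) * u} \<phi> = integral {0..real (Suc m) * u} \<phi>"
        by (rule Henstock_Kurzweil_Integration.integral_combine) (use u integ in \<open>auto simp: mult_right_mono\<close>)
      then show ?case using Suc by simp
    qed simp
    have "integral {1..real N * u} \<phi> = integral {1..real N * u} (\<lambda>_. 0)"
      by (rule integral_spike[of "{1}"]) (use van in auto)
    moreover have "integral {0..1} \<phi> + integral {1..real N * u} \<phi> = integral {0..real N * u} \<phi>"
      by (rule Henstock_Kurzweil_Integration.integral_combine) (use Nu integ in auto)
    ultimately have z: "integral {0..real N * u} \<phi> = 0" using int0 by simp
    have piece: "norm (u *\<^sub>R \<phi> (real (Suc n) * u) - integral {real n * u..real (Suc n) * u} \<phi>) \<le> M * u * u"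
      if n: "n < N" for n
    proof -
      have le: "real n * u \<le> real (Suc n) * u" "real (Suc n) * u \<le> real N * u"
        using u n by (auto intro!: mult_right_mono)
      have le2: "0 \<le> real n * u" using u by simp
      have eq: "u *\<^sub>R \<phi> (real (Suc n) * u) - integral {real n * u..real (Suc n) * u} \<phi>
        = integral {real n * u..real (Suc n) * u} (\<lambda>x. \<phi> (real (Suc n) * u) - \<phi> x)"
        using le integ by (subst integral_diff) (auto simp: algebra_simps)
      have "norm (integral {real n * u..real (Suc n) * u} (\<lambda>x. \<phi> (real (Suc n) * u) - \<phi> x))
        \<le> (M * u) * (real (Suc n) * u - real n * u)"
      proof (rule integral_bound[OF le(1)])
        show "continuous_on {real n * u..real (Suc n) * u} (\<lambda>x. \<phi> (real (Suc n) * u) - \<phi> x)"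
          by (intro continuous_intros continuous_on_subset[OF c\<phi>]) auto
        fix x assume x: "x \<in> {real n * u..real (Suc n) * u}"
        have "norm (\<phi> (real (Suc n) * u) - \<phi> x) \<le> M * \<bar>real (Suc n) * u - x\<bar>"
        proof (rule lip)
          have "real (Suc n) * u \<le> 2" "0 \<le> real (Suc n) * u" 
            using le le2 Nu u unfolding greaterThanLessThan_iff by linarith+
          then show "real (Suc n) * u \<in> {0..2}" "x \<in> {0..2}"
            using x le2 unfolding atLeastAtMost_iff by linarith+
        qed
        also have "\<dots> \<le> M * u" using x M0 by (intro mult_left_mono) (auto simp: algebra_simps)
        finally show "norm (\<phi> (real (Suc n) * u) - \<phi> x) \<le> M * u" .
      qed
      then show ?thesis unfolding eq by (simp add: algebra_simps)
    qed
    have "u *\<^sub>R T_op \<phi> u = (\<Sum>n<N. u *\<^sub>R \<phi> (real (Suc n) * u) - integral {real n * u..real (Suc n) * u} \<phi>)"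
      using z split[of N] by (simp add: T sum_subtractf scaleR_right.sum)
    also have "norm \<dots> \<le> (\<Sum>n<N. M * u * u)"
      by (rule sum_norm_le) (use piece in auto)
    finally have "u * norm (T_op \<phi> u) \<le> u * (M * (real N * u))" using u by (simp add: algebra_simps)
    then have "norm (T_op \<phi> u) \<le> M * (real N * u)" using u by simp
    also have "\<dots> \<le> M * 2" using Nu u M0 by (intro mult_left_mono) auto
    finally show ?thesis by simp
  qed
  have [measurable]: "\<phi> \<in> borel_measurable borel"
    using borel_measurable_continuous_onI c\<phi> by blast
  have "T_op \<phi> \<in> borel_measurable borel" unfolding T_op_def by measurable
  then have meas: "T_op \<phi> \<in> borel_measurable (lebesgue_on {0<..<1})"
    by (intro measurable_restrict_space1 measurable_completion) simp
  moreover have "integrable (lebesgue_on {0<..<1}) (\<lambda>u. (norm (T_op \<phi> u))\<^sup>2)"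
  proof (rule finite_measure.integrable_const_bound)
    show "finite_measure (lebesgue_on {0<..<1::real})"
      by (rule finite_measure_lebesgue_on) auto
    show "AE u in lebesgue_on {0<..<1}. norm ((norm (T_op \<phi> u))\<^sup>2) \<le> (2 * M)\<^sup>2"
      proof (rule AE_I2)
      fix u :: real assume "u \<in> space (lebesgue_on {0<..<1})"
      then have "(norm (T_op \<phi> u))\<^sup>2 \<le> (2 * M)\<^sup>2" by (intro power_mono bound) auto
      then show "norm ((norm (T_op \<phi> u))\<^sup>2) \<le> (2 * M)\<^sup>2" by simp
    qed
    show "(\<lambda>u. (norm (T_op \<phi> u))\<^sup>2) \<in> borel_measurable (lebesgue_on {0<..<1})"
      using meas by measurable
  qed
  ultimately show ?thesis by (simp add: L2_space_def)
qed

end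

theory Submission
  imports Defs "HOL-Probability.Characteristic_Functions" "HOL-Probability.Sinc_Integral"
begin

text \<open>
  For \<open>\<phi>\<close> in \<open>S0_le1\<close> the Mellin transform of \<open>T_op \<phi>\<close> is \<open>\<zeta>(s)\<close> times that of \<open>\<phi>\<close> on \<open>Re s > 0\<close>. If
  \<open>\<zeta>(\<rho>) = 0\<close> with \<open>Re \<rho> > 1/2\<close>, then every \<open>T_op \<phi>\<close> is orthogonal to the square-integrable function
  \<open>u \<mapsto> u powr (\<rho> - 1)\<close> (without conjugation), whereas the constant \<open>1\<close> is not.

  Conversely, let \<open>f\<close> be smooth with support in \<open>{0..1}\<close> and \<open>D(s) = (\<Sum>n\<le>N. c\<^sub>n n powr (- s))\<close>. The function
  \<open>\<phi>(u) = (\<Sum>n\<le>N. c\<^sub>n f(n u)) - D(1) f(u)\<close> lies in \<open>S0_le1\<close>, and \<open>T_op \<phi> - f\<close> has the Mellin transform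
  \<open>(\<zeta>(s) (D(s) - D(1)) - 1) F(s)\<close>, where \<open>F\<close> is the transform of \<open>f\<close> and decays rapidly. By the Plancherel
  inequality it suffices to make this small in \<open>L2\<close> of the critical line, with \<open>D\<close> close to \<open>1/\<zeta>(s + \<delta>)\<close>
  and then \<open>\<delta>\<close> to \<open>0\<close>; note that \<open>D(1)\<close> is then close to \<open>1/\<zeta>(1 + \<delta>)\<close>, which tends to \<open>0\<close>.
  For fixed \<open>\<delta>\<close>, one expands \<open>1/\<zeta>\<close> in its Taylor series around \<open>s + 3\<close>, which reaches \<open>s + \<delta>\<close> under RH, and
  whose coefficients are absolutely convergent Dirichlet series. For the limit \<open>\<delta> \<rightarrow> 0\<close>, the quotient
  \<open>\<zeta>(s)/\<zeta>(s + \<delta>)\<close> is bounded by a power of \<open>\<bar>s\<bar>\<close> uniformly in \<open>\<delta>\<close>: near \<open>s\<close>, split off the zeros of \<open>\<zeta>\<close>,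
  each of which is closer to \<open>s\<close> than to \<open>s + \<delta>\<close> as it is not to the right of the critical line, and
  apply Harnack's inequality to the zero-free factor. No functional equation is needed.
\<close>

text \<open>The constant is replaced by a smooth \<open>f\<close> because its Mellin transform
  decays faster than every power on the critical line; any polynomial bound for zeta and its
  quotients then suffices, however large the exponent. The obstacle is uniformity in \<delta>. The
  Taylor detour is taken because for small \<delta> the Dirichlet series of the reciprocal is not
  absolutely convergent at s + \<delta>, and bounding its truncations there would call for sharper
  growth estimates. The constants come from the crude coefficient bound, which gives absolute
  convergence for Re s > 3. Discs are therefore centred at 4 + it: radius 7/2 reaches the critical
  line, zeros are divided out in radius 4, and the bound must hold on a radius above 8, here 9,
  which takes zeta down to Re s = -5.\<close>

subsection \<open>Quotients of values of a holomorphic function\<close>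

text \<open>Harnack's inequality for the positive harmonic function
  \<open>1 + ln M - ln (norm (h z))\<close>, derived from the Schwarz lemma. The summand 1 keeps the
  function away from 0 even where \<open>norm (h z) = M\<close>.\<close>

lemma zero_free_lower_bound:
  fixes h :: "complex \<Rightarrow> complex"
  assumes hol: "h holomorphic_on ball z0 R" and nz: "\<And>z. z \<in> ball z0 R \<Longrightarrow> h z \<noteq> 0"
    and bd: "\<And>z. z \<in> ball z0 R \<Longrightarrow> norm (h z) \<le> M"
    and m: "0 < m" "m \<le> norm (h z0)" and w: "dist z0 w \<le> r" and r: "0 \<le> r" "r < R"
  shows "M * exp (- ((R + r) / (R - r)) * (1 + ln (M / m))) \<le> norm (h w)"
proof -
  have R: "R > 0" and z0: "z0 \<in> ball z0 R" and wb: "w \<in> ball z0 R" using r w by auto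
  have M: "0 < M" using bd[OF z0] m by linarith
  obtain g where g: "g holomorphic_on ball z0 R" "\<And>x. x \<in> ball z0 R \<Longrightarrow> exp (g x) = h x"
    using holomorphic_logarithm_exists[OF convex_ball open_ball hol nz z0] by auto
  have Reg: "Re (g x) = ln (norm (h x))" if "x \<in> ball z0 R" for x
    using g(2)[OF that, symmetric] by simp
  define G where "G z = of_real (1 + ln M) - g z + \<i> * of_real (Im (g z0))" for z
  define c where "c = 1 + ln M - ln (norm (h z0))"
  have ReG: "Re (G z) \<ge> 1" if "z \<in> ball z0 R" for z
    using Reg[OF that] bd[OF that] nz[OF that] M by (simp add: G_def)
  have Gz0: "G z0 = of_real c" using Reg[OF z0] by (simp add: G_def c_def complex_eq_iff)
  have c1: "c \<ge> 1" using ReG[OF z0] Gz0 by simp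
  have c2: "c \<le> 1 + ln (M / m)"
  proof -
    have "ln m \<le> ln (norm (h z0))" using m by (subst ln_le_cancel_iff) auto
    then show ?thesis using M m by (simp add: c_def ln_div)
  qed
  \<comment> \<open>A Cayley transform: it carries the right half-plane to the unit disc and
    \<open>c\<close> to 0, as the Schwarz lemma requires. Solving for \<open>G\<close> afterwards
    gives the factor (R + r) / (R - r).\<close>
  define f where "f \<xi> = (G (z0 + of_real R * \<xi>) - of_real c) / (G (z0 + of_real R * \<xi>) + of_real c)" for \<xi>
  have inb: "z0 + of_real R * \<xi> \<in> ball z0 R" if "norm \<xi> < 1" for \<xi>
    using that R by (simp add: dist_norm norm_mult)
  have nz': "G (z0 + of_real R * \<xi>) + of_real c \<noteq> 0" if "norm \<xi> < 1" for \<xi>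
    using ReG[OF inb[OF that]] c1 by (auto simp: complex_eq_iff)
  have "G holomorphic_on ball z0 R" unfolding G_def by (intro holomorphic_intros g)
  then have "(G \<circ> (\<lambda>\<xi>. z0 + of_real R * \<xi>)) holomorphic_on ball 0 1"
    by (intro holomorphic_on_compose_gen[of _ _ G "ball z0 R"] holomorphic_intros) (use inb in auto)
  then have fhol: "f holomorphic_on ball 0 1"
    unfolding f_def by (intro holomorphic_intros) (use nz' in \<open>auto simp: o_def\<close>)
  have f0: "f 0 = 0" by (simp add: f_def Gz0)
  have f1: "norm (f \<xi>) < 1" if "norm \<xi> < 1" for \<xi>
  proof -
    let ?g = "G (z0 + of_real R * \<xi>)"
    have "(Re ?g - c)\<^sup>2 < (Re ?g + c)\<^sup>2"
      using ReG[OF inb[OF that]] c1 by (simp add: power2_eq_square algebra_simps)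
    then have "norm (?g - of_real c) < norm (?g + of_real c)"
      by (simp add: cmod_def)
    then show ?thesis unfolding f_def norm_divide using nz'[OF that] by (simp add: divide_less_eq)
  qed
  define \<xi> where "\<xi> = (w - z0) / of_real R"
  have n\<xi>: "norm \<xi> \<le> r / R" "norm \<xi> < 1"
    using w r R by (auto simp: \<xi>_def norm_divide dist_norm norm_minus_commute divide_simps)
  have q1: "r / R < 1" using r R by simp
  have W: "norm (f \<xi>) \<le> r / R" using Schwarz_Lemma(1)[OF fhol f0 f1 n\<xi>(2)] n\<xi>(1) by linarith
  have wz: "z0 + of_real R * \<xi> = w" using R by (simp add: \<xi>_def)
  have "f \<xi> * (G w + of_real c) = G w - of_real c" using nz'[OF n\<xi>(2)] by (simp add: f_def wz)
  then have eq: "G w * (1 - f \<xi>) = of_real c * (1 + f \<xi>)" by (simp add: algebra_simps)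
  have "norm (G w) * (1 - r / R) \<le> norm (G w) * norm (1 - f \<xi>)"
    using W norm_triangle_ineq2[of 1 "f \<xi>"] by (intro mult_left_mono) auto
  also have "\<dots> = c * norm (1 + f \<xi>)" using eq c1 by (metis norm_mult norm_of_real abs_of_nonneg order_trans zero_le_one)
  also have "\<dots> \<le> c * (1 + r / R)" using W norm_triangle_ineq[of 1 "f \<xi>"] c1 by (intro mult_left_mono) auto
  finally have "norm (G w) \<le> c * (1 + r / R) / (1 - r / R)" using q1 by (subst pos_le_divide_eq) auto
  also have "(1 + r / R) / (1 - r / R) = (R + r) / (R - r)" using R r by (simp add: divide_simps)
  then have "c * (1 + r / R) / (1 - r / R) = c * ((R + r) / (R - r))" by (metis times_divide_eq_right)
  also have "\<dots> \<le> (1 + ln (M / m)) * ((R + r) / (R - r))" using c2 r by (intro mult_right_mono) auto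
  finally have Gw: "norm (G w) \<le> (R + r) / (R - r) * (1 + ln (M / m))" by (simp add: mult.commute)
  have "ln M - (R + r) / (R - r) * (1 + ln (M / m)) \<le> 1 + ln M - Re (G w)"
    using Gw complex_Re_le_cmod[of "G w"] by linarith
  also have "\<dots> = ln (norm (h w))" using Reg[OF wb] by (simp add: G_def)
  finally have "exp (ln M + (- ((R + r) / (R - r)) * (1 + ln (M / m)))) \<le> exp (ln (norm (h w)))" by simp
  then show ?thesis unfolding exp_add using M nz[OF wb] by simp
qed

text \<open>Dividing out the zeros in the small ball one at a time multiplies the bound on the large ball
  by a factor less than \<open>1\<close>, so the process stops; \<open>n\<close> bounds the number of steps.
  No zero lies to the right of \<open>s\<close>, so \<open>s'\<close> is farther from each of them.\<close>

lemma ratio_bound_aux: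
  fixes f :: "complex \<Rightarrow> complex"
  assumes r: "0 \<le> r" "r < R1" "2 * R1 < R" and m: "0 < m"
    and s: "dist z0 s \<le> r" "dist z0 s' \<le> r" "b \<le> Re s" "Re s \<le> Re s'" "Im s = Im s'"
    and f: "f holomorphic_on U" "open U" "cball z0 R \<subseteq> U"
    and bd: "\<And>z. z \<in> cball z0 R \<Longrightarrow> norm (f z) \<le> M" and fz0: "m \<le> norm (f z0)"
    and n: "M * (R1 / (R - R1)) ^ n < m"
    and zeros: "\<And>z. z \<in> ball z0 R1 \<Longrightarrow> f z = 0 \<Longrightarrow> Re z \<le> b"
  shows "norm (f s) \<le> exp (((R1 + r) / (R1 - r)) * (1 + ln (M / m))) * norm (f s')"
  using f bd fz0 n zeros
proof (induction n arbitrary: f M)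
  \<comment> \<open>No division left means \<open>M < m\<close>, which contradicts
    \<open>m \<le> norm (f z0) \<le> M\<close>.\<close>
  case 0
  then have "norm (f z0) \<le> M" using r by auto
  then show ?case using 0 by auto
next
  case (Suc n)
  have bd: "norm (f z) \<le> M" if "z \<in> cball z0 R" for z using Suc.prems(4) that by blast
  have M: "m \<le> M" using bd[of z0] Suc.prems(5) r by auto
  have sub: "ball z0 R1 \<subseteq> cball z0 R" using r by auto
  define q where "q = R1 / (R - R1)"
  have q: "0 < q" "q < 1" using r by (auto simp: q_def)
  show ?case
  proof (cases "\<exists>\<rho>\<in>ball z0 R1. f \<rho> = 0")
    case False
    have 1: "M * exp (- ((R1 + r) / (R1 - r)) * (1 + ln (M / m))) \<le> norm (f s')"
      by (rule zero_free_lower_bound[of f z0 R1 M m s' r])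
         (use False Suc.prems sub r m s bd in \<open>auto intro: holomorphic_on_subset\<close>)
    have "norm (f s) \<le> M" using bd s r by auto
    also have "M = exp ((R1 + r) / (R1 - r) * (1 + ln (M / m))) * (M * exp (- ((R1 + r) / (R1 - r)) * (1 + ln (M / m))))"
      by (simp add: exp_minus)
    also have "\<dots> \<le> exp ((R1 + r) / (R1 - r) * (1 + ln (M / m))) * norm (f s')"
      by (rule mult_left_mono[OF 1]) simp
    finally show ?thesis .
  next
    case True
    then obtain \<rho> where \<rho>: "\<rho> \<in> ball z0 R1" "f \<rho> = 0" by blast
    have ne: "z0 \<noteq> \<rho>" using \<rho> Suc.prems(5) m by auto
    \<comment> \<open>The factor \<open>z0 - \<rho>\<close> keeps the value at \<open>z0\<close>, so
      the lower bound \<open>m\<close> survives the division. On the circle of radius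
      \<open>R\<close> the quotient gains \<open>R1 / (R - R1)\<close>, which is below 1 because
      \<open>2 * R1 < R\<close>.\<close>
    define f1 where "f1 z = (z0 - \<rho>) * (if z = \<rho> then deriv f \<rho> else (f z - f \<rho>) / (z - \<rho>))" for z
    have hol1: "f1 holomorphic_on U"
      unfolding f1_def by (intro holomorphic_intros pole_lemma_open Suc.prems)
    have eq: "f z * (z0 - \<rho>) = (z - \<rho>) * f1 z" for z
      using \<rho> by (simp add: f1_def)
    have sph: "norm (f1 z) \<le> M * q" if "z \<in> frontier (cball z0 R)" for z
    proof -
      have z: "dist z0 z = R" using that r by auto
      have a: "norm (z - \<rho>) \<ge> R - R1" "norm (z0 - \<rho>) \<le> R1"
        using \<rho> z dist_triangle[of z0 z \<rho>] by (auto simp: dist_norm norm_minus_commute)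
      have "norm (f1 z) * (R - R1) \<le> norm (z - \<rho>) * norm (f1 z)"
        using a(1) by (subst mult.commute) (intro mult_right_mono, auto)
      also have "\<dots> = norm (f z) * norm (z0 - \<rho>)" by (metis eq norm_mult)
      also have "\<dots> \<le> M * R1" using bd[of z] z a M m by (intro mult_mono) auto
      finally show ?thesis using r by (simp add: q_def divide_simps)
    qed
    have bd1: "norm (f1 z) \<le> M * q" if "z \<in> cball z0 R" for z
    proof (rule maximum_modulus_frontier[of f1 "cball z0 R"])
      show "f1 holomorphic_on interior (cball z0 R)"
        using hol1 Suc.prems(3) by (meson holomorphic_on_subset interior_subset subset_trans)
      show "continuous_on (closure (cball z0 R)) f1"
        using hol1 Suc.prems(3) by (auto intro: holomorphic_on_imp_continuous_on holomorphic_on_subset)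
    qed (use sph that in auto)
    have IH: "norm (f1 s) \<le> exp ((R1 + r) / (R1 - r) * (1 + ln (M * q / m))) * norm (f1 s')"
    proof (rule Suc.IH[OF hol1 Suc.prems(2,3)])
      show "norm (f1 z) \<le> M * q" if "z \<in> cball z0 R" for z using bd1 that .
      show "m \<le> norm (f1 z0)" using Suc.prems(5) \<rho> ne by (simp add: f1_def)
      show "M * q * (R1 / (R - R1)) ^ n < m" using Suc.prems(6) by (simp add: q_def mult.assoc)
      show "Re z \<le> b" if "z \<in> ball z0 R1" "f1 z = 0" for z
        using Suc.prems(7)[OF that(1)] eq[of z] that(2) ne by auto
    qed
    have "M * q / m \<le> M / m" using q M m by (simp add: divide_simps)
    moreover have "0 < M * q / m" using q M m by simp
    ultimately have "ln (M * q / m) \<le> ln (M / m)" by simp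
    then have "exp ((R1 + r) / (R1 - r) * (1 + ln (M * q / m))) \<le> exp ((R1 + r) / (R1 - r) * (1 + ln (M / m)))"
      using r by (intro exp_le_cancel_iff[THEN iffD2] mult_left_mono) auto
    with IH have IH': "norm (f1 s) \<le> exp ((R1 + r) / (R1 - r) * (1 + ln (M / m))) * norm (f1 s')"
      by (meson mult_right_mono norm_ge_zero order_trans)
    have Re\<rho>: "Re \<rho> \<le> b" using Suc.prems(7) \<rho> by blast
    have "\<bar>Re (s - \<rho>)\<bar> \<le> \<bar>Re (s' - \<rho>)\<bar>" "Im (s - \<rho>) = Im (s' - \<rho>)"
      using s Re\<rho> by auto
    then have dist: "norm (s - \<rho>) \<le> norm (s' - \<rho>)"
      unfolding cmod_def by (metis add_right_mono power2_abs power_mono abs_ge_zero real_sqrt_le_iff)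
    have "norm (f s) * norm (z0 - \<rho>) = norm (s - \<rho>) * norm (f1 s)" by (metis eq norm_mult)
    also have "\<dots> \<le> norm (s' - \<rho>) * (exp ((R1 + r) / (R1 - r) * (1 + ln (M / m))) * norm (f1 s'))"
      using dist IH' by (intro mult_mono) auto
    also have "\<dots> = exp ((R1 + r) / (R1 - r) * (1 + ln (M / m))) * (norm (f s') * norm (z0 - \<rho>))"
      by (metis eq norm_mult mult.left_commute)
    finally show ?thesis using ne by simp
  qed
qed

lemma ratio_bound:
  fixes f :: "complex \<Rightarrow> complex"
  assumes r: "0 \<le> r" "r < R1" "2 * R1 < R" and m: "0 < m" "m \<le> norm (f z0)"
    and s: "dist z0 s \<le> r" "dist z0 s' \<le> r" "b \<le> Re s" "Re s \<le> Re s'" "Im s = Im s'"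
    and f: "f holomorphic_on U" "open U" "cball z0 R \<subseteq> U"
    and bd: "\<And>z. z \<in> cball z0 R \<Longrightarrow> norm (f z) \<le> M"
    and zeros: "\<And>z. z \<in> ball z0 R1 \<Longrightarrow> f z = 0 \<Longrightarrow> Re z \<le> b"
  shows "norm (f s) \<le> exp (((R1 + r) / (R1 - r)) * (1 + ln (M / m))) * norm (f s')"
proof -
  have "(\<lambda>n. M * (R1 / (R - R1)) ^ n) \<longlonglongrightarrow> M * 0"
    using r by (intro tendsto_intros LIMSEQ_power_zero) auto
  then have "eventually (\<lambda>n. M * (R1 / (R - R1)) ^ n < m) sequentially"
    using m by (intro order_tendstoD) auto
  then obtain n where "M * (R1 / (R - R1)) ^ n < m" by (auto simp: eventually_sequentially)
  from ratio_bound_aux[OF r m(1) s f bd m(2) this zeros] show ?thesis by blast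
qed

subsection \<open>Growth of the zeta function and of its reciprocal\<close>

text \<open>Both sides are holomorphic on the punctured half-plane and agree for Re s > 1, where
  every level of \<open>hz\<close> equals level 0.\<close>

lemma zeta_eq_hz:
  assumes "Re s > 1 - real k" "s \<noteq> 1"
  shows "riemann_zeta s = 1 / (s - 1) + hz k s 1"
proof -
  have eq1: "riemann_zeta z = 1 / (z - 1) + hz k z 1" if z: "Re z > 1" for z
  proof -
    have "hz k z 1 = hz 0 z 1" using hz_stable[of 0 k z] z by simp
    moreover have "riemann_zeta z = (\<Sum>n. pw z (real n + 1))"
      using sums_unique[OF riemann_zeta_sums[OF z]]
      by (simp add: pw_eq_powr powr_minus divide_inverse add.commute)
    ultimately show ?thesis using z by (auto simp: pw_def)
  qed
  show ?thesis
  proof (rule analytic_continuation_open[of "{s. Re s > 1}" "{s. Re s > 1 - real k} - {1}" riemann_zeta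
        "\<lambda>s. 1 / (s - 1) + hz k s 1" s])
    show "open ({s. Re s > 1 - real k} - {1})" by (intro open_Diff) (auto simp: open_halfspace_Re_gt)
    show "connected ({s. Re s > 1 - real k} - {1::complex})"
      by (intro connected_open_delete) (auto simp: open_halfspace_Re_gt convex_halfspace_Re_gt intro!: convex_connected)
    have "(\<lambda>s. hz k s 1) holomorphic_on {s. Re s > 1 - real k}"
    proof -
      \<comment> \<open>\<open>hz_regular\<close> covers only Re s > \<sigma> - k with \<sigma> > 1,
        so the half-plane is exhausted by \<sigma> = 1 + 1/(n + 1).\<close>
      have "(\<lambda>s. hz k s 1) holomorphic_on (\<Union>n. {s. Re s > 1 + 1 / real (Suc n) - real k})"
        by (rule holomorphic_on_UN_open)
           (use hz_regular[of "1 + 1 / real (Suc _)" k] in \<open>auto simp: open_halfspace_Re_gt\<close>)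
      moreover have "\<exists>n. Re z > 1 + 1 / real (Suc n) - real k" if "Re z > 1 - real k" for z
        using reals_Archimedean[of "Re z - (1 - real k)"] that by (auto simp: divide_inverse algebra_simps)
      ultimately show ?thesis by (auto elim!: holomorphic_on_subset)
    qed
    then show "(\<lambda>s. 1 / (s - 1) + hz k s 1) holomorphic_on {s. Re s > 1 - real k} - {1}"
      by (intro holomorphic_intros) (auto elim: holomorphic_on_subset)
    show "riemann_zeta holomorphic_on {s. Re s > 1 - real k} - {1}"
      using riemann_zeta_holomorphic by (rule holomorphic_on_subset) auto
    have "2 \<in> {s::complex. Re s > 1}" by simp
    then show "{s::complex. Re s > 1} \<noteq> {}" by blast
  qed (use assms eq1 in \<open>auto simp: open_halfspace_Re_gt\<close>)
qed

text \<open>Every level of the recursion costs one factor s, whence the exponent k. The bound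
  \<open>A\<close> is generalised in the induction because the recursion moves \<open>a\<close> up
  by at most 1, and because \<open>pw s (a + t)\<close> may grow with \<open>a\<close> once Re s is
  negative.\<close>

lemma hz_polynomial_growth:
  "\<exists>C\<ge>0. \<forall>s a. Re s \<ge> 2 - real k \<and> 1 \<le> a \<and> a \<le> A \<longrightarrow> norm (hz k s a) \<le> C * (1 + norm s) ^ k"
proof (induction k arbitrary: A)
  case 0
  have "norm (hz 0 s a) \<le> (\<Sum>n. (real n + 1) powr (- 2)) + 1" if "Re s \<ge> 2" "1 \<le> a" for s a
  proof -
    have "norm (\<Sum>n. pw s (real n + a)) \<le> (\<Sum>n. (real n + 1) powr (- 2))"
      by (rule norm_suminf_le[OF _ summable_pw_bound]) (use that in \<open>auto intro!: pw_bound\<close>)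
    moreover have "norm (pw (s - 1) a / (s - 1)) \<le> 1 / 1"
      unfolding norm_divide
    proof (rule frac_le)
      show "norm (pw (s - 1) a) \<le> 1" using that powr_mono2'[of "- Re (s - 1)" 1 a] by (simp add: norm_pw)
      show "1 \<le> norm (s - 1)" using that complex_Re_le_cmod[of "s - 1"] by simp
    qed auto
    ultimately show ?thesis unfolding hz.simps by (intro order_trans[OF norm_triangle_ineq4] add_mono) auto
  qed
  moreover have "0 \<le> (\<Sum>n. (real n + 1) powr (- 2)) + 1"
    by (intro add_nonneg_nonneg suminf_nonneg summable_pw_bound) auto
  ultimately show ?case by (intro exI[of _ "(\<Sum>n. (real n + 1) powr (- 2)) + 1"]) auto
next
  case (Suc k)
  obtain C where C: "C \<ge> 0" "\<And>s a. Re s \<ge> 2 - real k \<Longrightarrow> 1 \<le> a \<Longrightarrow> a \<le> A + 1 \<Longrightarrow> norm (hz k s a) \<le> C * (1 + norm s) ^ k"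
    using Suc[of "A + 1"] by blast
  define B where "B = max 1 (A + 1) powr real k"
  have B: "B \<ge> 1" unfolding B_def by (rule ge_one_powr_ge_zero) auto
  have "norm (hz (Suc k) s a) \<le> (C * 2 ^ k + B) * (1 + norm s) ^ Suc k"
    if s: "Re s \<ge> 2 - real (Suc k)" and a: "1 \<le> a" "a \<le> A" for s a
  proof -
    have c1: "continuous_on {0..1} (\<lambda>t. hz k (s + 1) (a + t))"
    proof -
      \<comment> \<open>Any number strictly between 1 and 2 would do: the closed half-plane of the
        claim has to lie inside the open one.\<close>
      have "continuous_on ({s. Re s > 3/2 - real k} \<times> {1..}) (\<lambda>(s,a). hz k s a)"
        using hz_regular[of "3/2" k] by simp
      then have "continuous_on {0..1} (\<lambda>t. (\<lambda>(s,a). hz k s a) (s + 1, a + t))"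
        by (rule continuous_on_compose2) (use s a in \<open>auto intro!: continuous_intros\<close>)
      then show ?thesis by simp
    qed
    have bd: "norm (of_real (1 - t) * (s * hz k (s + 1) (a + t) + pw s (a + t))) \<le> (C * 2 ^ k + B) * (1 + norm s) ^ Suc k"
      if t: "t \<in> {0..1}" for t
    proof -
      have n1: "norm (s + 1) \<le> norm s + 1" using norm_triangle_ineq[of s 1] by simp
      then have n2: "1 + norm (s + 1) \<le> 2 * (1 + norm s)" using norm_ge_zero[of s] by argo
      have "norm (hz k (s + 1) (a + t)) \<le> C * (1 + norm (s + 1)) ^ k"
        using s a t by (intro C) auto
      also have "\<dots> \<le> C * (2 * (1 + norm s)) ^ k"
        using C(1) n2 by (intro mult_left_mono power_mono) auto
      finally have h: "norm (hz k (s + 1) (a + t)) \<le> C * 2 ^ k * (1 + norm s) ^ k" by (simp only: power_mult_distrib mult.assoc)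
      have "norm (pw s (a + t)) \<le> (a + t) powr real k"
        using a t s by (subst norm_pw) (auto intro!: powr_mono)
      also have "\<dots> \<le> B" unfolding B_def using a t by (intro powr_mono2) auto
      also have "\<dots> \<le> B * (1 + norm s) ^ Suc k"
        using mult_left_mono[of 1 "(1 + norm s) ^ Suc k" B] one_le_power[of "1 + norm s" "Suc k"] B by simp
      finally have p: "norm (pw s (a + t)) \<le> B * (1 + norm s) ^ Suc k" .
      have "norm (s * hz k (s + 1) (a + t)) \<le> (1 + norm s) * (C * 2 ^ k * (1 + norm s) ^ k)"
        unfolding norm_mult using h by (intro mult_mono) auto
      with p have "norm (s * hz k (s + 1) (a + t) + pw s (a + t)) \<le> (C * 2 ^ k + B) * (1 + norm s) ^ Suc k"
        by (intro order_trans[OF norm_triangle_ineq]) (simp add: algebra_simps)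
      moreover have "norm (of_real (1 - t) :: complex) \<le> 1" using t by (simp del: of_real_diff)
      ultimately show ?thesis unfolding norm_mult
        using mult_mono[of _ 1 _ "(C * 2 ^ k + B) * (1 + norm s) ^ Suc k"] by fastforce
    qed
    have "norm (integral {0..1} (\<lambda>t. of_real (1 - t) * (s * hz k (s + 1) (a + t) + pw s (a + t)))) \<le> (C * 2 ^ k + B) * (1 + norm s) ^ Suc k * (1 - 0)"
      by (rule integral_bound) (use bd a in \<open>auto intro!: continuous_intros c1\<close>)
    then show ?thesis by simp
  qed
  moreover have "C * 2 ^ k + B \<ge> 0" using C B by simp
  ultimately show ?case by blast
qed

section \<open>The Dirichlet series of the reciprocal of zeta\<close>

text \<open>The coefficients of the Dirichlet series of the reciprocal of the zeta function. They are the values of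
  the Moebius function, but the bound by \<open>n\<^sup>2\<close> that the recursion gives at once is enough here.\<close>

fun zinv :: "nat \<Rightarrow> real" where
  "zinv n = (if n = 1 then 1 else - (\<Sum>d | d dvd n \<and> d < n. zinv d))"

declare zinv.simps [simp del]

lemma sum_zinv_divisors:
  assumes "n > 0"
  shows "(\<Sum>d | d dvd n. zinv d) = (if n = 1 then 1 else 0)"
proof -
  have "{d. d dvd n} = insert n {d. d dvd n \<and> d < n}"
    using assms by (auto dest: dvd_imp_le simp: le_less)
  moreover have "finite {d. d dvd n \<and> d < n}" by simp
  ultimately have eq: "(\<Sum>d | d dvd n. zinv d) = zinv n + (\<Sum>d | d dvd n \<and> d < n. zinv d)" by simp
  show ?thesis
  proof (cases "n = 1")
    case True
    then show ?thesis by (simp add: zinv.simps)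
  next
    case False
    then show ?thesis unfolding eq by (subst zinv.simps) simp
  qed
qed

text \<open>Comparison with the telescoping sum of 1/(k - 1) - 1/k. The constant 1 is exactly what
  lets the induction in \<open>abs_zinv_le\<close> close.\<close>

lemma sum_inverse_squares_le: "(\<Sum>k=2..n. 1 / (real k)\<^sup>2) \<le> 1"
proof -
  have "(\<Sum>k=2..Suc n. 1 / (real k)\<^sup>2) \<le> 1 - 1 / real (Suc n)" for n
  proof (induction n)
    case (Suc n)
    have "1 / (real (Suc (Suc n)))\<^sup>2 \<le> 1 / real (Suc n) - 1 / real (Suc (Suc n))"
      by (simp add: divide_simps power2_eq_square)
    then show ?case using Suc by simp
  qed simp
  from this[of "n - 1"] show ?thesis by (cases n) (auto intro: order_trans)
qed

text \<open>The proper divisors of n are the n/k with k at least 2 dividing n, so their squares add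
  up to at most \<open>n\<^sup>2\<close> times the sum of the 1/\<open>k\<^sup>2\<close>.\<close>

lemma abs_zinv_le: "\<bar>zinv n\<bar> \<le> (real n)\<^sup>2"
proof (induction n rule: less_induct)
  case (less n)
  consider "n = 0" | "n = 1" | "n > 1" by linarith
  then show ?case
  proof cases
    case 1 
    then show ?thesis by (subst zinv.simps) auto
  next
    case 2
    then show ?thesis by (simp add: zinv.simps)
  next
    case 3
    have "\<bar>zinv n\<bar> \<le> (\<Sum>d | d dvd n \<and> d < n. \<bar>zinv d\<bar>)"
      using 3 by (subst zinv.simps) (simp add: sum_abs)
    also have "\<dots> \<le> (\<Sum>d | d dvd n \<and> d < n. (real d)\<^sup>2)" by (rule sum_mono) (use less in auto)
    also have "\<dots> = (\<Sum>d | d dvd n \<and> d < n. (real n)\<^sup>2 * (1 / (real (n div d))\<^sup>2))"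
    proof (rule sum.cong[OF refl])
      fix d assume "d \<in> {d. d dvd n \<and> d < n}"
      then have "real n = real (n div d) * real d" "n div d \<noteq> 0"
        using 3 by (auto simp flip: of_nat_mult) 
      then show "(real d)\<^sup>2 = (real n)\<^sup>2 * (1 / (real (n div d))\<^sup>2)"
        by (simp add: power_mult_distrib)
    qed
    also have "\<dots> = (real n)\<^sup>2 * (\<Sum>k\<in>(\<lambda>d. n div d) ` {d. d dvd n \<and> d < n}. 1 / (real k)\<^sup>2)"
    proof -
      have "inj_on (\<lambda>d. n div d) {d. d dvd n \<and> d < n}"
        using 3 by (intro inj_on_inverseI[of _ "\<lambda>k. n div k"]) (auto elim!: dvdE)
      then show ?thesis by (simp add: sum.reindex sum_distrib_left)
    qed
    also have "\<dots> \<le> (real n)\<^sup>2 * (\<Sum>k=2..n. 1 / (real k)\<^sup>2)"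
    proof (intro mult_left_mono sum_mono2)
      show "(\<lambda>d. n div d) ` {d. d dvd n \<and> d < n} \<subseteq> {2..n}"
      proof clarify
        fix d assume d: "d dvd n" "d < n"
        then obtain k where k: "n = d * k" by blast
        with d 3 have "k \<noteq> 0" "k \<noteq> 1" "d > 0" by auto
        then show "n div d \<in> {2..n}" using k by auto
      qed
    qed auto
    also have "\<dots> \<le> (real n)\<^sup>2" using sum_inverse_squares_le[of n] by (intro mult_left_le) auto
    finally show ?thesis .
  qed
qed

lemma pw_mult: "a > 0 \<Longrightarrow> b > 0 \<Longrightarrow> pw s (a * b) = pw s a * pw s b"
  by (simp add: pw_def ln_mult distrib_left flip: exp_add)

lemma norm_zinv_pw_le:
  "norm (of_real (zinv (Suc n)) * pw s (real (Suc n))) \<le> (real n + 1) powr (- (Re s - 2))"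
proof -
  have "norm (of_real (zinv (Suc n)) * pw s (real (Suc n))) \<le> (real (Suc n))\<^sup>2 * real (Suc n) powr (- Re s)"
    unfolding norm_mult by (intro mult_mono) (use abs_zinv_le[of "Suc n"] in \<open>auto simp: norm_pw simp del: of_nat_Suc\<close>)
  also have "\<dots> = real (Suc n) powr (2 - Re s)"
    by (simp add: powr_diff powr_minus divide_inverse del: of_nat_Suc)
  finally show ?thesis by (simp add: add.commute)
qed

text \<open>The two absolutely convergent series are multiplied and regrouped by the product k of
  the indices; the sum of \<open>zinv\<close> over the divisors of k vanishes except at k = 1. That
  the product is 1 also yields the nonvanishing.\<close>

lemma zinv_sums:
  assumes s: "Re s > 3"
  shows "(\<lambda>n. of_real (zinv (Suc n)) * pw s (real (Suc n))) sums (1 / riemann_zeta s)"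
    and riemann_zeta_nonzero_right: "riemann_zeta s \<noteq> 0"
proof -
  define a where "a n = of_real (zinv (Suc n)) * pw s (real (Suc n))" for n
  define b where "b n = pw s (real (Suc n))" for n
  have sa: "summable (\<lambda>n. norm (a n))"
    by (rule summable_comparison_test'[OF summable_pw_bound[of "Re s - 2"]])
       (use s norm_zinv_pw_le in \<open>auto simp: a_def\<close>)
  have sb: "summable (\<lambda>n. norm (b n))"
    by (rule summable_comparison_test'[OF summable_pw_bound[of "Re s"]])
       (use s pw_bound[of "Re s" s 1] in \<open>auto simp: b_def add.commute\<close>)
  have b_sums: "b sums riemann_zeta s"
    using riemann_zeta_sums[of s] s unfolding b_def
    by (simp add: pw_eq_powr powr_minus divide_inverse)
  have ha: "(a has_sum suminf a) UNIV"
    using norm_summable_imp_has_sum[OF sa] summable_norm_cancel[OF sa] by blast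
  have hb: "(b has_sum riemann_zeta s) UNIV"
    by (rule norm_summable_imp_has_sum[OF sb b_sums])
  have "(\<lambda>p. norm (a (fst p) * b (snd p))) summable_on UNIV \<times> UNIV"
    unfolding Infinite_Sum.abs_summable_on_Sigma_iff
  proof (intro conjI ballI)
    have nb: "(\<lambda>y. norm (b y)) summable_on UNIV" and na: "(\<lambda>y. norm (a y)) summable_on UNIV"
      using sa sb by (auto simp: summable_on_UNIV_nonneg_real_iff)
    show "(\<lambda>y. norm (a (fst (x, y)) * b (snd (x, y)))) summable_on UNIV" for x
      using nb by (simp add: norm_mult summable_on_cmult_right)
    have "(\<lambda>x. norm (a x) * infsum (\<lambda>y. norm (b y)) UNIV) summable_on UNIV"
      using na by (rule summable_on_cmult_left)
    then show "(\<lambda>x. norm (\<Sum>\<^sub>\<infinity>y\<in>UNIV. norm (a (fst (x, y)) * b (snd (x, y))))) summable_on UNIV"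
      by (simp add: norm_mult infsum_cmult_right' abs_mult infsum_nonneg)
  qed
  then have sum2: "(\<lambda>p. a (fst p) * b (snd p)) summable_on UNIV \<times> UNIV"
    by (rule Infinite_Sum.abs_summable_summable)
  have prod: "((\<lambda>p. a (fst p) * b (snd p)) has_sum (suminf a * riemann_zeta s)) (UNIV \<times> UNIV)"
  proof (rule has_sum_SigmaI[OF _ _ sum2])
    show "((\<lambda>y. a (fst (x, y)) * b (snd (x, y))) has_sum (a x * riemann_zeta s)) UNIV" for x
      using has_sum_cmult_right[OF hb] by simp
    show "((\<lambda>x. a x * riemann_zeta s) has_sum suminf a * riemann_zeta s) UNIV"
      by (rule has_sum_cmult_left[OF ha])
  qed
  let ?f = "\<lambda>p. of_real (zinv (snd p)) * pw s (real (fst p))"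
  let ?S = "Sigma {1..} (\<lambda>k::nat. {d. d dvd k})"
  \<comment> \<open>Both series are indexed from 0, so (i, j) stands for the divisor d = i + 1 of k
    = (i + 1)(j + 1).\<close>
  have "((\<lambda>p. a (fst p) * b (snd p)) has_sum (suminf a * riemann_zeta s)) (UNIV \<times> UNIV)
     = (?f has_sum (suminf a * riemann_zeta s)) ?S"
  proof (rule has_sum_reindex_bij_witness[where j = "\<lambda>(i, j). (Suc i * Suc j, Suc i)" and i = "\<lambda>(k, d). (d - 1, k div d - 1)"])
    fix p assume "p \<in> ?S"
    then obtain k d where p: "p = (k, d)" "k \<ge> 1" "d dvd k" by auto
    then obtain e where e: "k = d * e" by blast
    with p have "d > 0" "e > 0" by auto
    then obtain i j where "d = Suc i" "e = Suc j" by (metis not0_implies_Suc less_numeral_extra(3))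
    then show "(case (case p of (k, d) \<Rightarrow> (d - 1, k div d - 1)) of (i, j) \<Rightarrow> (Suc i * Suc j, Suc i)) = p"
      using p e by (simp del: mult_Suc mult_Suc_right)
  next
    fix p :: "nat \<times> nat"
    obtain i j where p: "p = (i, j)" by force
    have "pw s (real (Suc i * Suc j)) = pw s (real (Suc i)) * pw s (real (Suc j))"
      unfolding of_nat_mult by (rule pw_mult) auto
    then show "?f (case p of (i, j) \<Rightarrow> (Suc i * Suc j, Suc i)) = a (fst p) * b (snd p)"
      by (simp add: p a_def b_def del: of_nat_Suc of_nat_mult)
  qed (auto split: prod.splits simp del: mult_Suc mult_Suc_right)
  with prod have "(?f has_sum (suminf a * riemann_zeta s)) ?S" by simp
  then have "((\<lambda>k. if k = 1 then 1 else 0) has_sum (suminf a * riemann_zeta s)) {1::nat..}"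
  proof (rule has_sum_SigmaD)
    fix k :: nat assume k: "k \<in> {1..}"
    show "((\<lambda>d. ?f (k, d)) has_sum (if k = 1 then 1 else 0)) {d. d dvd k}"
    proof (rule has_sum_finiteI)
      show "finite {d. d dvd k}" using k by simp
      have "(\<Sum>d | d dvd k. ?f (k, d)) = of_real (\<Sum>d | d dvd k. zinv d) * pw s (real k)"
        by (simp add: sum_distrib_right)
      also have "\<dots> = (if k = 1 then 1 else 0)"
        using k by (subst sum_zinv_divisors) (auto simp: pw_def)
      finally show "(if k = 1 then 1 else 0) = (\<Sum>d | d dvd k. ?f (k, d))" ..
    qed
  qed
  moreover have "((\<lambda>k. if k = 1 then 1 else 0) has_sum (1::complex)) {1::nat..}"
    by (rule has_sum_finite_neutralI[of "{1}"]) auto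
  ultimately have eq: "suminf a * riemann_zeta s = 1" by (rule has_sum_unique)
  then show "riemann_zeta s \<noteq> 0" by auto
  have "suminf a = 1 / riemann_zeta s" using eq by (metis nonzero_mult_div_cancel_right mult_zero_right zero_neq_one)
  moreover have "a = (\<lambda>n. of_real (zinv (Suc n)) * pw s (real (Suc n)))"
    by (rule ext) (rule a_def)
  ultimately show "(\<lambda>n. of_real (zinv (Suc n)) * pw s (real (Suc n))) sums (1 / riemann_zeta s)"
    using summable_sums[OF summable_norm_cancel[OF sa]] by simp
qed

section \<open>Zeta with its pole removed: bounds on discs about 4 + it\<close>

text \<open>The value 1 at the pole is the residue of zeta, which makes the function holomorphic
  there; discs containing 1 then need no exception.\<close>

definition zreg :: "complex \<Rightarrow> complex" where
  "zreg s = (if s = 1 then 1 else (s - 1) * riemann_zeta s)"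

text \<open>Level 8 reaches further left than the discs of radius 9 about 4 + it require.\<close>

lemma zreg_eq: "Re s > - 7 \<Longrightarrow> zreg s = 1 + (s - 1) * hz 8 s 1"
  using zeta_eq_hz[of 8 s] by (simp add: zreg_def algebra_simps del: hz.simps)

lemma riemann_zeta_1 [simp]: "riemann_zeta 1 = 0"
  using theI'[OF riemann_zeta_ex1] unfolding riemann_zeta_def[symmetric] by auto

text \<open>Also at \<open>s = 1\<close>, as \<open>riemann_zeta 1 = 0\<close> and \<open>1 / 0 = 0\<close>.\<close>

lemma inverse_zeta_eq: "1 / riemann_zeta s = (s - 1) / zreg s"
  by (simp add: zreg_def)

lemma zreg_holomorphic: "zreg holomorphic_on {s. Re s > - 6}"
proof (rule holomorphic_transform)
  show "(\<lambda>s. 1 + (s - 1) * hz 8 s 1) holomorphic_on {s. Re s > - 6}"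
    using hz_regular[of 2 8] by (intro holomorphic_intros) auto
qed (auto simp: zreg_eq simp del: hz.simps)

text \<open>The exponent 9 counts eight levels of \<open>hz\<close> and the factor s - 1; the 14 in
  the proof is 1 + 4 + 9, from the centre and the radius.\<close>

lemma zreg_growth: "\<exists>C\<ge>1. \<forall>t z. z \<in> cball (Complex 4 t) 9 \<longrightarrow> norm (zreg z) \<le> C * (1 + \<bar>t\<bar>) ^ 9"
proof -
  obtain C where C: "C \<ge> 0" "\<And>s. Re s \<ge> - 6 \<Longrightarrow> norm (hz 8 s 1) \<le> C * (1 + norm s) ^ 8"
    using hz_polynomial_growth[of 8 1] by auto
  have "norm (zreg z) \<le> (1 + C) * 14 ^ 9 * (1 + \<bar>t\<bar>) ^ 9" if z: "z \<in> cball (Complex 4 t) 9" for z t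
  proof -
    have "\<bar>Re (z - Complex 4 t)\<bar> \<le> 9" using z abs_Re_le_cmod[of "z - Complex 4 t"] by (simp add: dist_norm norm_minus_commute)
    then have Re: "Re z \<ge> - 6" by simp
    have "norm (Complex 4 t) \<le> 4 + \<bar>t\<bar>" using cmod_le[of "Complex 4 t"] by simp
    moreover have "norm z \<le> norm (Complex 4 t) + 9"
      using z norm_triangle_ineq2[of z "Complex 4 t"] by (simp add: dist_norm norm_minus_commute)
    ultimately have nz: "1 + norm z \<le> 14 * (1 + \<bar>t\<bar>)" by simp
    have "norm (zreg z) \<le> norm (1::complex) + norm (z - 1) * norm (hz 8 z 1)"
      using zreg_eq[of z] Re norm_triangle_ineq[of 1 "(z - 1) * hz 8 z 1"] by (simp add: norm_mult del: hz.simps)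
    also have "\<dots> \<le> (1 + norm z) ^ 9 + (1 + norm z) * (C * (1 + norm z) ^ 8)"
      using C(2)[OF Re] norm_triangle_ineq4[of z 1] C(1)
      by (intro add_mono mult_mono) (auto simp del: hz.simps intro: one_le_power)
    also have "\<dots> = (1 + C) * (1 + norm z) ^ 9" by (simp add: eval_nat_numeral algebra_simps)
    also have "\<dots> \<le> (1 + C) * (14 * (1 + \<bar>t\<bar>)) ^ 9"
      using C nz by (intro mult_left_mono power_mono) auto
    finally show ?thesis by (simp only: power_mult_distrib mult.assoc)
  qed
  moreover have "(1 + C) * 14 ^ 9 \<ge> 1" using C by simp
  ultimately show ?thesis by blast
qed

lemma norm_inverse_zeta_le:
  assumes "Re s = 4"
  shows "norm (1 / riemann_zeta s) \<le> (\<Sum>n. (real n + 1) powr (- 2))"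
  using norm_suminf_le[OF norm_zinv_pw_le[of _ s] summable_pw_bound[of "Re s - 2"]]
    sums_unique[OF zinv_sums(1)[of s]] assms by simp

text \<open>On Re s = 4 the reciprocal of zeta is bounded by a convergent series independent of t,
  and s - 1 has norm at least 3.\<close>

lemma zreg_lower: "\<exists>m>0. \<forall>t. m \<le> norm (zreg (Complex 4 t))"
proof -
  define S where "S = (\<Sum>n. (real n + 1) powr (- 2))"
  have S: "norm (1 / riemann_zeta s) \<le> S" if "Re s = 4" for s
    unfolding S_def by (rule norm_inverse_zeta_le[OF that])
  have "norm (1 / riemann_zeta 4) > 0" using riemann_zeta_nonzero_right[of 4] by simp
  then have S0: "S > 0" using S[of 4] by (rule less_le_trans) simp
  have "3 / S \<le> norm (zreg (Complex 4 t))" for t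
  proof -
    have nz: "riemann_zeta (Complex 4 t) \<noteq> 0" by (rule riemann_zeta_nonzero_right) simp
    have "3 / S \<le> norm (Complex 4 t - 1) * norm (riemann_zeta (Complex 4 t))"
    proof -
      have "3 \<le> norm (Complex 4 t - 1)" using complex_Re_le_cmod[of "Complex 4 t - 1"] by simp
      moreover have "1 / S \<le> norm (riemann_zeta (Complex 4 t))"
        using S[of "Complex 4 t"] S0 nz by (simp add: norm_divide divide_simps mult.commute)
      ultimately have "3 * (1 / S) \<le> norm (Complex 4 t - 1) * norm (riemann_zeta (Complex 4 t))"
        using S0 by (intro mult_mono) auto
      then show ?thesis by simp
    qed
    then show ?thesis by (auto simp: zreg_def norm_mult complex_eq_iff)
  qed
  then show ?thesis using S0 by (intro exI[of _ "3 / S"]) auto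
qed

text \<open>Converts the Harnack factor into an integer power of \<open>M\<close>; as
  \<open>M\<close> will be polynomial in t, so is the result.\<close>

lemma exp_log_bound:
  fixes a :: real
  assumes "0 < m" "m \<le> M" "K \<le> real k"
  shows "exp (K * (1 + ln (M / m))) \<le> (exp 1 * M / m) ^ k"
proof -
  have "exp (1 + ln (M / m)) = exp 1 * M / m" using assms by (simp add: exp_add)
  moreover have "exp (K * (1 + ln (M / m))) \<le> exp (real k * (1 + ln (M / m)))"
    using assms by (intro exp_le_cancel_iff[THEN iffD2] mult_right_mono) auto
  ultimately show ?thesis by (simp add: exp_of_nat_mult)
qed

lemma zreg_nonzero:
  assumes "riemann_hypothesis" "Re s > 1/2"
  shows "zreg s \<noteq> 0"
  using assms by (auto simp: riemann_hypothesis_def zreg_def)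

lemma zreg_disc_bounds:
  "\<exists>C m. C \<ge> 1 \<and> 0 < m \<and> m \<le> C \<and>
    (\<forall>t z. z \<in> cball (Complex 4 t) 9 \<longrightarrow> norm (zreg z) \<le> C * (1 + \<bar>t\<bar>) ^ 9) \<and>
    (\<forall>t. m \<le> norm (zreg (Complex 4 t)))"
proof -
  obtain C where C: "C \<ge> 1" "\<And>t z. z \<in> cball (Complex 4 t) 9 \<Longrightarrow> norm (zreg z) \<le> C * (1 + \<bar>t\<bar>) ^ 9"
    using zreg_growth by blast
  obtain m where m: "m > 0" "\<And>t. m \<le> norm (zreg (Complex 4 t))"
    using zreg_lower by blast
  have "m \<le> C" using m(2)[of 0] C(2)[of "Complex 4 0" 0] by simp
  with C m show ?thesis by blast
qed

lemma cball_Complex_4_subset: "cball (Complex 4 t) 9 \<subseteq> {s. Re s > - 6}"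
proof
  fix z assume "z \<in> cball (Complex 4 t) 9"
  then have "\<bar>Re (Complex 4 t - z)\<bar> \<le> 9"
    using abs_Re_le_cmod[of "Complex 4 t - z"] by (simp add: dist_norm)
  then show "z \<in> {s. Re s > - 6}" by simp
qed

text \<open>With zeros removed in radius 4 and both points within 7/2 of the centre, the Harnack
  constant is (4 + 7/2)/(4 - 7/2) = 15 for every \<delta>, which gives the exponent 9 * 15. The
  hypothesis enters as \<open>b = 1/2\<close>: the disc of radius 4 crosses the critical line, but
  its zeros stay on the line or to its left.\<close>

lemma zreg_ratio:
  assumes "riemann_hypothesis"
  shows "\<exists>C\<ge>0. \<exists>A. \<forall>t \<delta>. 0 \<le> \<delta> \<and> \<delta> \<le> 1/2 \<longrightarrow>
    norm (zreg (Complex (1/2) t)) \<le> C * (1 + \<bar>t\<bar>) ^ A * norm (zreg (Complex (1/2 + \<delta>) t))"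
proof -
  obtain C m where Cm: "C \<ge> 1" "0 < m" "m \<le> C"
    "\<And>t z. z \<in> cball (Complex 4 t) 9 \<Longrightarrow> norm (zreg z) \<le> C * (1 + \<bar>t\<bar>) ^ 9"
    "\<And>t. m \<le> norm (zreg (Complex 4 t))"
    using zreg_disc_bounds by blast
  have "norm (zreg (Complex (1/2) t)) \<le> (exp 1 * C / m) ^ 15 * (1 + \<bar>t\<bar>) ^ (9 * 15) * norm (zreg (Complex (1/2 + \<delta>) t))"
    if \<delta>: "0 \<le> \<delta>" "\<delta> \<le> 1/2" for t \<delta>
  proof -
    define M where "M = C * (1 + \<bar>t\<bar>) ^ 9"
    have "m * 1 \<le> C * (1 + \<bar>t\<bar>) ^ 9" using Cm(1-3) by (intro mult_mono one_le_power) auto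
    then have M: "m \<le> M" by (simp add: M_def)
    have "norm (zreg (Complex (1/2) t)) \<le> exp (((4 + 7/2) / (4 - 7/2)) * (1 + ln (M / m))) * norm (zreg (Complex (1/2 + \<delta>) t))"
    proof (rule ratio_bound[where f = zreg and s = "Complex (1/2) t" and s' = "Complex (1/2 + \<delta>) t" and ?z0.0 = "Complex 4 t" and R = 9 and U = "{s. Re s > -6}" and b = "1/2"])
      show "dist (Complex 4 t) (Complex (1/2) t) \<le> 7/2" "dist (Complex 4 t) (Complex (1/2 + \<delta>) t) \<le> 7/2"
        using \<delta> by (auto simp: dist_norm cmod_def)
      show "Re z \<le> 1/2" if "z \<in> ball (Complex 4 t) 4" "zreg z = 0" for z
        using zreg_nonzero[OF assms, of z] that(2) by (cases "Re z \<le> 1/2") auto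
    qed (use Cm \<delta> cball_Complex_4_subset zreg_holomorphic in \<open>auto simp: M_def open_halfspace_Re_gt\<close>)
    also have "\<dots> \<le> (exp 1 * M / m) ^ 15 * norm (zreg (Complex (1/2 + \<delta>) t))"
      by (intro mult_right_mono exp_log_bound) (use Cm M in auto)
    also have "(exp 1 * M / m) ^ 15 = (exp 1 * C / m) ^ 15 * (1 + \<bar>t\<bar>) ^ (9 * 15)"
      unfolding M_def by (subst power_mult) (simp add: power_mult_distrib power_divide del: power_mult)
    finally show ?thesis .
  qed
  moreover have "0 \<le> (exp 1 * C / m) ^ 15" using Cm by simp
  ultimately show ?thesis by blast
qed

text \<open>Under the hypothesis the disc of radius 7/2 about 4 + it is free of zeros of
  \<open>zreg\<close>, so the Harnack bound applies at distance at most 7/2 - \<eta> from its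
  centre. The constant \<open>K\<close> tends to infinity as \<eta> tends to 0, so \<open>C\<close>
  and \<open>A\<close> depend on \<eta>.\<close>

lemma inverse_zeta_growth:
  assumes "riemann_hypothesis" "0 < \<eta>" "\<eta> < 7/2"
  shows "\<exists>C\<ge>0. \<exists>A. \<forall>z. 1/2 + \<eta> \<le> Re z \<and> Re z \<le> 15/2 - \<eta> \<longrightarrow>
    norm (1 / riemann_zeta z) \<le> C * (1 + \<bar>Im z\<bar>) ^ A"
proof -
  obtain C m where Cm: "C \<ge> 1" "0 < m" "m \<le> C"
    "\<And>t z. z \<in> cball (Complex 4 t) 9 \<Longrightarrow> norm (zreg z) \<le> C * (1 + \<bar>t\<bar>) ^ 9"
    "\<And>t. m \<le> norm (zreg (Complex 4 t))"
    using zreg_disc_bounds by blast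
  define K where "K = (7/2 + (7/2 - \<eta>)) / (7/2 - (7/2 - \<eta>))"
  define k where "k = nat \<lceil>K\<rceil>"
  have k: "K \<le> real k" unfolding k_def by linarith
  have "norm (1 / riemann_zeta z) \<le> (8 * (exp 1 * C / m) ^ k) * (1 + \<bar>Im z\<bar>) ^ (9 * k + 1)"
    if z: "1/2 + \<eta> \<le> Re z" "Re z \<le> 15/2 - \<eta>" for z
  proof -
    define t where "t = Im z"
    define M where "M = C * (1 + \<bar>t\<bar>) ^ 9"
    have "m * 1 \<le> C * (1 + \<bar>t\<bar>) ^ 9" using Cm(1-3) by (intro mult_mono one_le_power) auto
    then have M: "m \<le> M" by (simp add: M_def)
    have "1 * 1 \<le> C * (1 + \<bar>t\<bar>) ^ 9" using Cm(1-3) by (intro mult_mono one_le_power) auto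
    then have M1: "1 \<le> M" by (simp add: M_def)
    have "M * exp (- K * (1 + ln (M / m))) \<le> norm (zreg z)"
      unfolding K_def
    proof (rule zero_free_lower_bound[where h = zreg and w = z and ?z0.0 = "Complex 4 t"])
      have sub: "ball (Complex 4 t) (7/2) \<subseteq> cball (Complex 4 t) 9" by auto
      show "zreg holomorphic_on ball (Complex 4 t) (7/2)"
        using zreg_holomorphic by (rule holomorphic_on_subset) (use sub cball_Complex_4_subset in blast)
      show "norm (zreg w) \<le> M" if "w \<in> ball (Complex 4 t) (7/2)" for w
        unfolding M_def using Cm(4) sub that by blast
      show "zreg w \<noteq> 0" if "w \<in> ball (Complex 4 t) (7/2)" for w
      proof (rule zreg_nonzero[OF assms(1)])
        have "\<bar>Re (Complex 4 t - w)\<bar> < 7/2"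
          using that abs_Re_le_cmod[of "Complex 4 t - w"] by (simp add: dist_norm)
        then have "\<bar>4 - Re w\<bar> < 7/2" by simp
        then show "Re w > 1/2" by linarith
      qed
      have "Complex 4 t - z = of_real (4 - Re z)" by (simp add: t_def complex_eq_iff)
      then show "dist (Complex 4 t) z \<le> 7/2 - \<eta>" using z by (simp add: dist_norm del: of_real_diff)
    next
      show "0 < m" "m \<le> norm (zreg (Complex 4 t))" using Cm by auto
      show "0 \<le> 7/2 - \<eta>" "7/2 - \<eta> < 7/2" using assms by auto
    qed
    then have "exp (- K * (1 + ln (M / m))) \<le> norm (zreg z)"
      using M1 by (metis (no_types) exp_ge_zero mult.commute mult_left_mono mult.right_neutral order_trans)
    then have "1 \<le> exp (K * (1 + ln (M / m))) * norm (zreg z)"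
      by (simp add: exp_minus divide_simps mult.commute)
    also have "\<dots> \<le> (exp 1 * M / m) ^ k * norm (zreg z)"
      by (intro mult_right_mono exp_log_bound) (use Cm M k in auto)
    also have "(exp 1 * M / m) ^ k = (exp 1 * C / m) ^ k * (1 + \<bar>t\<bar>) ^ (9 * k)"
      unfolding M_def by (subst power_mult) (simp add: power_mult_distrib power_divide del: power_mult)
    finally have 1: "1 \<le> (exp 1 * C / m) ^ k * (1 + \<bar>t\<bar>) ^ (9 * k) * norm (zreg z)" .
    have nz: "zreg z \<noteq> 0" using z assms by (intro zreg_nonzero) auto
    have "norm (z - 1) \<le> \<bar>Re (z - 1)\<bar> + \<bar>Im (z - 1)\<bar>" by (rule cmod_le)
    also have "\<dots> \<le> 8 * (1 + \<bar>t\<bar>)" using z assms by (auto simp: t_def)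
    finally have 2: "norm (z - 1) \<le> 8 * (1 + \<bar>t\<bar>)" .
    have "norm (z - 1) \<le> norm (z - 1) * ((exp 1 * C / m) ^ k * (1 + \<bar>t\<bar>) ^ (9 * k) * norm (zreg z))"
      using mult_left_mono[OF 1 norm_ge_zero[of "z - 1"]] by simp
    also have "\<dots> \<le> (8 * (1 + \<bar>t\<bar>)) * ((exp 1 * C / m) ^ k * (1 + \<bar>t\<bar>) ^ (9 * k) * norm (zreg z))"
      using 2 Cm by (intro mult_right_mono) auto
    also have "\<dots> = (8 * (exp 1 * C / m) ^ k) * (1 + \<bar>t\<bar>) ^ (9 * k + 1) * norm (zreg z)" by simp
    finally show ?thesis
      unfolding inverse_zeta_eq norm_divide t_def[symmetric] using nz by (subst pos_divide_le_eq) auto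
  qed
  moreover have "0 \<le> 8 * (exp 1 * C / m) ^ k" using Cm by simp
  ultimately show ?thesis by blast
qed

subsection \<open>The Plancherel inequality\<close>

lemma integrable_mult_bounded:
  fixes f g :: "'a \<Rightarrow> complex"
  assumes "integrable M f" "g \<in> borel_measurable M" "\<And>x. norm (g x) \<le> B"
  shows "integrable M (\<lambda>x. f x * g x)"
proof (rule Bochner_Integration.integrable_bound)
  show "integrable M (\<lambda>x. B * norm (f x))" using assms by simp
  show "AE x in M. norm (f x * g x) \<le> norm (B * norm (f x))"
  proof (rule AE_I2)
    fix x
    have "norm (f x * g x) \<le> norm (f x) * B" unfolding norm_mult by (rule mult_left_mono) (use assms in auto)
    then show "norm (f x * g x) \<le> norm (B * norm (f x))" by (simp add: mult.commute) 
  qed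
qed (use assms in \<open>auto intro: borel_measurable_times borel_measurable_integrable\<close>)

lemma integrable_product:
  fixes f g :: "real \<Rightarrow> complex"
  assumes f: "integrable lborel f" and g: "integrable lborel g"
  shows "integrable (lborel \<Otimes>\<^sub>M lborel) (\<lambda>(x, y). f x * g y)"
proof (subst lborel_pair.Fubini_integrable)
  have [measurable]: "f \<in> borel_measurable borel" "g \<in> borel_measurable borel"
    using f g by (auto dest!: borel_measurable_integrable)
  show "(\<lambda>(x, y). f x * g y) \<in> borel_measurable (lborel \<Otimes>\<^sub>M lborel)" by measurable
  show "integrable lborel (\<lambda>x. \<integral>y. norm (case (x, y) of (x, y) \<Rightarrow> f x * g y) \<partial>lborel)"
    using f g by (simp add: norm_mult)
  show "AE x in lborel. integrable lborel (\<lambda>y. case (x, y) of (x, y) \<Rightarrow> f x * g y)"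
    using g by simp
qed simp

lemma Fubini_product_kernel:
  fixes f g :: "real \<Rightarrow> complex"
  assumes f: "integrable lborel f" and g: "integrable lborel g"
    and K: "K \<in> borel_measurable (lborel \<Otimes>\<^sub>M lborel)" "\<And>p. norm (K p) \<le> B"
  shows "(\<integral>x. \<integral>y. f x * g y * K (x, y) \<partial>lborel \<partial>lborel) = (\<integral>y. \<integral>x. f x * g y * K (x, y) \<partial>lborel \<partial>lborel)"
proof -
  have "integrable (lborel \<Otimes>\<^sub>M lborel) (\<lambda>p. (case p of (x, y) \<Rightarrow> f x * g y) * K p)"
    by (rule integrable_mult_bounded[OF integrable_product[OF f g] K])
  then have "integrable (lborel \<Otimes>\<^sub>M lborel) (\<lambda>(x, y). f x * g y * K (x, y))"
    by (simp add: case_prod_unfold)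
  then show ?thesis by (rule lborel_pair.Fubini_integral[symmetric])
qed

text \<open>The sign makes the transform of \<open>g (exp x) * exp (x / 2)\<close> equal to the
  Mellin transform of \<open>g\<close> at 1/2 + it. Without a normalising factor, 2 pi appears in
  \<open>plancherel_le\<close>.\<close>

definition fourier :: "(real \<Rightarrow> complex) \<Rightarrow> real \<Rightarrow> complex" where
  "fourier h t = (\<integral>x. h x * cis (t * x) \<partial>lborel)"

lemma cis_measurable [measurable]: "cis \<in> borel_measurable borel"
  by (intro borel_measurable_continuous_onI continuous_intros)

lemma cnj_measurable [measurable]: "cnj \<in> borel_measurable borel"
  by (intro borel_measurable_continuous_onI continuous_intros)

lemma integrable_mult_cis:
  "integrable lborel h \<Longrightarrow> integrable lborel (\<lambda>x. h x * cis (t * x))"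
  by (rule integrable_mult_bounded[where B = 1]) auto

lemma norm_fourier_le: "norm (fourier h t) \<le> (\<integral>x. norm (h x) \<partial>lborel)"
  unfolding fourier_def by (rule order_trans[OF integral_norm_bound]) (simp add: norm_mult)

lemma fourier_measurable [measurable]:
  assumes [measurable]: "h \<in> borel_measurable borel"
  shows "fourier h \<in> borel_measurable borel"
  unfolding fourier_def by measurable

lemma integrable_std_normal: "integrable lborel (\<lambda>x. complex_of_real (std_normal_density x))"
  using integrable_normal_density[of 1 0] by (intro integrable_of_real) simp

lemma fourier_std_normal:
  "(\<integral>t. complex_of_real (std_normal_density t) * cis (x * t) \<partial>lborel) = of_real (exp (- (x\<^sup>2) / 2))"
proof -
  have "char std_normal_distribution x = (\<integral>t. std_normal_density t *\<^sub>R cis (x * t) \<partial>lborel)"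
    unfolding char_def by (subst integral_density) (auto simp: mult.commute cis_conv_exp)
  then show ?thesis by (simp add: char_std_normal_distribution scaleR_conv_of_real)
qed

lemma cnj_integral: "cnj (\<integral>x. f x \<partial>M) = (\<integral>x. cnj (f x) \<partial>M)"
  by (cases "integrable M f") (auto simp: not_integrable_integral_eq)

text \<open>Both transforms are expanded as integrals and the t-integration is moved inside, where
  it becomes the characteristic function of the normal distribution at c (x - y). The Gaussian
  density supplies integrability in t for both uses of Fubini's theorem.\<close>

lemma gaussian_fourier_identity:
  assumes h: "integrable lborel h"
  shows "(\<integral>t. of_real (std_normal_density t) * (fourier h (c * t) * cnj (fourier h (c * t))) \<partial>lborel)
    = (\<integral>x. \<integral>y. h x * cnj (h y) * of_real (exp (- ((c * (x - y))\<^sup>2) / 2)) \<partial>lborel \<partial>lborel)"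
proof -
  have [measurable]: "h \<in> borel_measurable borel" using h by (auto dest!: borel_measurable_integrable)
  let ?\<rho> = "\<lambda>t. complex_of_real (std_normal_density t)"
  have hc: "integrable lborel (\<lambda>y. cnj (h y))" using h by simp
  have cF: "cnj (fourier h s) = (\<integral>y. cnj (h y) * cis (- (s * y)) \<partial>lborel)" for s
    unfolding fourier_def cnj_integral by (simp add: cis_cnj)
  define B where "B = (\<integral>x. norm (h x) \<partial>lborel)"
  have FB: "norm (cnj (fourier h s)) \<le> B" for s using norm_fourier_le[of h s] by (simp add: B_def)
  have "(\<integral>t. ?\<rho> t * (fourier h (c * t) * cnj (fourier h (c * t))) \<partial>lborel)
     = (\<integral>t. \<integral>x. ?\<rho> t * h x * (\<lambda>(t, x). cis (c * t * x) * cnj (fourier h (c * t))) (t, x) \<partial>lborel \<partial>lborel)"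
  proof (rule Bochner_Integration.integral_cong[OF refl])
    fix t
    have "?\<rho> t * (fourier h (c * t) * cnj (fourier h (c * t))) = (\<integral>x. ?\<rho> t * (h x * cis (c * t * x) * cnj (fourier h (c * t))) \<partial>lborel)"
      using integrable_mult_cis[OF h, of "c * t"] by (simp add: fourier_def[of h "c * t"])
    then show "?\<rho> t * (fourier h (c * t) * cnj (fourier h (c * t))) = (\<integral>x. ?\<rho> t * h x * (\<lambda>(t, x). cis (c * t * x) * cnj (fourier h (c * t))) (t, x) \<partial>lborel)"
      by (simp add: mult.assoc)
  qed
  also have "\<dots> = (\<integral>x. \<integral>t. ?\<rho> t * h x * (\<lambda>(t, x). cis (c * t * x) * cnj (fourier h (c * t))) (t, x) \<partial>lborel \<partial>lborel)"
    by (rule Fubini_product_kernel[OF integrable_std_normal h, where B = B]) (use FB in \<open>auto simp: norm_mult\<close>)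
  also have "\<dots> = (\<integral>x. \<integral>y. h x * cnj (h y) * of_real (exp (- ((c * (x - y))\<^sup>2) / 2)) \<partial>lborel \<partial>lborel)"
  proof (rule Bochner_Integration.integral_cong[OF refl])
    fix x
    have "(\<integral>t. ?\<rho> t * h x * (\<lambda>(t, x). cis (c * t * x) * cnj (fourier h (c * t))) (t, x) \<partial>lborel)
       = (\<integral>t. \<integral>y. ?\<rho> t * cnj (h y) * (\<lambda>(t, y). h x * cis (c * t * (x - y))) (t, y) \<partial>lborel \<partial>lborel)"
    proof (rule Bochner_Integration.integral_cong[OF refl])
      fix t
      have "?\<rho> t * h x * (cis (c * t * x) * cnj (fourier h (c * t)))
        = (\<integral>y. (?\<rho> t * h x * cis (c * t * x)) * (cnj (h y) * cis (- (c * t * y))) \<partial>lborel)"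
        unfolding cF using integrable_mult_cis[OF hc, of "- (c * t)"] by simp
      also have "\<dots> = (\<integral>y. ?\<rho> t * cnj (h y) * (h x * cis (c * t * (x - y))) \<partial>lborel)"
        by (rule Bochner_Integration.integral_cong[OF refl]) (simp add: cis_mult right_diff_distrib)
      finally show "?\<rho> t * h x * (\<lambda>(t, x). cis (c * t * x) * cnj (fourier h (c * t))) (t, x)
        = (\<integral>y. ?\<rho> t * cnj (h y) * (\<lambda>(t, y). h x * cis (c * t * (x - y))) (t, y) \<partial>lborel)" by simp
    qed
    also have "\<dots> = (\<integral>y. \<integral>t. ?\<rho> t * cnj (h y) * (\<lambda>(t, y). h x * cis (c * t * (x - y))) (t, y) \<partial>lborel \<partial>lborel)"
      by (rule Fubini_product_kernel[OF integrable_std_normal hc, where B = "norm (h x)"]) (auto simp: norm_mult)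
    also have "\<dots> = (\<integral>y. h x * cnj (h y) * of_real (exp (- ((c * (x - y))\<^sup>2) / 2)) \<partial>lborel)"
    proof (rule Bochner_Integration.integral_cong[OF refl])
      fix y
      have "(\<integral>t. ?\<rho> t * cnj (h y) * (\<lambda>(t, y). h x * cis (c * t * (x - y))) (t, y) \<partial>lborel)
        = (\<integral>t. h x * cnj (h y) * (?\<rho> t * cis ((c * (x - y)) * t)) \<partial>lborel)"
        by (rule Bochner_Integration.integral_cong[OF refl]) (simp add: mult_ac)
      also have "\<dots> = h x * cnj (h y) * of_real (exp (- ((c * (x - y))\<^sup>2) / 2))"
        using integrable_mult_cis[OF integrable_std_normal] by (simp add: fourier_std_normal)
      finally show "(\<integral>t. ?\<rho> t * cnj (h y) * (\<lambda>(t, y). h x * cis (c * t * (x - y))) (t, y) \<partial>lborel)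
        = h x * cnj (h y) * of_real (exp (- ((c * (x - y))\<^sup>2) / 2))" .
    qed
    finally show "(\<integral>t. ?\<rho> t * h x * (\<lambda>(t, x). cis (c * t * x) * cnj (fourier h (c * t))) (t, x) \<partial>lborel)
      = (\<integral>y. h x * cnj (h y) * of_real (exp (- ((c * (x - y))\<^sup>2) / 2)) \<partial>lborel)" .
  qed
  finally show ?thesis .
qed

text \<open>The Gaussian factor makes Fubini's theorem applicable; letting its width tend to infinity gives
  the inequality, and only this direction of Plancherel's theorem is needed.\<close>

lemma plancherel_le:
  assumes h: "integrable lborel h" and cont: "continuous_on UNIV h" and bd: "\<And>x. norm (h x) \<le> B"
    and F: "integrable lborel (\<lambda>t. (norm (fourier h t))\<^sup>2)"
  shows "integrable lborel (\<lambda>x. (norm (h x))\<^sup>2)"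
    and "2 * pi * (\<integral>x. (norm (h x))\<^sup>2 \<partial>lborel) \<le> (\<integral>t. (norm (fourier h t))\<^sup>2 \<partial>lborel)"
proof -
  have [measurable]: "h \<in> borel_measurable borel" using h by (auto dest!: borel_measurable_integrable)
  have B0: "B \<ge> 0" using bd[of 0] norm_ge_zero order_trans by blast
  have sq: "z * cnj z = of_real ((norm z)\<^sup>2)" for z by (simp add: complex_mult_cnj cmod_power2)
  have hh: "integrable lborel (\<lambda>x. h x * cnj (h x))"
    by (rule integrable_mult_bounded[OF h, where B = B]) (use bd in auto)
  then show int2: "integrable lborel (\<lambda>x. (norm (h x))\<^sup>2)"
    unfolding sq complex_of_real_integrable_eq .
  define I where "I = (\<integral>t. (norm (fourier h t))\<^sup>2 \<partial>lborel)"
  \<comment> \<open>The conjugate of \<open>h\<close> averaged against a Gaussian of width 1/c; it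
    tends to \<open>cnj (h x)\<close> as c grows.\<close>
  define k where "k c x = (\<integral>z. of_real (std_normal_density z) * cnj (h (x - z / c)) \<partial>lborel)" for c x
  have kb: "norm (k c x) \<le> B" for c x
  proof -
    have "norm (k c x) \<le> (\<integral>z. std_normal_density z * B \<partial>lborel)"
      unfolding k_def
    proof (rule Bochner_Integration.integral_norm_bound_integral)
      show i: "integrable lborel (\<lambda>z. std_normal_density z * B)"
        using integrable_normal_density[of 1 0] by simp
      show "integrable lborel (\<lambda>z. of_real (std_normal_density z) * cnj (h (x - z / c)))"
        by (rule integrable_mult_bounded[OF integrable_std_normal, where B = B]) (use bd in auto)
    qed (use bd in \<open>auto simp: norm_mult intro!: mult_left_mono\<close>)
    then show ?thesis using integral_normal_density[of 1 0] by simp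
  qed
  \<comment> \<open>Substituting y = x - z/c on one side and rescaling t by c on the other produces
    a factor 1/c on both, so the resulting bound is independent of c.\<close>
  have id: "2 * pi * norm (\<integral>x. h x * k c x \<partial>lborel) \<le> I" if c: "c > 0" for c
  proof -
    have "(\<integral>y. h x * cnj (h y) * of_real (exp (- ((c * (x - y))\<^sup>2) / 2)) \<partial>lborel) = of_real (sqrt (2 * pi) / c) * (h x * k c x)" for x
    proof -
      have "(\<integral>y. h x * cnj (h y) * of_real (exp (- ((c * (x - y))\<^sup>2) / 2)) \<partial>lborel)
        = \<bar>- (1 / c)\<bar> *\<^sub>R (\<integral>z. h x * cnj (h (x + - (1 / c) * z)) * of_real (exp (- ((c * (x - (x + - (1 / c) * z)))\<^sup>2) / 2)) \<partial>lborel)"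
        using c by (intro lborel_integral_real_affine) auto
      also have "\<dots> = (1 / c) *\<^sub>R (\<integral>z. h x * of_real (sqrt (2 * pi)) * (of_real (std_normal_density z) * cnj (h (x - z / c))) \<partial>lborel)"
        using c by (simp add: normal_density_def real_sqrt_mult mult_ac)
      also have "\<dots> = of_real (sqrt (2 * pi) / c) * (h x * k c x)"
        unfolding k_def by (simp add: scaleR_conv_of_real)
      finally show ?thesis .
    qed
    then have "of_real (sqrt (2 * pi) / c) * (\<integral>x. h x * k c x \<partial>lborel)
      = (\<integral>x. \<integral>y. h x * cnj (h y) * of_real (exp (- ((c * (x - y))\<^sup>2) / 2)) \<partial>lborel \<partial>lborel)" by simp
    also have "\<dots> = (\<integral>t. of_real (std_normal_density t) * (fourier h (c * t) * cnj (fourier h (c * t))) \<partial>lborel)"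
      by (rule gaussian_fourier_identity[OF h, symmetric])
    also have "norm \<dots> \<le> (\<integral>t. (1 / sqrt (2 * pi)) * (norm (fourier h (c * t)))\<^sup>2 \<partial>lborel)"
    proof (rule Bochner_Integration.integral_norm_bound_integral)
      have F': "integrable lborel (\<lambda>t. (norm (fourier h (c * t)))\<^sup>2)"
        using lborel_integrable_real_affine[OF F, of c 0] c by simp
      then show i: "integrable lborel (\<lambda>t. (1 / sqrt (2 * pi)) * (norm (fourier h (c * t)))\<^sup>2)" by simp
      show bound: "norm (of_real (std_normal_density t) * (fourier h (c * t) * cnj (fourier h (c * t))))
         \<le> (1 / sqrt (2 * pi)) * (norm (fourier h (c * t)))\<^sup>2" for t
        unfolding sq by (simp add: norm_mult norm_divide norm_power normal_density_def divide_right_mono mult_left_le_one_le)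
      show "integrable lborel (\<lambda>t. of_real (std_normal_density t) * (fourier h (c * t) * cnj (fourier h (c * t))))"
        by (rule Bochner_Integration.integrable_bound[OF i]) (use bound in \<open>auto simp: abs_mult\<close>)
    qed
    also have "\<dots> = (1 / sqrt (2 * pi)) * (I / c)"
      using lborel_integral_real_affine[of c "\<lambda>t. (norm (fourier h t))\<^sup>2" 0] c by (simp add: I_def)
    finally have "sqrt (2 * pi) / c * norm (\<integral>x. h x * k c x \<partial>lborel) \<le> (1 / sqrt (2 * pi)) * (I / c)"
      using c by (simp add: norm_mult norm_divide)
    then have "sqrt (2 * pi) * (sqrt (2 * pi) * norm (\<integral>x. h x * k c x \<partial>lborel)) \<le> I"
      using c by (simp add: field_simps)
    moreover have "sqrt (2 * pi) * sqrt (2 * pi) = 2 * pi" by simp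
    ultimately show ?thesis by (metis mult.assoc)
  qed
  have klim: "(\<lambda>n. k (real (Suc n)) x) \<longlonglongrightarrow> cnj (h x)" for x
  proof -
    have "(\<lambda>n. k (real (Suc n)) x) \<longlonglongrightarrow> (\<integral>z. of_real (std_normal_density z) * cnj (h x) \<partial>lborel)"
      unfolding k_def
    proof (rule integral_dominated_convergence[where w = "\<lambda>z. std_normal_density z * B"])
      show "integrable lborel (\<lambda>z. std_normal_density z * B)"
        using integrable_normal_density[of 1 0] by simp
      show "AE z in lborel. (\<lambda>n. of_real (std_normal_density z) * cnj (h (x - z / real (Suc n))))
         \<longlonglongrightarrow> of_real (std_normal_density z) * cnj (h x)"
      proof (rule AE_I2)
        fix z
        have "(\<lambda>n. x - z * (1 / real (Suc n))) \<longlonglongrightarrow> x - z * 0"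
          by (intro tendsto_intros) (use LIMSEQ_inverse_real_of_nat in \<open>simp add: inverse_eq_divide\<close>)
        then have "(\<lambda>n. h (x - z / real (Suc n))) \<longlonglongrightarrow> h x"
          using cont by (intro isCont_tendsto_compose[of x h]) (auto simp: continuous_on_eq_continuous_at)
        then show "(\<lambda>n. of_real (std_normal_density z) * cnj (h (x - z / real (Suc n)))) \<longlonglongrightarrow> of_real (std_normal_density z) * cnj (h x)"
          by (intro tendsto_intros)
      qed
    qed (use bd in \<open>auto simp: norm_mult intro!: mult_left_mono\<close>)
    moreover have "(\<integral>z. complex_of_real (std_normal_density z) * cnj (h x) \<partial>lborel) = cnj (h x)"
      using integral_normal_density[of 1 0] by (simp del: integral_normal_density)
    ultimately show ?thesis by simp
  qed
  have km: "k c \<in> borel_measurable borel" for c unfolding k_def by measurable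
  have "(\<lambda>n. \<integral>x. h x * k (real (Suc n)) x \<partial>lborel) \<longlonglongrightarrow> (\<integral>x. h x * cnj (h x) \<partial>lborel)"
  proof (rule integral_dominated_convergence[where w = "\<lambda>x. norm (h x) * B"])
    show "AE x in lborel. (\<lambda>n. h x * k (real (Suc n)) x) \<longlonglongrightarrow> h x * cnj (h x)"
      by (intro AE_I2 tendsto_mult tendsto_const klim)
  qed (use h kb km in \<open>auto simp: norm_mult intro!: mult_left_mono\<close>)
  then have "(\<lambda>n. 2 * pi * norm (\<integral>x. h x * k (real (Suc n)) x \<partial>lborel)) \<longlonglongrightarrow> 2 * pi * norm (\<integral>x. h x * cnj (h x) \<partial>lborel)"
    by (intro tendsto_intros)
  then have "2 * pi * norm (\<integral>x. h x * cnj (h x) \<partial>lborel) \<le> I"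
    by (rule LIMSEQ_le_const2) (use id in auto)
  moreover have "(\<integral>x. h x * cnj (h x) \<partial>lborel) = of_real (\<integral>x. (norm (h x))\<^sup>2 \<partial>lborel)"
    unfolding sq by (rule integral_complex_of_real)
  ultimately show "2 * pi * (\<integral>x. (norm (h x))\<^sup>2 \<partial>lborel) \<le> (\<integral>t. (norm (fourier h t))\<^sup>2 \<partial>lborel)"
    by (simp add: I_def)
qed

subsection \<open>The Mellin transform\<close>

lemma exp_left_half_line:
  fixes c :: real
  assumes "c > 0"
  shows "integrable lborel (\<lambda>x. indicator {..<0} x * exp (c * x))"
    and "(\<integral>x. indicator {..<0} x * exp (c * x) \<partial>lborel) = 1 / c"
proof -
  have eq: "(\<lambda>x. indicator {0<..} x *\<^sub>R exp (- (x * c))) = (\<lambda>x::real. (\<lambda>y. indicator {..<0} y * exp (c * y)) (0 + - 1 * x))"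
    by (auto simp: indicator_def mult.commute)
  have "integrable lborel (\<lambda>x. indicator {0<..} x *\<^sub>R exp (- (x * c)))"
    using integrable_I0i_exp_mscale[OF assms] by (simp add: set_integrable_def)
  then show "integrable lborel (\<lambda>x. indicator {..<0} x * exp (c * x))"
    unfolding eq by (subst (asm) lborel_integrable_real_affine_iff) auto
  have "1 / c = (\<integral>x. indicator {0<..} x *\<^sub>R exp (- (x * c)) \<partial>lborel)"
    using LBINT_I0i_exp_mscale[OF assms]
    by (simp add: interval_lebesgue_integral_def set_lebesgue_integral_def zero_ereal_def)
  also have "\<dots> = (\<integral>x. indicator {..<0} x * exp (c * x) \<partial>lborel)"
    unfolding eq using lborel_integral_real_affine[of "-1" "\<lambda>y. indicator {..<0} y * exp (c * y)" 0] by simp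
  finally show "(\<integral>x. indicator {..<0} x * exp (c * x) \<partial>lborel) = 1 / c" ..
qed

lemma FTC_left_half_line:
  fixes F f :: "real \<Rightarrow> complex"
  assumes "\<And>x. x < 0 \<Longrightarrow> (F has_vector_derivative f x) (at x)" "\<And>x. x < 0 \<Longrightarrow> isCont f x"
    and "integrable lborel (\<lambda>x. indicator {..<0} x *\<^sub>R f x)"
    and "(F \<longlongrightarrow> A) at_bot" "(F \<longlongrightarrow> B) (at_left 0)"
  shows "(\<integral>x. indicator {..<0} x *\<^sub>R f x \<partial>lborel) = B - A"
proof -
  have "(LBINT x=-\<infinity>..ereal 0. f x) = B - A"
    by (rule interval_integral_FTC_integrable)
       (use assms in \<open>auto simp: set_integrable_def ereal_tendsto_simps\<close>)
  then show ?thesis by (simp add: interval_lebesgue_integral_def set_lebesgue_integral_def)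
qed

text \<open>The integration variable is \<open>x = ln u\<close>, so the integral over \<open>u > 0\<close> becomes one over all reals.\<close>

definition mellin :: "(real \<Rightarrow> complex) \<Rightarrow> complex \<Rightarrow> complex" where
  "mellin f s = (\<integral>x. f (exp x) * exp (s * of_real x) \<partial>lborel)"

lemma mellin_kernel_bound:
  assumes "\<And>u. norm (f u) \<le> B" "\<And>u. u \<ge> 1 \<Longrightarrow> f u = 0"
  shows "norm (f (exp x) * exp (s * of_real x)) \<le> B * (indicator {..<0} x * exp (Re s * x))"
proof (cases "x < 0")
  case True
  then show ?thesis using assms(1)[of "exp x"] by (simp add: norm_mult mult_right_mono)
qed (use assms in auto)

lemma mellin_integrable:
  assumes f: "f \<in> borel_measurable borel" "\<And>u. norm (f u) \<le> B" "\<And>u. u \<ge> 1 \<Longrightarrow> f u = 0"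
    and s: "Re s > 0"
  shows "integrable lborel (\<lambda>x. f (exp x) * exp (s * of_real x))"
proof (rule Bochner_Integration.integrable_bound)
  show "integrable lborel (\<lambda>x. B * (indicator {..<0} x * exp (Re s * x)))"
    using exp_left_half_line[OF s] by simp
  show "AE x in lborel. norm (f (exp x) * exp (s * of_real x)) \<le> norm (B * (indicator {..<0} x * exp (Re s * x)))"
    using mellin_kernel_bound[where f = f, OF f(2,3)] abs_ge_self order_trans unfolding real_norm_def
    by (intro AE_I2) blast
  show "(\<lambda>x. f (exp x) * exp (s * of_real x)) \<in> borel_measurable lborel"
    using f(1) by measurable
qed

lemma norm_mellin_le:
  assumes f: "f \<in> borel_measurable borel" "\<And>u. norm (f u) \<le> B" "\<And>u. u \<ge> 1 \<Longrightarrow> f u = 0"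
    and s: "Re s > 0"
  shows "norm (mellin f s) \<le> B / Re s"
proof -
  have "norm (mellin f s) \<le> (\<integral>x. B * (indicator {..<0} x * exp (Re s * x)) \<partial>lborel)"
    unfolding mellin_def
    by (rule Bochner_Integration.integral_norm_bound_integral[OF mellin_integrable[OF f s]])
       (use exp_left_half_line[OF s] mellin_kernel_bound[where f = f, OF f(2,3)] in auto)
  then show ?thesis using exp_left_half_line[OF s] by simp
qed

text \<open>Differentiation under the integral sign with an explicit remainder. For norm h <
  \<sigma>/2 the second-order Taylor remainder of exp costs half of the decay exp (\<sigma> x); part
  of the other half absorbs the polynomial factors (\<open>lin\<close>, \<open>quad\<close>), and
  exp (\<sigma> x / 4) remains as an integrable majorant.\<close>

lemma mellin_holomorphic:
  assumes f: "f \<in> borel_measurable borel" "\<And>u. norm (f u) \<le> B" "\<And>u. u \<ge> 1 \<Longrightarrow> f u = 0"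
  shows "mellin f holomorphic_on {s. Re s > 0}"
proof -
  note [measurable] = f(1)
  have B: "B \<ge> 0" using f(2)[of 0] norm_ge_zero order_trans by blast
  have "\<exists>D. (mellin f has_field_derivative D) (at s)" if s: "Re s > 0" for s
  proof -
    define \<sigma> where "\<sigma> = Re s"
    have \<sigma>: "\<sigma> > 0" using s by (simp add: \<sigma>_def)
    define E where "E c x = indicator {..<0} x * exp (c * x)" for c x :: real
    have E: "integrable lborel (E c)" if "c > 0" for c
      unfolding E_def by (rule exp_left_half_line(1)[OF that])
    define G where "G x = f (exp x) * exp (s * of_real x)" for x
    have Gb: "norm (G x) \<le> B * E \<sigma> x" for x
      unfolding G_def E_def \<sigma>_def by (rule mellin_kernel_bound[OF f(2,3)])
    have int_G: "integrable lborel G"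
      unfolding G_def by (rule mellin_integrable[OF f s])
    define D where "D = (\<integral>x. G x * of_real x \<partial>lborel)"
    have lin: "\<bar>x\<bar> * E \<sigma> x \<le> (4 / \<sigma>) * E (\<sigma> / 4) x" for x
    proof (cases "x < 0")
      case True
      have "\<sigma> * \<bar>x\<bar> / 4 \<le> exp (\<sigma> * \<bar>x\<bar> / 4)" using exp_ge_add_one_self[of "\<sigma> * \<bar>x\<bar> / 4"] by linarith
      then have "\<bar>x\<bar> * exp (\<sigma> * x) \<le> (4 / \<sigma>) * exp (\<sigma> * \<bar>x\<bar> / 4) * exp (\<sigma> * x)"
        using \<sigma> by (intro mult_right_mono) (auto simp: field_simps)
      also have "\<dots> = (4 / \<sigma>) * exp (\<sigma> * (3 / 4) * x)" using True by (simp flip: exp_add)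
      also have "\<dots> \<le> (4 / \<sigma>) * exp (\<sigma> / 4 * x)" using True \<sigma> by (intro mult_left_mono) auto
      finally show ?thesis using True by (simp add: E_def)
    qed (simp add: E_def)
    have quad: "x\<^sup>2 * E (\<sigma> / 2) x \<le> (32 / \<sigma>\<^sup>2) * E (\<sigma> / 4) x" for x
    proof (cases "x < 0")
      case True
      have "(\<sigma> * \<bar>x\<bar> / 4)\<^sup>2 / 2 \<le> exp (\<sigma> * \<bar>x\<bar> / 4)"
      proof -
        have nn: "0 \<le> \<sigma> * \<bar>x\<bar> / 4" using \<sigma> by simp
        from exp_lower_Taylor_quadratic[OF nn] nn show ?thesis by linarith
      qed
      then have "x\<^sup>2 * exp (\<sigma> / 2 * x) \<le> (32 / \<sigma>\<^sup>2) * exp (\<sigma> * \<bar>x\<bar> / 4) * exp (\<sigma> / 2 * x)"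
        using \<sigma> by (intro mult_right_mono) (auto simp: field_simps power2_eq_square)
      also have "\<dots> = (32 / \<sigma>\<^sup>2) * exp (\<sigma> / 4 * x)" using True by (simp flip: exp_add)
      finally show ?thesis using True by (simp add: E_def)
    qed (simp add: E_def)
    have int_D: "integrable lborel (\<lambda>x. G x * of_real x)"
    proof (rule Bochner_Integration.integrable_bound)
      show "integrable lborel (\<lambda>x. B * ((4 / \<sigma>) * E (\<sigma> / 4) x))" using E \<sigma> by simp
      show "AE x in lborel. norm (G x * of_real x) \<le> norm (B * ((4 / \<sigma>) * E (\<sigma> / 4) x))"
      proof (rule AE_I2)
        fix x
        have "norm (G x * of_real x) \<le> B * E \<sigma> x * \<bar>x\<bar>"
          unfolding norm_mult norm_of_real by (rule mult_right_mono[OF Gb]) simp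
        also have "\<dots> \<le> B * ((4 / \<sigma>) * E (\<sigma> / 4) x)"
          using mult_left_mono[OF lin[of x] B] by (simp add: mult_ac)
        finally show "norm (G x * of_real x) \<le> norm (B * ((4 / \<sigma>) * E (\<sigma> / 4) x))"
          unfolding real_norm_def using abs_ge_self order_trans by blast
      qed
      show "(\<lambda>x. G x * of_real x) \<in> borel_measurable lborel" unfolding G_def by measurable
    qed
    define C where "C = B * (32 / \<sigma>\<^sup>2) * (\<integral>x. E (\<sigma> / 4) x \<partial>lborel)"
    have est: "norm ((mellin f (s + h) - mellin f s) / h - D) \<le> C * norm h"
      if h: "h \<noteq> 0" "norm h < \<sigma> / 2" for h
    proof -
      have sh: "Re (s + h) > 0" using h abs_Re_le_cmod[of h] by (simp add: \<sigma>_def)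
      have int_h: "integrable lborel (\<lambda>x. G x * exp (h * of_real x))"
        using mellin_integrable[OF f sh] by (simp add: G_def exp_add distrib_right mult.assoc)
      have "mellin f (s + h) = (\<integral>x. G x * exp (h * of_real x) \<partial>lborel)"
        unfolding mellin_def G_def by (simp add: exp_add distrib_right mult.assoc)
      moreover have "mellin f s = (\<integral>x. G x \<partial>lborel)" by (simp add: mellin_def G_def)
      ultimately have "mellin f (s + h) - mellin f s - h * D
         = (\<integral>x. G x * exp (h * of_real x) - G x - h * (G x * of_real x) \<partial>lborel)"
        unfolding D_def using int_h int_G int_D by simp
      also have "norm \<dots> \<le> (\<integral>x. B * (32 / \<sigma>\<^sup>2) * (norm h)\<^sup>2 * E (\<sigma> / 4) x \<partial>lborel)"
      proof (rule Bochner_Integration.integral_norm_bound_integral)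
        fix x
        let ?z = "h * of_real x"
        have "norm (exp ?z - (\<Sum>i\<le>1. ?z ^ i / fact i)) \<le> exp \<bar>Re ?z\<bar> * norm ?z ^ Suc 1 / fact 1"
          by (rule Taylor_exp)
        then have t: "norm (exp ?z - 1 - ?z) \<le> exp \<bar>Re ?z\<bar> * (norm ?z)\<^sup>2"
          by (simp add: power2_eq_square diff_diff_eq)
        have "exp \<bar>Re ?z\<bar> \<le> exp (\<sigma> / 2 * \<bar>x\<bar>)"
        proof -
          have "\<bar>Re h\<bar> \<le> \<sigma> / 2" using h abs_Re_le_cmod[of h] by linarith
          from mult_right_mono[OF this abs_ge_zero[of x]] show ?thesis by (simp add: abs_mult)
        qed
        then have "exp \<bar>Re ?z\<bar> * (norm ?z)\<^sup>2 \<le> exp (\<sigma> / 2 * \<bar>x\<bar>) * (norm ?z)\<^sup>2"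
          by (rule mult_right_mono) simp
        then have 1: "norm (exp ?z - 1 - ?z) \<le> exp (\<sigma> / 2 * \<bar>x\<bar>) * ((norm h)\<^sup>2 * x\<^sup>2)"
          using t by (simp add: norm_mult power_mult_distrib)
        have "G x * exp (h * of_real x) - G x - h * (G x * of_real x) = G x * (exp (h * of_real x) - 1 - h * of_real x)"
          by (simp add: algebra_simps)
        also have "norm \<dots> \<le> (B * E \<sigma> x) * (exp (\<sigma> / 2 * \<bar>x\<bar>) * ((norm h)\<^sup>2 * x\<^sup>2))"
          unfolding norm_mult using Gb 1 B by (intro mult_mono) (auto simp: E_def)
        also have "E \<sigma> x * exp (\<sigma> / 2 * \<bar>x\<bar>) = E (\<sigma> / 2) x"
          by (auto simp: E_def indicator_def abs_if simp flip: exp_add)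
        then have "(B * E \<sigma> x) * (exp (\<sigma> / 2 * \<bar>x\<bar>) * ((norm h)\<^sup>2 * x\<^sup>2)) = B * (norm h)\<^sup>2 * (x\<^sup>2 * E (\<sigma> / 2) x)"
          by (metis mult.assoc mult.commute)
        also have "\<dots> \<le> B * (norm h)\<^sup>2 * ((32 / \<sigma>\<^sup>2) * E (\<sigma> / 4) x)"
          using B by (intro mult_left_mono quad) auto
        finally show "norm (G x * exp (h * of_real x) - G x - h * (G x * of_real x)) \<le> B * (32 / \<sigma>\<^sup>2) * (norm h)\<^sup>2 * E (\<sigma> / 4) x"
          by (simp add: mult_ac)
      qed (use int_h int_G int_D E \<sigma> in auto)
      also have "\<dots> = C * (norm h)\<^sup>2" by (simp add: C_def)
      finally have "norm (mellin f (s + h) - mellin f s - h * D) / norm h \<le> C * (norm h)\<^sup>2 / norm h"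
        by (rule divide_right_mono) simp
      moreover have "(mellin f (s + h) - mellin f s) / h - D = (mellin f (s + h) - mellin f s - h * D) / h"
        using h by (simp add: divide_simps)
      ultimately show ?thesis using h by (simp add: norm_divide power2_eq_square)
    qed
    have "((\<lambda>h. (mellin f (s + h) - mellin f s) / h - D) \<longlongrightarrow> 0) (at 0)"
    proof (rule Lim_null_comparison)
      have "eventually (\<lambda>h. h \<in> ball 0 (\<sigma> / 2) - {0}) (at (0::complex))"
        using \<sigma> by (intro eventually_at_in_open) auto
      then show "eventually (\<lambda>h. norm ((mellin f (s + h) - mellin f s) / h - D) \<le> C * norm h) (at 0)"
        by eventually_elim (use est in \<open>auto simp: dist_norm\<close>)
      show "((\<lambda>h::complex. C * norm h) \<longlongrightarrow> 0) (at 0)"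
        by (rule tendsto_eq_intros refl | simp)+
    qed
    then have "(mellin f has_field_derivative D) (at s)"
      by (simp add: DERIV_def Lim_null[symmetric])
    then show ?thesis ..
  qed
  then show ?thesis
    by (auto simp: holomorphic_on_open open_halfspace_Re_gt)
qed

lemma mellin_scale:
  assumes "c > 0"
  shows "mellin (\<lambda>u. f (c * u)) s = pw s c * mellin f s"
proof -
  have "mellin f s = (\<integral>x. f (exp (ln c + 1 * x)) * exp (s * of_real (ln c + 1 * x)) \<partial>lborel)"
    unfolding mellin_def using lborel_integral_real_affine[of 1 "\<lambda>x. f (exp x) * exp (s * of_real x)" "ln c"] by simp
  also have "\<dots> = (\<integral>x. exp (s * of_real (ln c)) * (f (c * exp x) * exp (s * of_real x)) \<partial>lborel)"
    using assms by (simp add: exp_add distrib_left mult_ac)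
  also have "\<dots> = exp (s * of_real (ln c)) * mellin (\<lambda>u. f (c * u)) s"
    by (simp add: mellin_def)
  finally show ?thesis by (simp add: pw_def exp_minus)
qed

subsection \<open>Smooth functions supported in the unit interval\<close>

abbreviation vderiv :: "(real \<Rightarrow> complex) \<Rightarrow> real \<Rightarrow> complex" where
  "vderiv f \<equiv> \<lambda>x. vector_derivative f (at x)"

text \<open>\<open>S0_le1\<close> without the condition on the mean. The support is described
  pointwise, which by continuity at 0 and 1 agrees with the closure condition, see
  \<open>S0_le1_iff\<close>.\<close>

definition smooth01 :: "(real \<Rightarrow> complex) set" where
  "smooth01 = {f. smooth f \<and> (\<forall>x. x \<notin> {0<..<1} \<longrightarrow> f x = 0)}"

lemma smooth_imp_derivative:
  assumes "smooth f"
  shows "(f has_vector_derivative vderiv f x) (at x)" "smooth (vderiv f)" "continuous_on UNIV f"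
proof -
  have s: "((vderiv ^^ n) f) differentiable_on UNIV" for n using assms by (simp add: smooth_def)
  have "f differentiable_on UNIV" using s[of 0] by simp
  then show "(f has_vector_derivative vderiv f x) (at x)" "continuous_on UNIV f"
    by (simp_all add: differentiable_on_def vector_derivative_works[symmetric] continuous_on_eq_continuous_within differentiable_imp_continuous_within)
  have "((vderiv ^^ n) (vderiv f)) differentiable_on UNIV" for n
    using s[of "Suc n"] by (simp only: funpow_Suc_right o_apply)
  then show "smooth (vderiv f)" by (simp add: smooth_def)
qed

text \<open>A class of functions that contains a derivative of each member contains all iterated
  derivatives, so these never have to be computed. It is used for sums, for dilations and for the
  family \<open>bump\<close>.\<close>

lemma smooth_coinduct:
  assumes "f \<in> S" and step: "\<And>f. f \<in> S \<Longrightarrow> \<exists>g\<in>S. \<forall>x. (f has_vector_derivative g x) (at x)"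
  shows "smooth f"
  unfolding smooth_def
proof
  fix n
  have "(vderiv ^^ n) f \<in> S"
  proof (induction n)
    case (Suc n)
    obtain g where g: "g \<in> S" "\<forall>x. ((vderiv ^^ n) f has_vector_derivative g x) (at x)" using step[OF Suc] by blast
    then have "vderiv ((vderiv ^^ n) f) = g" by (auto simp: vector_derivative_at)
    then show ?case using g by simp
  qed (use assms in simp)
  then obtain g where "\<forall>x. ((vderiv ^^ n) f has_vector_derivative g x) (at x)" using step by blast
  then show "(vderiv ^^ n) f differentiable_on UNIV"
    by (auto simp: differentiable_on_def intro: differentiableI_vector)
qed

lemma smooth_add:
  assumes "smooth f" "smooth g" shows "smooth (\<lambda>x. f x + g x)"
proof (rule smooth_coinduct[of _ "{\<lambda>x. f x + g x | f g. smooth f \<and> smooth g}"])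
  show "\<exists>g\<in>{\<lambda>x. f x + g x | f g. smooth f \<and> smooth g}. \<forall>x. (h has_vector_derivative g x) (at x)"
    if "h \<in> {\<lambda>x. f x + g x | f g. smooth f \<and> smooth g}" for h
  proof -
    from that obtain f g where h: "h = (\<lambda>x. f x + g x)" "smooth f" "smooth g" by blast
    show ?thesis
      by (rule bexI[of _ "\<lambda>x. vderiv f x + vderiv g x"])
         (use h in \<open>auto intro!: derivative_intros smooth_imp_derivative\<close>)
  qed
qed (use assms in blast)

lemma smooth_scale:
  assumes "smooth f" shows "smooth (\<lambda>x. a * f (c * x))"
proof (rule smooth_coinduct[of _ "{\<lambda>x. a * f (c * x) | a f. smooth f}"])
  show "\<exists>g\<in>{\<lambda>x. a * f (c * x) | a f. smooth f}. \<forall>x. (h has_vector_derivative g x) (at x)"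
    if "h \<in> {\<lambda>x. a * f (c * x) | a f. smooth f}" for h
  proof -
    from that obtain a f where h: "h = (\<lambda>x. a * f (c * x))" "smooth f" by blast
    have "(f \<circ> (\<lambda>x. c * x) has_vector_derivative c *\<^sub>R vderiv f (c * x)) (at x)" for x
      by (rule vector_diff_chain_at) (use smooth_imp_derivative[OF h(2)] in \<open>auto intro!: derivative_eq_intros\<close>)
    from has_vector_derivative_mult_right[OF this, of a]
    have "(h has_vector_derivative (a * of_real c) * vderiv f (c * x)) (at x)" for x
      by (simp add: h o_def scaleR_conv_of_real mult.assoc)
    then show ?thesis using smooth_imp_derivative(2)[OF h(2)]
      by (intro bexI[of _ "\<lambda>x. (a * of_real c) * vderiv f (c * x)"]) auto
  qed
qed (use assms in blast)

lemma smooth_sum: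
  assumes "\<And>i. i \<in> I \<Longrightarrow> smooth (f i)" shows "smooth (\<lambda>x. \<Sum>i\<in>I. f i x)"
proof -
  have z: "smooth (\<lambda>x. 0)"
    by (rule smooth_coinduct[of _ "{\<lambda>x. 0}"]) (auto intro: has_vector_derivative_const)
  then show ?thesis
  proof (cases "finite I")
    case True
    then show ?thesis using assms by (induction I rule: finite_induct) (auto intro: z smooth_add)
  qed simp
qed

lemma smooth01_D:
  assumes "f \<in> smooth01"
  shows "smooth f" "x \<le> 0 \<Longrightarrow> f x = 0" "x \<ge> 1 \<Longrightarrow> f x = 0" "continuous_on UNIV f"
    "f \<in> borel_measurable borel"
  using assms smooth_imp_derivative(3)[of f] by (auto simp: smooth01_def intro: borel_measurable_continuous_onI)

lemma continuous_zero_outside: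
  fixes f :: "real \<Rightarrow> complex"
  assumes "continuous_on UNIV f" "\<And>x. x < 0 \<or> x > 1 \<Longrightarrow> f x = 0" "x \<notin> {0<..<1}"
  shows "f x = 0"
proof -
  have "closed {x. f x = 0}"
    by (intro closed_Collect_eq assms continuous_on_const)
  moreover have "{..<0} \<union> {1<..} \<subseteq> {x. f x = 0}" using assms(2) by auto
  ultimately have "closure ({..<0} \<union> {1<..}) \<subseteq> {x. f x = 0}" by (rule closure_minimal[rotated])
  then have "{..0} \<union> {1..} \<subseteq> {x. f x = 0}" by (simp add: closure_Un)
  moreover have "x \<in> {..0} \<union> {1..}" using assms(3) by auto
  ultimately show ?thesis by blast
qed

lemma S0_le1_iff: "f \<in> S0_le1 \<longleftrightarrow> f \<in> smooth01 \<and> integral {0..1} f = 0"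
proof -
  have "f \<in> smooth01" if s: "smooth f" and c: "closure {x. f x \<noteq> 0} \<subseteq> {0..1}"
  proof -
    have "f x = 0" if "x < 0 \<or> x > 1" for x
      using that c closure_subset[of "{x. f x \<noteq> 0}"] by fastforce
    from continuous_zero_outside[OF smooth_imp_derivative(3)[OF s] this]
    show ?thesis using s unfolding smooth01_def by blast
  qed
  moreover have "closure {x. f x \<noteq> 0} \<subseteq> {0..1}" if "f \<in> smooth01"
  proof (rule closure_minimal)
    show "{x. f x \<noteq> 0} \<subseteq> {0..1}"
    proof
      fix x assume "x \<in> {x. f x \<noteq> 0}"
      then have "\<not> x \<le> 0" "\<not> x \<ge> 1" using smooth01_D(2,3)[OF that] by blast+
      then show "x \<in> {0..1}" by simp
    qed
  qed simp
  ultimately show ?thesis by (auto simp: S0_le1_def dest: smooth01_D(1))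
qed

lemma smooth01_vderiv:
  assumes f: "f \<in> smooth01" shows "vderiv f \<in> smooth01"
proof -
  note s = smooth_imp_derivative[OF smooth01_D(1)[OF f]]
  have "vderiv f x = 0" if "x < 0 \<or> x > 1" for x
  proof -
    have "((\<lambda>x. 0) has_vector_derivative 0) (at x)" by (rule has_vector_derivative_const)
    moreover have "open ({..<0} \<union> {1<..} :: real set)" by auto
    ultimately have "(f has_vector_derivative 0) (at x)"
      by (rule has_vector_derivative_transform_within_open) (use that smooth01_D(2,3)[OF f] in auto)
    then show ?thesis by (rule vector_derivative_at)
  qed
  from continuous_zero_outside[OF smooth_imp_derivative(3)[OF s(2)] this]
  show ?thesis using s(2) unfolding smooth01_def by blast
qed

lemma smooth01_bounded:
  assumes f: "f \<in> smooth01" shows "\<exists>B\<ge>0. \<forall>x. norm (f x) \<le> B"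
proof -
  have "compact (f ` {0..1})"
    by (intro compact_continuous_image continuous_on_subset[OF smooth01_D(4)[OF f]]) auto
  then have "bounded (f ` {0..1})" by (rule compact_imp_bounded)
  then obtain B where B: "\<forall>y \<in> f ` {0..1}. norm y \<le> B"
    unfolding bounded_iff by blast
  have "norm (f x) \<le> max B 0" for x
    using B smooth01_D(2,3)[OF f, of x] by (cases "x \<in> {0..1}") (auto simp: le_max_iff_disj)
  then show ?thesis by (intro exI[of _ "max B 0"]) auto
qed

lemma smooth01_dilate:
  assumes f: "f \<in> smooth01" and c: "c \<ge> 1"
  shows "(\<lambda>u. f (c * u)) \<in> smooth01"
proof -
  have "smooth (\<lambda>x. 1 * f (c * x))" by (rule smooth_scale[OF smooth01_D(1)[OF f]])
  moreover have "f (c * x) = 0" if "x \<notin> {0<..<1}" for x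
  proof (cases "x \<le> 0")
    case True
    then show ?thesis using c by (intro smooth01_D(2)[OF f] mult_nonneg_nonpos) auto
  next
    case False
    then have "1 * 1 \<le> c * x" using that c by (intro mult_mono) auto
    then show ?thesis by (intro smooth01_D(3)[OF f]) simp
  qed
  ultimately show ?thesis by (simp add: smooth01_def)
qed

lemma smooth01_mellin_integrable:
  assumes "f \<in> smooth01" "Re s > 0"
  shows "integrable lborel (\<lambda>x. f (exp x) * exp (s * of_real x))"
proof -
  obtain B where "\<And>x. norm (f x) \<le> B" using smooth01_bounded[OF assms(1)] by blast
  then show ?thesis using smooth01_D[OF assms(1)] assms(2) by (intro mellin_integrable) auto
qed

text \<open>Integration by parts in the variable x: \<open>g\<close> is the derivative of
  \<open>f (exp x) * exp (s * x)\<close>, whose boundary values vanish, at 0 because f(1) = 0 and at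
  minus infinity because Re s > 0.\<close>

lemma mellin_vderiv:
  assumes f: "f \<in> smooth01" and s: "Re s > 0"
  shows "mellin (vderiv f) (s + 1) = - s * mellin f s"
proof -
  note d = smooth_imp_derivative(1)[OF smooth01_D(1)[OF f]]
  note f' = smooth01_vderiv[OF f]
  obtain B where B: "B \<ge> 0" "\<And>x. norm (f x) \<le> B" using smooth01_bounded[OF f] by blast
  let ?g1 = "\<lambda>x. vderiv f (exp x) * exp ((s + 1) * of_real x)"
  let ?g2 = "\<lambda>x. f (exp x) * exp (s * of_real x)"
  define g where "g x = ?g1 x + s * ?g2 x" for x
  have int: "integrable lborel ?g1" "integrable lborel ?g2"
    using smooth01_mellin_integrable[OF f s] smooth01_mellin_integrable[OF f', of "s + 1"] s by auto
  have ind: "indicator {..<0} x *\<^sub>R g x = g x" for x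
    using smooth01_D(3)[OF f, of "exp x"] smooth01_D(3)[OF f', of "exp x"] by (cases "x < 0") (auto simp: g_def)
  have "(\<integral>x. indicator {..<0} x *\<^sub>R g x \<partial>lborel) = 0 - 0"
  proof (rule FTC_left_half_line)
    fix x :: real
    have 1: "(f \<circ> exp has_vector_derivative exp x *\<^sub>R vderiv f (exp x)) (at x)"
      by (rule vector_diff_chain_at[OF _ d]) (auto intro!: derivative_eq_intros simp flip: has_real_derivative_iff_has_vector_derivative)
    have 2: "((\<lambda>x. exp (s * of_real x)) has_vector_derivative s * exp (s * of_real x)) (at x)"
    proof -
      have "((exp \<circ> (\<lambda>x. s * of_real x)) has_vector_derivative (s * 1) * exp (s * of_real x)) (at x)"
        by (rule field_vector_diff_chain_at) (auto intro!: derivative_eq_intros)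
      then show ?thesis by (simp add: o_def)
    qed
    have e: "exp ((s + 1) * of_real x) = exp (s * of_real x) * of_real (exp x)"
      by (simp only: distrib_right exp_add mult_1 exp_of_real)
    from has_vector_derivative_mult[OF 1 2]
    show "((\<lambda>x. f (exp x) * exp (s * of_real x)) has_vector_derivative g x) (at x)"
      unfolding g_def e by (simp add: o_def scaleR_conv_of_real mult_ac add.commute)
    have "continuous_on UNIV g" unfolding g_def
      by (intro continuous_intros continuous_on_compose2[OF smooth01_D(4)[OF f]] continuous_on_compose2[OF smooth01_D(4)[OF f']]) auto
    then show "isCont g x" by (simp add: continuous_on_eq_continuous_at)
  next
    show "integrable lborel (\<lambda>x. indicator {..<0} x *\<^sub>R g x)" unfolding ind using int by (simp add: g_def)
    have "((\<lambda>x. B * exp (Re s * x)) \<longlongrightarrow> B * 0) at_bot"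
      by (intro tendsto_intros filterlim_compose[OF exp_at_bot] filterlim_tendsto_pos_mult_at_bot[OF tendsto_const s] filterlim_ident)
    then show "(?g2 \<longlongrightarrow> 0) at_bot"
      by (intro Lim_null_comparison[of ?g2 "\<lambda>x. B * exp (Re s * x)"] always_eventually allI)
         (auto simp: norm_mult intro!: mult_right_mono B(2))
    have "continuous_on UNIV ?g2"
      by (intro continuous_intros continuous_on_compose2[OF smooth01_D(4)[OF f]]) auto
    then have "isCont ?g2 0" by (simp add: continuous_on_eq_continuous_at)
    then have "(?g2 \<longlongrightarrow> ?g2 0) (at_left 0)" unfolding isCont_def filterlim_at_split by blast
    then show "(?g2 \<longlongrightarrow> 0) (at_left 0)" using smooth01_D(3)[OF f, of 1] by simp
  qed
  then have "(\<integral>x. g x \<partial>lborel) = 0" unfolding ind by simp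
  then have "mellin (vderiv f) (s + 1) + s * mellin f s = 0"
    unfolding g_def mellin_def using int by simp
  then show ?thesis by (simp add: eq_neg_iff_add_eq_0)
qed

text \<open>Each integration by parts gains a factor s at the price of a derivative of f. The shift
  from s to s + 1 is harmless, since it increases the norm when Re s is positive.\<close>

lemma mellin_decay:
  assumes "f \<in> smooth01"
  shows "\<exists>C\<ge>0. \<forall>s. Re s \<ge> 1/2 \<longrightarrow> norm (mellin f s) * norm s ^ k \<le> C"
  using assms
proof (induction k arbitrary: f)
  case 0
  obtain B where B: "B \<ge> 0" "\<And>x. norm (f x) \<le> B" using smooth01_bounded[OF 0] by blast
  have "norm (mellin f s) \<le> 2 * B" if "Re s \<ge> 1/2" for s
  proof -
    have "norm (mellin f s) \<le> B / Re s"
      using B smooth01_D[OF 0] that by (intro norm_mellin_le) auto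
    also have "\<dots> \<le> B / (1/2)" using B that by (intro divide_left_mono) auto
    finally show ?thesis by simp
  qed
  then show ?case using B by (intro exI[of _ "2 * B"]) auto
next
  case (Suc k)
  obtain C where C: "C \<ge> 0" "\<And>s. Re s \<ge> 1/2 \<Longrightarrow> norm (mellin (vderiv f) s) * norm s ^ k \<le> C"
    using Suc.IH[OF smooth01_vderiv[OF Suc.prems]] by blast
  have "norm (mellin f s) * norm s ^ Suc k \<le> C" if s: "Re s \<ge> 1/2" for s
  proof -
    have "norm (mellin f s) * norm s ^ Suc k = norm (mellin (vderiv f) (s + 1)) * norm s ^ k"
      using mellin_vderiv[OF Suc.prems, of s] s by (simp add: norm_mult)
    also have "norm s \<le> norm (s + 1)" using s by (simp add: cmod_def power_mono)
    then have "norm (mellin (vderiv f) (s + 1)) * norm s ^ k \<le> norm (mellin (vderiv f) (s + 1)) * norm (s + 1) ^ k"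
      by (intro mult_left_mono power_mono) auto
    also have "\<dots> \<le> C" using s by (intro C) auto
    finally show ?thesis .
  qed
  then show ?case using C by blast
qed

subsection \<open>The Mellin transform of \<open>T_op \<phi>\<close>\<close>

lemma T_op_finite:
  assumes f: "f \<in> smooth01" and "real N * u \<ge> 1" "u > 0"
  shows "T_op f u = (\<Sum>n<N. f (real (Suc n) * u))"
  unfolding T_op_def
proof (rule suminf_finite)
  fix n assume "n \<notin> {..<N}"
  then have "real N * u \<le> real (Suc n) * u" using assms by (intro mult_right_mono) auto
  then show "f (real (Suc n) * u) = 0" using assms by (intro smooth01_D(3)[OF f]) linarith
qed simp

lemma T_op_zero:
  assumes f: "f \<in> smooth01" and u: "u \<le> 0 \<or> u \<ge> 1"
  shows "T_op f u = 0"
proof (cases "u \<le> 0")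
  case True
  then have "f (real (Suc n) * u) = 0" for n
    by (intro smooth01_D(2)[OF f]) (auto intro: mult_nonneg_nonpos)
  then show ?thesis by (simp add: T_op_def)
next
  case False
  then show ?thesis using u T_op_finite[OF f, of 1 u] smooth01_D(3)[OF f, of u] by auto
qed

lemma T_op_measurable: "f \<in> smooth01 \<Longrightarrow> T_op f \<in> borel_measurable borel"
proof -
  assume "f \<in> smooth01"
  then have [measurable]: "f \<in> borel_measurable borel" by (rule smooth01_D)
  show ?thesis unfolding T_op_def by measurable
qed

lemma T_op_continuous:
  assumes f: "f \<in> smooth01" shows "continuous_on {0<..} (T_op f)"
proof -
  have "isCont (T_op f) u" if u: "u > 0" for u
  proof -
    obtain N where N: "2 / u < real N" using reals_Archimedean2 by blast
    have "continuous_on {u/2<..} (\<lambda>v. \<Sum>n<N. f (real (Suc n) * v))"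
      by (intro continuous_intros continuous_on_compose2[OF smooth01_D(4)[OF f]]) auto
    moreover have "(\<Sum>n<N. f (real (Suc n) * v)) = T_op f v" if "v \<in> {u/2<..}" for v
    proof (rule sym, rule T_op_finite[OF f])
      have "1 = 2 / u * (u / 2)" using u by simp
      also have "\<dots> \<le> real N * v" using N u that by (intro mult_mono) auto
      finally show "1 \<le> real N * v" .
      show "v > 0" using that u by auto
    qed
    ultimately have "continuous_on {u/2<..} (T_op f)" by (rule continuous_on_eq)
    then show ?thesis using u by (auto simp: continuous_on_eq_continuous_at)
  qed
  then show ?thesis by (auto simp: continuous_on_eq_continuous_at)
qed

text \<open>\<open>u * T_op f u\<close> is a Riemann sum with mesh u for the integral of
  \<open>f\<close>, which is 0. By the Lipschitz bound each cell errs by at most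
  \<open>B * u * u\<close>, and \<open>N * u < 2\<close>, so the total error is at most 2 B u. With
  a nonzero mean, \<open>T_op f\<close> would grow like 1/u.\<close>

lemma T_op_bounded:
  assumes f: "f \<in> smooth01" and f0: "integral {0..1} f = 0"
  shows "\<exists>B\<ge>0. \<forall>u. norm (T_op f u) \<le> B"
proof -
  obtain B where B: "B \<ge> 0" "\<And>x. norm (vderiv f x) \<le> B"
    using smooth01_bounded[OF smooth01_vderiv[OF f]] by blast
  have lip: "norm (f x - f y) \<le> B * \<bar>x - y\<bar>" for x y
  proof -
    have "norm (f x - f y) \<le> B * norm (x - y)"
    proof (rule differentiable_bound[where S = UNIV and f' = "\<lambda>x h. h *\<^sub>R vderiv f x"])
      show "(f has_derivative (\<lambda>h. h *\<^sub>R vderiv f x)) (at x within UNIV)" for x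
        using smooth_imp_derivative(1)[OF smooth01_D(1)[OF f], of x] by (simp add: has_vector_derivative_def)
      show "onorm (\<lambda>h. h *\<^sub>R vderiv f x) \<le> B" for x
        by (rule onorm_le) (use mult_left_mono[OF B(2) abs_ge_zero] in \<open>simp add: mult.commute\<close>)
    qed auto
    then show ?thesis by simp
  qed
  have integ: "f integrable_on {a..b}" for a b
    using integrable_continuous_interval continuous_on_subset[OF smooth01_D(4)[OF f]] by blast
  define I where "I x = integral {0..x} f" for x
  have comb: "I a + integral {a..b} f = I b" if "0 \<le> a" "a \<le> b" for a b
    unfolding I_def by (rule Henstock_Kurzweil_Integration.integral_combine[OF that integ])
  have "norm (T_op f u) \<le> 2 * B" if u: "0 < u" "u < 1" for u
  proof -
    define N where "N = nat \<lceil>1 / u\<rceil>"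
    have "1 / u > 0" using u by simp
    then have "1 / u \<le> real N" "real N < 1 / u + 1" unfolding N_def by linarith+
    then have Nu: "1 \<le> real N * u" "real N * u < 1 + u" using u by (auto simp: field_simps)
    have "integral {1..real N * u} f = integral {1..real N * u} (\<lambda>_. 0)"
      by (rule integral_cong) (use smooth01_D(3)[OF f] in auto)
    then have IN: "I (real N * u) = 0" using comb[of 1 "real N * u"] Nu f0 by (simp add: I_def)
    have piece: "norm (u *\<^sub>R f (real (Suc n) * u) - (I (real (Suc n) * u) - I (real n * u))) \<le> B * u * u" for n
    proof -
      have le: "real n * u \<le> real (Suc n) * u" "0 \<le> real n * u" using u by (auto intro!: mult_right_mono)
      have "u *\<^sub>R f (real (Suc n) * u) - (I (real (Suc n) * u) - I (real n * u))
        = integral {real n * u..real (Suc n) * u} (\<lambda>x. f (real (Suc n) * u) - f x)"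
        using comb[OF le(2,1)] le integ by (subst integral_diff) (auto simp: algebra_simps)
      also have "norm \<dots> \<le> (B * u) * (real (Suc n) * u - real n * u)"
      proof (rule integral_bound[OF le(1)])
        show "continuous_on {real n * u..real (Suc n) * u} (\<lambda>x. f (real (Suc n) * u) - f x)"
          by (intro continuous_intros continuous_on_subset[OF smooth01_D(4)[OF f]]) auto
        fix x assume x: "x \<in> {real n * u..real (Suc n) * u}"
        have "norm (f (real (Suc n) * u) - f x) \<le> B * \<bar>real (Suc n) * u - x\<bar>" by (rule lip)
        also have "\<dots> \<le> B * u" using x B(1) by (intro mult_left_mono) (auto simp: algebra_simps)
        finally show "norm (f (real (Suc n) * u) - f x) \<le> B * u" .
      qed
      finally show ?thesis by (simp add: algebra_simps)
    qed
    have "u *\<^sub>R T_op f u = (\<Sum>n<N. u *\<^sub>R f (real (Suc n) * u) - (I (real (Suc n) * u) - I (real n * u)))"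
      using T_op_finite[OF f Nu(1) u(1)] IN sum_lessThan_telescope[of "\<lambda>n. I (real n * u)" N]
      by (simp add: sum_subtractf scaleR_right.sum I_def del: of_nat_Suc)
    also have "norm \<dots> \<le> (\<Sum>n<N. B * u * u)" by (rule sum_norm_le) (use piece in auto)
    finally have "u * norm (T_op f u) \<le> u * (B * (real N * u))" using u by (simp add: algebra_simps)
    then have "norm (T_op f u) \<le> B * (real N * u)" using u by simp
    also have "\<dots> \<le> B * 2" using Nu u B by (intro mult_left_mono) auto
    finally show ?thesis by simp
  qed
  moreover have "norm (T_op f u) \<le> 2 * B" if "u \<le> 0 \<or> u \<ge> 1" for u
    using T_op_zero[OF f that] B by simp
  ultimately have "norm (T_op f u) \<le> 2 * B" for u by (cases "0 < u \<and> u < 1") auto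
  then show ?thesis using B by (intro exI[of _ "2 * B"]) auto
qed

text \<open>Termwise integration: a dilation is a translation of x, so the L1 norm of the n-th term
  is \<open>(real n + 1) powr (- Re s)\<close> times that of the undilated integrand, and these are
  summable for Re s > 1.\<close>

lemma mellin_T_op_right:
  assumes f: "f \<in> smooth01" and s: "Re s > 1"
  shows "mellin (T_op f) s = riemann_zeta s * mellin f s"
proof -
  have s0: "Re s > 0" using s by simp
  let ?g = "\<lambda>n x. f (real (Suc n) * exp x) * exp (s * of_real x)"
  have scaled: "(\<lambda>u. f (real (Suc n) * u)) \<in> smooth01" for n
    by (rule smooth01_dilate[OF f]) simp
  have int: "integrable lborel (?g n)" for n
    using smooth01_mellin_integrable[OF scaled s0] .
  have absint: "(\<integral>x. norm (?g n x) \<partial>lborel) = (real n + 1) powr (- Re s) * (\<integral>x. norm (f (exp x) * exp (s * of_real x)) \<partial>lborel)" for n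
  proof -
    have "(\<integral>x. norm (f (exp x) * exp (s * of_real x)) \<partial>lborel)
       = (\<integral>x. norm (f (exp (ln (real (Suc n)) + 1 * x)) * exp (s * of_real (ln (real (Suc n)) + 1 * x))) \<partial>lborel)"
      using lborel_integral_real_affine[of 1 "\<lambda>x. norm (f (exp x) * exp (s * of_real x))" "ln (real (Suc n))"] by simp
    also have "\<dots> = (\<integral>x. real (Suc n) powr (Re s) * norm (?g n x) \<partial>lborel)"
      by (simp add: exp_add distrib_left norm_mult powr_def mult_ac del: of_nat_Suc)
    also have "\<dots> = real (Suc n) powr (Re s) * (\<integral>x. norm (?g n x) \<partial>lborel)" by simp
    finally show ?thesis by (simp add: powr_minus add.commute)
  qed
  have pt: "summable (\<lambda>n. norm (?g n x))" for x
  proof -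
    obtain N where N: "1 / exp x < real N" using reals_Archimedean2 by blast
    show ?thesis
    proof (rule summable_finite)
      fix n assume "n \<notin> {..<N}"
      then have "real N \<le> real (Suc n)" by simp
      then have "1 / exp x \<le> real (Suc n)" using N by linarith
      then have "1 \<le> real (Suc n) * exp x" by (simp add: field_simps)
      then show "norm (?g n x) = 0" by (simp only: smooth01_D(3)[OF f]) simp
    qed simp
  qed
  have T: "T_op f (exp x) * exp (s * of_real x) = (\<Sum>n. ?g n x)" for x
  proof -
    have "summable (\<lambda>n. f (real (Suc n) * exp x))"
    proof (rule summable_norm_cancel)
      have "(\<lambda>n. norm (?g n x) / norm (exp (s * of_real x))) = (\<lambda>n. norm (f (real (Suc n) * exp x)))"
        by (simp add: norm_mult)
      then show "summable (\<lambda>n. norm (f (real (Suc n) * exp x)))"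
        using summable_divide[OF pt[of x]] by metis
    qed
    then show ?thesis unfolding T_op_def by (rule suminf_mult2)
  qed
  have "(\<lambda>n. integral\<^sup>L lborel (?g n)) sums mellin (T_op f) s"
    unfolding mellin_def T
  proof (rule sums_integral[OF int])
    show "AE x in lborel. summable (\<lambda>n. norm (?g n x))" using pt by simp
    show "summable (\<lambda>n. \<integral>x. norm (?g n x) \<partial>lborel)"
      unfolding absint by (intro summable_mult2 summable_pw_bound s)
  qed
  moreover have "integral\<^sup>L lborel (?g n) = pw s (real (Suc n)) * mellin f s" for n
    using mellin_scale[of "real (Suc n)" f s] by (simp add: mellin_def del: of_nat_Suc)
  ultimately have "(\<lambda>n. pw s (real (Suc n)) * mellin f s) sums mellin (T_op f) s" by simp
  moreover have "(\<lambda>n. pw s (real (Suc n)) * mellin f s) sums (riemann_zeta s * mellin f s)"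
    using riemann_zeta_sums[OF s] by (intro sums_mult2) (simp add: pw_eq_powr powr_minus divide_inverse)
  ultimately show ?thesis by (rule sums_unique2)
qed

text \<open>The mean zero makes \<open>T_op f\<close> bounded, so its transform is holomorphic on
  all of Re s > 0 and the identity continues analytically past the pole, down to the critical
  line.\<close>

lemma mellin_T_op:
  assumes f: "f \<in> smooth01" and f0: "integral {0..1} f = 0" and s: "Re s > 0" "s \<noteq> 1"
  shows "mellin (T_op f) s = riemann_zeta s * mellin f s"
proof (rule analytic_continuation_open[of "{s. Re s > 1}" "{s. Re s > 0} - {1}" "mellin (T_op f)"
      "\<lambda>s. riemann_zeta s * mellin f s" s])
  obtain B where B: "\<And>u. norm (f u) \<le> B" using smooth01_bounded[OF f] by blast
  obtain B' where B': "\<And>u. norm (T_op f u) \<le> B'" using T_op_bounded[OF f f0] by blast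
  have "mellin (T_op f) holomorphic_on {s. Re s > 0}"
    by (rule mellin_holomorphic[OF T_op_measurable[OF f] B' T_op_zero[OF f]]) auto
  then show "mellin (T_op f) holomorphic_on {s. Re s > 0} - {1}" by (rule holomorphic_on_subset) auto
  have "mellin f holomorphic_on {s. Re s > 0}"
    by (rule mellin_holomorphic[OF smooth01_D(5)[OF f] B smooth01_D(3)[OF f]])
  then show "(\<lambda>s. riemann_zeta s * mellin f s) holomorphic_on {s. Re s > 0} - {1}"
    by (intro holomorphic_intros holomorphic_on_subset[OF riemann_zeta_holomorphic]) (auto elim: holomorphic_on_subset)
  show "open ({s. Re s > 0} - {1::complex})" by (intro open_Diff) (auto simp: open_halfspace_Re_gt)
  show "connected ({s. Re s > 0} - {1::complex})"
    by (intro connected_open_delete) (auto simp: open_halfspace_Re_gt convex_halfspace_Re_gt intro!: convex_connected)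
  have "2 \<in> {s::complex. Re s > 1}" by simp
  then show "{s::complex. Re s > 1} \<noteq> {}" by blast
qed (use s mellin_T_op_right[OF f] in \<open>auto simp: open_halfspace_Re_gt\<close>)

section \<open>The substitution u = exp x between (0,1) and the real line\<close>

lemma exp_substitution:
  fixes F :: "real \<Rightarrow> 'a::euclidean_space"
  assumes F: "F \<in> borel_measurable borel" "\<And>u. u \<ge> 1 \<Longrightarrow> F u = 0"
    and int: "integrable lborel (\<lambda>x. exp x *\<^sub>R F (exp x))"
  shows "integrable (lebesgue_on {0<..<1}) F"
    and "integral\<^sup>L (lebesgue_on {0<..<1}) F = (\<integral>x. exp x *\<^sub>R F (exp x) \<partial>lborel)"
proof -
  note [measurable] = F(1)
  let ?G = "\<lambda>x. exp x *\<^sub>R F (exp x)"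
  have G: "?G \<in> borel_measurable lborel" by measurable
  have "integrable lebesgue ?G" using int G by (subst integrable_completion)
  then have intG: "integrable (lebesgue_on UNIV) ?G" by (simp add: lebesgue_on_UNIV_eq)
  have "integral UNIV ?G = integral\<^sup>L (lebesgue_on UNIV) ?G"
    using lebesgue_integral_eq_integral[OF intG] by simp
  also have "\<dots> = integral\<^sup>L lborel ?G"
    unfolding lebesgue_on_UNIV_eq by (rule integral_completion[OF G])
  finally have "(\<lambda>x. \<bar>exp x\<bar> *\<^sub>R F (exp x)) absolutely_integrable_on UNIV \<and>
      integral UNIV (\<lambda>x. \<bar>exp x\<bar> *\<^sub>R F (exp x)) = integral\<^sup>L lborel ?G"
    using intG by (simp add: set_integrable_def lebesgue_on_UNIV_eq)
  then have *: "F absolutely_integrable_on range exp \<and> integral (range exp) F = integral\<^sup>L lborel ?G"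
    by (subst (asm) has_absolute_integral_change_of_variables_real) (auto intro!: derivative_eq_intros inj_onI)
  have r: "range exp = {0::real<..}"
  proof (intro equalityI subsetI)
    fix u :: real assume "u \<in> {0<..}"
    then have "u = exp (ln u)" by simp
    then show "u \<in> range exp" by (rule range_eqI)
  qed auto
  have ind: "indicator {0<..} u *\<^sub>R F u = indicator {0<..<1} u *\<^sub>R F u" for u
    using F(2)[of u] by (auto simp: indicator_def)
  have "integrable lebesgue (\<lambda>u. indicator {0<..} u *\<^sub>R F u)"
    using * by (simp add: r set_integrable_def)
  then show "integrable (lebesgue_on {0<..<1}) F"
    unfolding ind by (subst integrable_restrict_space) auto
  have i: "integrable (lebesgue_on {0<..}) F"
    using \<open>integrable lebesgue (\<lambda>u. indicator {0<..} u *\<^sub>R F u)\<close> by (subst integrable_restrict_space) auto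
  have "integral\<^sup>L (lebesgue_on {0<..<1}) F = integral\<^sup>L lebesgue (\<lambda>u. indicator {0<..<1} u *\<^sub>R F u)"
    by (subst integral_restrict_space) auto
  also have "\<dots> = integral\<^sup>L (lebesgue_on {0<..}) F"
    unfolding ind[symmetric] by (subst integral_restrict_space) auto
  also have "\<dots> = integral {0<..} F" by (rule lebesgue_integral_eq_integral[OF i]) auto
  finally show "integral\<^sup>L (lebesgue_on {0<..<1}) F = integral\<^sup>L lborel ?G" using * by (simp add: r)
qed

text \<open>Translates the mean-zero condition of \<open>S0_le1\<close> into a zero of the Mellin
  transform at 1, where dilations act by multiplication.\<close>

lemma mellin_1:
  assumes f: "f \<in> smooth01" shows "mellin f 1 = integral {0..1} f"
proof -
  have "integrable lborel (\<lambda>x. exp x *\<^sub>R f (exp x))"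
    using smooth01_mellin_integrable[OF f, of 1] by (simp add: scaleR_conv_of_real exp_of_real mult.commute)
  note e = exp_substitution[OF smooth01_D(5)[OF f] smooth01_D(3)[OF f] this]
  have "integral {0..1} f = integral {0<..<1} f" by (simp add: integral_open_interval_real)
  also have "\<dots> = integral\<^sup>L (lebesgue_on {0<..<1}) f" using lebesgue_integral_eq_integral[OF e(1)] by simp
  also have "\<dots> = (\<integral>x. exp x *\<^sub>R f (exp x) \<partial>lborel)" by (rule e(2))
  also have "\<dots> = mellin f 1" by (simp add: mellin_def scaleR_conv_of_real exp_of_real mult.commute)
  finally show ?thesis ..
qed

lemma mellin_indicator:
  assumes s: "Re s > 0"
  shows "mellin (\<lambda>u. indicator {0<..<1} u) s = 1 / s"
proof -
  have s0: "s \<noteq> 0" using s by auto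
  have "mellin (\<lambda>u. indicator {0<..<1} u) s = (\<integral>x. indicator {..<0} x *\<^sub>R exp (s * of_real x) \<partial>lborel)"
    unfolding mellin_def by (rule Bochner_Integration.integral_cong) (auto simp: indicator_def)
  also have "\<dots> = exp (s * of_real 0) / s - 0"
  proof (rule FTC_left_half_line)
    show "((\<lambda>x. exp (s * of_real x) / s) has_vector_derivative exp (s * of_real x)) (at x)" for x
    proof -
      have "((exp \<circ> (\<lambda>x. s * of_real x)) has_vector_derivative (s * 1) * exp (s * of_real x)) (at x)"
        by (rule field_vector_diff_chain_at) (auto intro!: derivative_eq_intros)
      from has_vector_derivative_mult_right[OF this, of "1 / s"]
      show ?thesis by (simp add: o_def s0)
    qed
    show "isCont (\<lambda>x. exp (s * of_real x)) x" for x by (intro continuous_intros)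
    show "integrable lborel (\<lambda>x. indicator {..<0} x *\<^sub>R exp (s * of_real x))"
    proof (rule Bochner_Integration.integrable_bound[OF exp_left_half_line(1)[OF s]])
      show "AE x in lborel. norm (indicator {..<0} x *\<^sub>R exp (s * of_real x)) \<le> norm (indicator {..<0} x * exp (Re s * x))"
        by (rule AE_I2) (simp add: abs_mult)
    qed measurable
    have "((\<lambda>x. exp (Re s * x)) \<longlongrightarrow> 0) at_bot"
      by (rule filterlim_compose[OF exp_at_bot])
         (rule filterlim_tendsto_pos_mult_at_bot[OF tendsto_const s filterlim_ident])
    then have "((\<lambda>x. exp (Re s * x) / norm s) \<longlongrightarrow> 0) at_bot" by (rule tendsto_divide_zero)
    then show "((\<lambda>x. exp (s * of_real x) / s) \<longlongrightarrow> 0) at_bot"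
      by (rule Lim_null_comparison[rotated]) (simp add: norm_divide)
    show "((\<lambda>x. exp (s * of_real x) / s) \<longlongrightarrow> exp (s * of_real 0) / s) (at_left 0)"
      by (intro tendsto_intros s0)
  qed
  finally show ?thesis by simp
qed

text \<open>The Jacobian exp x is the square of exp (x / 2); this is why L2 of (0,1) corresponds to
  the line Re s = 1/2.\<close>

lemma exp_substitution_norm_square:
  fixes d :: "real \<Rightarrow> complex"
  assumes d: "d \<in> borel_measurable borel" "\<And>u. u \<ge> 1 \<Longrightarrow> d u = 0" "\<And>u. norm (d u) \<le> B"
  shows "integrable lborel (\<lambda>x. exp x * (norm (d (exp x)))\<^sup>2)"
    and "integrable (lebesgue_on {0<..<1}) (\<lambda>u. (norm (d u))\<^sup>2)"
    and "(\<integral>u. (norm (d u))\<^sup>2 \<partial>lebesgue_on {0<..<1}) = (\<integral>x. exp x * (norm (d (exp x)))\<^sup>2 \<partial>lborel)"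
proof -
  note [measurable] = d(1)
  show int: "integrable lborel (\<lambda>x. exp x * (norm (d (exp x)))\<^sup>2)"
  proof (rule Bochner_Integration.integrable_bound)
    show "integrable lborel (\<lambda>x. B\<^sup>2 * (indicator {..<0} x * exp (1 * x)))"
      using exp_left_half_line(1)[of 1] by simp
    show "AE x in lborel. norm (exp x * (norm (d (exp x)))\<^sup>2) \<le> norm (B\<^sup>2 * (indicator {..<0} x * exp (1 * x)))"
    proof (rule AE_I2)
      fix x :: real
      have "(norm (d (exp x)))\<^sup>2 \<le> B\<^sup>2 * indicator {..<0} x"
      proof (cases "x < 0")
        case True
        then show ?thesis using power_mono[OF d(3)[of "exp x"] norm_ge_zero, of 2] by simp
      qed (use d(2) in simp)
      then have "exp x * (norm (d (exp x)))\<^sup>2 \<le> exp x * (B\<^sup>2 * indicator {..<0} x)"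
        by (rule mult_left_mono) simp
      also have "\<dots> = B\<^sup>2 * (indicator {..<0} x * exp (1 * x))" by simp
      finally have "exp x * (norm (d (exp x)))\<^sup>2 \<le> B\<^sup>2 * (indicator {..<0} x * exp (1 * x))" .
      moreover have "0 \<le> exp x * (norm (d (exp x)))\<^sup>2" by simp
      ultimately show "norm (exp x * (norm (d (exp x)))\<^sup>2) \<le> norm (B\<^sup>2 * (indicator {..<0} x * exp (1 * x)))"
        unfolding real_norm_def by linarith
    qed
  qed measurable
  have "(\<lambda>u. (norm (d u))\<^sup>2) \<in> borel_measurable borel" by measurable
  note e = exp_substitution[OF this]
  show "integrable (lebesgue_on {0<..<1}) (\<lambda>u. (norm (d u))\<^sup>2)"
    and "(\<integral>u. (norm (d u))\<^sup>2 \<partial>lebesgue_on {0<..<1}) = (\<integral>x. exp x * (norm (d (exp x)))\<^sup>2 \<partial>lborel)"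
    using e int d(2) by simp_all
qed

section \<open>A zero to the right of the critical line separates the constant from the
  closure\<close>

lemma closure_imp_riemann_hypothesis:
  assumes cl: "(\<lambda>u. 1) \<in> L2_closure (lebesgue_on {0<..<1}) (T_op ` S0_le1)"
  shows "riemann_hypothesis"
  unfolding riemann_hypothesis_def
proof (intro allI impI notI)
  fix \<rho> assume \<rho>: "Re \<rho> > 1/2 \<and> \<rho> \<noteq> 1" and z: "riemann_zeta \<rho> = 0"
  define \<sigma> where "\<sigma> = Re \<rho>"
  have \<sigma>: "\<sigma> > 1/2" using \<rho> by (simp add: \<sigma>_def)
  have \<rho>0: "norm \<rho> > 0" using \<rho> by auto
  \<comment> \<open>By Cauchy-Schwarz, 1 / norm \<rho> is at most the distance times the L2 norm 1 /
    sqrt (2 \<sigma> - 1) of \<open>u powr (\<rho> - 1)\<close>; \<epsilon> is half of the distance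
    this forces.\<close>
  define \<epsilon> where "\<epsilon> = sqrt ((2 * \<sigma> - 1) / (4 * (norm \<rho>)\<^sup>2))"
  have \<epsilon>: "\<epsilon> > 0" using \<sigma> \<rho>0 by (simp add: \<epsilon>_def)
  obtain f where f: "f \<in> S0_le1" and dist: "L2_dist (lebesgue_on {0<..<1}) (\<lambda>u. 1) (T_op f) < \<epsilon>"
    using cl \<epsilon> by (auto simp: L2_closure_def)
  have f01: "f \<in> smooth01" and f0: "integral {0..1} f = 0" using f by (auto simp: S0_le1_iff)
  obtain B where B: "B \<ge> 0" "\<And>u. norm (T_op f u) \<le> B" using T_op_bounded[OF f01 f0] by blast
  define d where "d u = indicator {0<..<1} u - T_op f u" for u
  have d: "d \<in> borel_measurable borel" "\<And>u. u \<ge> 1 \<Longrightarrow> d u = 0" "\<And>u. norm (d u) \<le> 1 + B"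
  proof -
    show "d \<in> borel_measurable borel" unfolding d_def using T_op_measurable[OF f01] by measurable
    show "d u = 0" if "u \<ge> 1" for u using that T_op_zero[OF f01, of u] by (simp add: d_def)
    show "norm (d u) \<le> 1 + B" for u
    proof -
      have "norm (indicator {0<..<1} u :: complex) \<le> 1" by (simp add: indicator_def)
      then show ?thesis unfolding d_def using B(2)[of u]
        by (intro order_trans[OF norm_triangle_ineq4] add_mono) auto
    qed
  qed
  note N = exp_substitution_norm_square[OF d]
  define N2 where "N2 = (\<integral>x. exp x * (norm (d (exp x)))\<^sup>2 \<partial>lborel)"
  have "(\<integral>u. (norm (1 - T_op f u))\<^sup>2 \<partial>lebesgue_on {0<..<1}) = (\<integral>u. (norm (d u))\<^sup>2 \<partial>lebesgue_on {0<..<1})"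
    by (rule Bochner_Integration.integral_cong) (auto simp: d_def)
  then have "sqrt N2 < \<epsilon>" using dist by (simp add: L2_dist_def N(3) N2_def)
  then have N2: "N2 < (2 * \<sigma> - 1) / (4 * (norm \<rho>)\<^sup>2)" unfolding \<epsilon>_def by simp
  \<comment> \<open>Weight in
    \<open>p * q \<le> l / 2 * p\<^sup>2 + 1 / (2 * l) * q\<^sup>2\<close>, which replaces
    Cauchy-Schwarz. The two integrated terms become less than 1/(8 norm \<rho>) and equal to 1/(2
    norm \<rho>), together less than 1 / norm \<rho>.\<close>
  define l where "l = norm \<rho> / (2 * \<sigma> - 1)"
  have l: "l > 0" using \<sigma> \<rho>0 by (simp add: l_def)
  have mT: "mellin (T_op f) \<rho> = 0" using mellin_T_op[OF f01 f0, of \<rho>] \<rho> z by simp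
  have "mellin d \<rho> = mellin (\<lambda>u. indicator {0<..<1} u) \<rho> - mellin (T_op f) \<rho>"
  proof -
    have 1: "integrable lborel (\<lambda>x. indicator {0<..<1} (exp x) * exp (\<rho> * of_real x))"
      by (rule mellin_integrable[of "\<lambda>u. indicator {0<..<1} u" 1]) (use \<rho> in \<open>auto simp: indicator_def\<close>)
    have 2: "integrable lborel (\<lambda>x. T_op f (exp x) * exp (\<rho> * of_real x))"
      by (rule mellin_integrable[OF T_op_measurable[OF f01] B(2) T_op_zero[OF f01]]) (use \<rho> in auto)
    show ?thesis unfolding mellin_def d_def left_diff_distrib by (rule Bochner_Integration.integral_diff[OF 1 2])
  qed
  then have md: "mellin d \<rho> = 1 / \<rho>" using mellin_indicator[of \<rho>] \<rho> mT by simp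
  have "norm (mellin d \<rho>) \<le> (\<integral>x. l / 2 * (exp x * (norm (d (exp x)))\<^sup>2) + 1 / (2 * l) * (indicator {..<0} x * exp ((2 * \<sigma> - 1) * x)) \<partial>lborel)"
    unfolding mellin_def
  proof (rule Bochner_Integration.integral_norm_bound_integral)
    show "integrable lborel (\<lambda>x. d (exp x) * exp (\<rho> * of_real x))"
      by (rule mellin_integrable[OF d(1,3,2)]) (use \<rho> in auto)
    show "integrable lborel (\<lambda>x. l / 2 * (exp x * (norm (d (exp x)))\<^sup>2) + 1 / (2 * l) * (indicator {..<0} x * exp ((2 * \<sigma> - 1) * x)))"
      using exp_left_half_line(1)[of "2 * \<sigma> - 1"] N(1) \<sigma> by simp
    fix x :: real
    show "norm (d (exp x) * exp (\<rho> * of_real x)) \<le> l / 2 * (exp x * (norm (d (exp x)))\<^sup>2) + 1 / (2 * l) * (indicator {..<0} x * exp ((2 * \<sigma> - 1) * x))"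
    proof (cases "x < 0")
      case True
      define p where "p = exp (x / 2) * norm (d (exp x))"
      define q where "q = exp ((\<sigma> - 1/2) * x)"
      have "0 \<le> (l * p - q)\<^sup>2 / (2 * l)" using l by simp
      also have "\<dots> = l / 2 * p\<^sup>2 + 1 / (2 * l) * q\<^sup>2 - p * q"
        using l by (simp add: power2_eq_square field_simps)
      finally have "p * q \<le> l / 2 * p\<^sup>2 + 1 / (2 * l) * q\<^sup>2" by simp
      moreover have "p * q = norm (d (exp x) * exp (\<rho> * of_real x))"
      proof -
        have "exp (x / 2) * exp ((\<sigma> - 1/2) * x) = exp (\<sigma> * x)"
          unfolding exp_add[symmetric] by (simp add: left_diff_distrib)
        then show ?thesis by (simp add: p_def q_def norm_mult \<sigma>_def mult_ac)
      qed
      moreover have "p\<^sup>2 = exp x * (norm (d (exp x)))\<^sup>2"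
      proof -
        have "(exp (x / 2))\<^sup>2 = exp x" unfolding power2_eq_square exp_add[symmetric] by simp
        then show ?thesis by (simp add: p_def power_mult_distrib)
      qed
      moreover have "q\<^sup>2 = exp ((2 * \<sigma> - 1) * x)"
        unfolding q_def power2_eq_square exp_add[symmetric] by (simp add: left_diff_distrib)
      ultimately show ?thesis using True by simp
    qed (use d(2) in simp)
  qed
  also have "\<dots> = l / 2 * N2 + 1 / (2 * l) * (1 / (2 * \<sigma> - 1))"
    using exp_left_half_line[of "2 * \<sigma> - 1"] N(1) \<sigma> by (simp add: N2_def)
  also have "1 / (2 * l) * (1 / (2 * \<sigma> - 1)) = 1 / (2 * norm \<rho>)"
    using \<sigma> \<rho>0 by (simp add: l_def)
  also have "l / 2 * N2 < l / 2 * ((2 * \<sigma> - 1) / (4 * (norm \<rho>)\<^sup>2))"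
    using N2 l by (intro mult_strict_left_mono) auto
  also have "l / 2 * ((2 * \<sigma> - 1) / (4 * (norm \<rho>)\<^sup>2)) = 1 / (8 * norm \<rho>)"
    using \<sigma> \<rho>0 by (simp add: l_def power2_eq_square field_simps)
  finally have "1 / norm \<rho> < 1 / (8 * norm \<rho>) + 1 / (2 * norm \<rho>)" by (simp add: md norm_divide)
  then show False using \<rho>0 by (simp add: field_simps)
qed

subsection \<open>Approximation by Dirichlet polynomials on the critical line\<close>

definition crit :: "real \<Rightarrow> complex" where "crit t = Complex (1/2) t"

lemma crit_simps [simp]: "Re (crit t) = 1/2" "Im (crit t) = t"
  by (simp_all add: crit_def)

lemma continuous_crit [continuous_intros]: "continuous_on A crit"
  unfolding crit_def Complex_eq by (intro continuous_intros)

lemma crit_measurable [measurable]: "crit \<in> borel_measurable borel"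
  by (intro borel_measurable_continuous_onI continuous_intros)

lemma pw_measurable [measurable]: "(\<lambda>s. pw s b) \<in> borel_measurable borel"
  unfolding pw_def by (intro borel_measurable_continuous_onI continuous_intros)

lemma norm_pw_le_half:
  assumes "Re s \<ge> 1/2"
  shows "norm (pw s (real (Suc n))) \<le> (real n + 1) powr (- (1/2))"
  using assms by (subst norm_pw) (auto simp: add.commute intro!: powr_mono)

definition dirichlet_poly :: "(nat \<Rightarrow> complex) \<Rightarrow> nat \<Rightarrow> complex \<Rightarrow> complex" where
  "dirichlet_poly c N s = (\<Sum>n<N. c n * pw s (real (Suc n)))"

lemma dirichlet_poly_measurable [measurable]: "dirichlet_poly c N \<in> borel_measurable borel"
  unfolding dirichlet_poly_def by measurable

definition rapidly_decreasing :: "(real \<Rightarrow> complex) \<Rightarrow> bool" where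
  "rapidly_decreasing w \<longleftrightarrow> w \<in> borel_measurable borel \<and> (\<forall>k. \<exists>C\<ge>0. \<forall>t. norm (w t) * (1 + \<bar>t\<bar>) ^ k \<le> C)"

text \<open>One power of 1 + |t| beyond A leaves a multiple of
  \<open>inverse (1 + t\<^sup>2)\<close>. The majorant is chosen before z, so that it can serve for
  a whole sequence in dominated convergence.\<close>

lemma weighted_square_bound:
  assumes "rapidly_decreasing w" "D \<ge> 0"
  shows "\<exists>g. integrable lborel g \<and> (\<forall>z t. norm z \<le> D * (1 + \<bar>t\<bar>) ^ A \<longrightarrow> (norm (w t * z))\<^sup>2 \<le> g t)"
proof -
  obtain C where C: "C \<ge> 0" "\<And>t. norm (w t) * (1 + \<bar>t\<bar>) ^ Suc A \<le> C"
    using assms(1) unfolding rapidly_decreasing_def by blast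
  have "integrable lborel (\<lambda>t::real. inverse (1 + t\<^sup>2))"
    using integrable_inverse_1_plus_square by (simp add: set_integrable_def)
  then have "integrable lborel (\<lambda>t::real. (C * D)\<^sup>2 * inverse (1 + t\<^sup>2))" by simp
  moreover have "(norm (w t * z))\<^sup>2 \<le> (C * D)\<^sup>2 * inverse (1 + t\<^sup>2)" if z: "norm z \<le> D * (1 + \<bar>t\<bar>) ^ A" for z t
  proof -
    have "norm (w t * z) * (1 + \<bar>t\<bar>) \<le> norm (w t) * (D * (1 + \<bar>t\<bar>) ^ A) * (1 + \<bar>t\<bar>)"
      unfolding norm_mult using z by (intro mult_right_mono mult_left_mono) auto
    also have "\<dots> = norm (w t) * (1 + \<bar>t\<bar>) ^ Suc A * D" by simp
    also have "\<dots> \<le> C * D" using C assms(2) by (intro mult_right_mono) auto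
    finally have "(norm (w t * z) * (1 + \<bar>t\<bar>))\<^sup>2 \<le> (C * D)\<^sup>2" by (rule power_mono) simp
    then have 1: "(norm (w t * z))\<^sup>2 * (1 + \<bar>t\<bar>)\<^sup>2 \<le> (C * D)\<^sup>2" by (simp add: power_mult_distrib)
    have "1 + t\<^sup>2 \<le> (1 + \<bar>t\<bar>)\<^sup>2" by (simp add: power2_eq_square algebra_simps)
    then have "(norm (w t * z))\<^sup>2 * (1 + t\<^sup>2) \<le> (norm (w t * z))\<^sup>2 * (1 + \<bar>t\<bar>)\<^sup>2"
      by (rule mult_left_mono) simp
    with 1 have "(norm (w t * z))\<^sup>2 * (1 + t\<^sup>2) \<le> (C * D)\<^sup>2" by linarith
    moreover have "1 + t\<^sup>2 > 0" using zero_le_power2[of t] by linarith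
    ultimately have "(norm (w t * z))\<^sup>2 \<le> (C * D)\<^sup>2 / (1 + t\<^sup>2)" by (simp only: pos_le_divide_eq)
    then show ?thesis by (simp only: divide_inverse)
  qed
  ultimately show ?thesis by blast
qed

lemma weighted_square_integrable:
  assumes w: "rapidly_decreasing w" and E: "E \<in> borel_measurable borel"
    and bd: "\<And>t. norm (E t) \<le> D * (1 + \<bar>t\<bar>) ^ A" and D: "D \<ge> 0"
  shows "integrable lborel (\<lambda>t. (norm (w t * E t))\<^sup>2)"
proof -
  have [measurable]: "w \<in> borel_measurable borel" using w by (simp add: rapidly_decreasing_def)
  note [measurable] = E
  obtain g where g1: "integrable lborel g" and g2: "\<forall>z t. norm z \<le> D * (1 + \<bar>t\<bar>) ^ A \<longrightarrow> (norm (w t * z))\<^sup>2 \<le> g t"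
    using weighted_square_bound[OF w D, of A] by (elim exE conjE)
  have g: "integrable lborel g" "(norm (w t * E t))\<^sup>2 \<le> g t" for t
    using g1 g2 bd[of t] by simp_all
  show ?thesis
  proof (rule Bochner_Integration.integrable_bound[OF g(1)])
    show "AE t in lborel. norm ((norm (w t * E t))\<^sup>2) \<le> norm (g t)"
    proof (rule AE_I2)
      show "norm ((norm (w t * E t))\<^sup>2) \<le> norm (g t)" for t
        using g(2)[of t] abs_ge_self[of "g t"] by simp
    qed
  qed measurable
qed

text \<open>The point \<open>1\<close> is included because the value there controls the mean of the test function.\<close>

definition approximable :: "(real \<Rightarrow> complex) \<Rightarrow> (complex \<Rightarrow> complex) \<Rightarrow> bool" where
  "approximable w E \<longleftrightarrow> (\<forall>\<epsilon>>0. \<exists>c N.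
     integrable lborel (\<lambda>t. (norm (w t * (dirichlet_poly c N (crit t) - E (crit t))))\<^sup>2) \<and>
     (\<integral>t. (norm (w t * (dirichlet_poly c N (crit t) - E (crit t))))\<^sup>2 \<partial>lborel) < \<epsilon> \<and>
     norm (dirichlet_poly c N 1 - E 1) < \<epsilon>)"

lemma approximable_dirichlet_poly: "approximable w (dirichlet_poly c N)"
  unfolding approximable_def by (intro allI impI exI[of _ c] exI[of _ N]) auto

lemma norm_add_square_le: "(norm (a + b))\<^sup>2 \<le> 2 * (norm a)\<^sup>2 + 2 * (norm (b :: complex))\<^sup>2"
proof -
  have "(norm (a + b))\<^sup>2 \<le> (norm a + norm b)\<^sup>2" by (intro power_mono norm_triangle_ineq) auto
  also have "\<dots> \<le> 2 * (norm a)\<^sup>2 + 2 * (norm b)\<^sup>2"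
    using sum_squares_bound[of "norm a" "norm b"] by (simp add: power2_sum)
  finally show ?thesis .
qed

text \<open>The bound uniform in k permits dominated convergence of the weighted errors; one late
  \<open>E k\<close> is then replaced by a Dirichlet polynomial.\<close>

lemma approximable_limit:
  assumes w: "rapidly_decreasing w" and ap: "\<And>k. approximable w (E k)"
    and lim: "\<And>t. (\<lambda>k. E k (crit t)) \<longlonglongrightarrow> F (crit t)" and lim1: "(\<lambda>k. E k 1) \<longlonglongrightarrow> F 1"
    and bd: "\<And>k t. norm (E k (crit t)) \<le> D * (1 + \<bar>t\<bar>) ^ A" and D: "D \<ge> 0"
    and meas: "\<And>k. (\<lambda>t. E k (crit t)) \<in> borel_measurable borel"
  shows "approximable w F"
  unfolding approximable_def
proof (intro allI impI)
  fix \<epsilon> :: real assume \<epsilon>: "\<epsilon> > 0"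
  let ?err = "\<lambda>G H t. (norm (w t * (G (crit t) - H (crit t))))\<^sup>2"
  have [measurable]: "w \<in> borel_measurable borel" using w by (simp add: rapidly_decreasing_def)
  note [measurable] = meas
  have Fm [measurable]: "(\<lambda>t. F (crit t)) \<in> borel_measurable borel"
    by (rule borel_measurable_LIMSEQ_metric[OF meas lim])
  have Fb: "norm (F (crit t)) \<le> D * (1 + \<bar>t\<bar>) ^ A" for t
    by (rule LIMSEQ_le_const2[OF tendsto_norm[OF lim]]) (use bd in auto)
  have D2: "2 * D \<ge> 0" using D by simp
  have b2: "norm (E k (crit t) - F (crit t)) \<le> 2 * D * (1 + \<bar>t\<bar>) ^ A" for k t
    using norm_triangle_ineq4[of "E k (crit t)" "F (crit t)"] bd[of k t] Fb[of t] by simp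
  obtain g where g1: "integrable lborel g" and g2: "\<forall>z t. norm z \<le> 2 * D * (1 + \<bar>t\<bar>) ^ A \<longrightarrow> (norm (w t * z))\<^sup>2 \<le> g t"
    using weighted_square_bound[OF w D2, of A] by (elim exE conjE)
  have g: "integrable lborel g" "?err (E k) F t \<le> g t" for k t
    using g1 g2 b2[of k t] by simp_all
  have "(\<lambda>k. \<integral>t. ?err (E k) F t \<partial>lborel) \<longlonglongrightarrow> (\<integral>t. 0 \<partial>(lborel :: real measure))"
  proof (rule integral_dominated_convergence[where w = g])
    show "AE t in lborel. (\<lambda>k. ?err (E k) F t) \<longlonglongrightarrow> 0"
    proof (rule AE_I2)
      fix t
      have "(\<lambda>k. ?err (E k) F t) \<longlonglongrightarrow> (norm (w t * (F (crit t) - F (crit t))))\<^sup>2"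
        by (intro tendsto_intros lim)
      then show "(\<lambda>k. ?err (E k) F t) \<longlonglongrightarrow> 0" by simp
    qed
    show "AE t in lborel. norm (?err (E k) F t) \<le> g t" for k
      using g(2) by (intro AE_I2) simp
  qed (use g in auto)
  \<comment> \<open>A quarter, because \<open>norm_add_square_le\<close> doubles each of the two
    squared errors.\<close>
  then have "eventually (\<lambda>k. (\<integral>t. ?err (E k) F t \<partial>lborel) < \<epsilon> / 4) sequentially"
    using \<epsilon> by (intro order_tendstoD(2)) auto
  moreover have "eventually (\<lambda>k. norm (E k 1 - F 1) < \<epsilon> / 2) sequentially"
    using tendstoD[OF lim1, of "\<epsilon> / 2"] \<epsilon> by (simp add: dist_norm)
  ultimately have "eventually (\<lambda>k. (\<integral>t. ?err (E k) F t \<partial>lborel) < \<epsilon> / 4 \<and> norm (E k 1 - F 1) < \<epsilon> / 2) sequentially"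
    by (rule eventually_conj)
  then obtain k where k: "(\<integral>t. ?err (E k) F t \<partial>lborel) < \<epsilon> / 4" "norm (E k 1 - F 1) < \<epsilon> / 2"
    by (auto simp: eventually_sequentially)
  have ki: "integrable lborel (\<lambda>t. ?err (E k) F t)"
    by (rule weighted_square_integrable[OF w _ b2 D2]) measurable
  have "\<epsilon> / 4 > 0" using \<epsilon> by simp
  then obtain c N where cN: "integrable lborel (\<lambda>t. ?err (dirichlet_poly c N) (E k) t)"
     "(\<integral>t. ?err (dirichlet_poly c N) (E k) t \<partial>lborel) < \<epsilon> / 4"
     "norm (dirichlet_poly c N 1 - E k 1) < \<epsilon> / 4"
    using ap[of k] unfolding approximable_def by blast
  let ?S = "\<lambda>t. 2 * ?err (dirichlet_poly c N) (E k) t + 2 * ?err (E k) F t"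
  have S: "integrable lborel ?S" using ki cN(1) by simp
  have le: "?err (dirichlet_poly c N) F t \<le> ?S t" for t
    using norm_add_square_le[of "w t * (dirichlet_poly c N (crit t) - E k (crit t))" "w t * (E k (crit t) - F (crit t))"]
    by (simp add: algebra_simps)
  have int: "integrable lborel (\<lambda>t. ?err (dirichlet_poly c N) F t)"
  proof (rule Bochner_Integration.integrable_bound[OF S])
    show "AE t in lborel. norm (?err (dirichlet_poly c N) F t) \<le> norm (?S t)"
      by (rule AE_I2) (use le in simp)
  qed measurable
  have "(\<integral>t. ?err (dirichlet_poly c N) F t \<partial>lborel) \<le> integral\<^sup>L lborel ?S"
    by (rule integral_mono[OF int S le])
  also have "\<dots> < \<epsilon>" using ki cN k(1) by simp
  finally have "(\<integral>t. ?err (dirichlet_poly c N) F t \<partial>lborel) < \<epsilon>" .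
  moreover have "norm (dirichlet_poly c N 1 - F 1) < \<epsilon>"
    using norm_triangle_ineq[of "dirichlet_poly c N 1 - E k 1" "E k 1 - F 1"] cN(3) k(2) \<epsilon> by simp
  ultimately show "\<exists>c N. integrable lborel (\<lambda>t. ?err (dirichlet_poly c N) F t) \<and>
     (\<integral>t. ?err (dirichlet_poly c N) F t \<partial>lborel) < \<epsilon> \<and>
     norm (dirichlet_poly c N 1 - F 1) < \<epsilon>" using int by blast
qed

text \<open>Absolute convergence at 1/2 bounds all partial sums on Re s \<ge> 1/2 by one constant,
  so the limit lemma applies with exponent 0.\<close>

lemma approximable_dirichlet_series:
  assumes w: "rapidly_decreasing w"
    and c: "summable (\<lambda>n. norm (c n) * (real n + 1) powr (- (1/2)))"
  shows "approximable w (\<lambda>s. \<Sum>n. c n * pw s (real (Suc n)))"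
proof -
  have le: "norm (c n * pw s (real (Suc n))) \<le> norm (c n) * (real n + 1) powr (- (1/2))" if "Re s \<ge> 1/2" for s n
    unfolding norm_mult using norm_pw_le_half[OF that] by (rule mult_left_mono) simp
  have sm: "summable (\<lambda>n. c n * pw s (real (Suc n)))" if "Re s \<ge> 1/2" for s
    by (rule summable_comparison_test'[OF c le[OF that]])
  have lim: "(\<lambda>N. dirichlet_poly c N s) \<longlonglongrightarrow> (\<Sum>n. c n * pw s (real (Suc n)))" if "Re s \<ge> 1/2" for s
    unfolding dirichlet_poly_def by (rule summable_LIMSEQ[OF sm[OF that]])
  let ?D = "\<Sum>n. norm (c n) * (real n + 1) powr (- (1/2))"
  show ?thesis
  proof (rule approximable_limit[where E = "dirichlet_poly c", OF w approximable_dirichlet_poly, where D = ?D and A = 0])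
    show "norm (dirichlet_poly c k (crit t)) \<le> ?D * (1 + \<bar>t\<bar>) ^ 0" for k t
    proof -
      have "norm (dirichlet_poly c k (crit t)) \<le> (\<Sum>n<k. norm (c n) * (real n + 1) powr (- (1/2)))"
        unfolding dirichlet_poly_def by (rule sum_norm_le) (use le in simp)
      also have "\<dots> \<le> ?D" by (rule sum_le_suminf[OF c]) auto
      finally show ?thesis by simp
    qed
    show "?D \<ge> 0" by (rule suminf_nonneg[OF c]) simp
  qed (use lim in auto)
qed

section \<open>Taylor coefficients of the reciprocal of zeta as Dirichlet series\<close>

lemma higher_deriv_dirichlet_poly:
  "(deriv ^^ j) (dirichlet_poly c N) = dirichlet_poly (\<lambda>n. c n * (- of_real (ln (real (Suc n)))) ^ j) N"
proof (induction j)
  case (Suc j)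
  have "((\<lambda>s. d * pw s (real (Suc n))) has_field_derivative d * (- of_real (ln (real (Suc n)))) * pw s (real (Suc n))) (at s)" for d n s
    unfolding pw_def by (auto intro!: derivative_eq_intros simp del: of_nat_Suc)
  then have "(dirichlet_poly d N has_field_derivative dirichlet_poly (\<lambda>n. d n * (- of_real (ln (real (Suc n))))) N s) (at s)" for d s
    unfolding dirichlet_poly_def by (intro DERIV_sum)
  then have "deriv (dirichlet_poly d N) = dirichlet_poly (\<lambda>n. d n * (- of_real (ln (real (Suc n))))) N" for d
    by (intro ext DERIV_imp_deriv)
  then show ?case using Suc by (simp add: mult_ac del: of_nat_Suc)
qed simp

lemma approximable_cong:
  assumes "approximable w E" "\<And>t. E (crit t) = F (crit t)" "E 1 = F 1"
  shows "approximable w F"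
  using assms unfolding approximable_def by simp

lemma inverse_zeta_holomorphic:
  assumes "riemann_hypothesis"
  shows "(\<lambda>z. 1 / riemann_zeta z) holomorphic_on {z. Re z > 1/2}"
proof -
  have "zreg holomorphic_on {z. Re z > 1/2}"
    using zreg_holomorphic by (rule holomorphic_on_subset) auto
  then have "(\<lambda>z. (z - 1) / zreg z) holomorphic_on {z. Re z > 1/2}"
    by (intro holomorphic_intros) (use zreg_nonzero[OF assms] in auto)
  then show ?thesis by (simp add: inverse_zeta_eq)
qed

lemma ln_power_le_powr:
  fixes x :: real assumes x: "x \<ge> 1"
  shows "ln x ^ j \<le> (4 * (real j + 1)) ^ j * x powr (1/4)"
proof -
  define a where "a = 1 / (4 * (real j + 1))"
  have a: "a > 0" by (simp add: a_def)
  have "ln x \<le> x powr a / a" by (rule ln_powr_bound[OF x a])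
  then have "ln x ^ j \<le> (x powr a / a) ^ j" using x by (intro power_mono) auto
  also have "\<dots> = (1 / a) ^ j * x powr (a * real j)"
    using x by (simp add: power_divide powr_powr[symmetric] powr_realpow)
  also have "\<dots> \<le> (1 / a) ^ j * x powr (1/4)"
  proof (intro mult_left_mono powr_mono x)
    show "a * real j \<le> 1/4" by (simp add: a_def field_simps)
  qed (use a in simp)
  finally show ?thesis by (simp add: a_def)
qed

text \<open>Count of exponents: 2 from \<open>zinv\<close>, 1/4 from the logarithms, -3 from the
  shifted centre and -1/2 from the critical line make -5/4, which is below -1.\<close>

lemma summable_zinv_ln:
  "summable (\<lambda>n. norm (of_real (zinv (Suc n)) * (- of_real (ln (real (Suc n)))) ^ j * pw 3 (real (Suc n))) * (real n + 1) powr (- (1/2)))"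
proof (rule summable_comparison_test')
  show "summable (\<lambda>n. (4 * (real j + 1)) ^ j * (real n + 1) powr (- (5/4)))"
    by (intro summable_mult summable_pw_bound) simp
  fix n :: nat
  let ?x = "real n + 1"
  have "norm (of_real (zinv (Suc n)) * (- of_real (ln (real (Suc n)))) ^ j * pw 3 (real (Suc n))) * ?x powr (- (1/2))
    = \<bar>zinv (Suc n)\<bar> * ln ?x ^ j * ?x powr (- 3) * ?x powr (- (1/2))"
    by (simp add: norm_mult norm_power norm_pw add.commute)
  also have "\<dots> \<le> ?x\<^sup>2 * ((4 * (real j + 1)) ^ j * ?x powr (1/4)) * ?x powr (- 3) * ?x powr (- (1/2))"
    using abs_zinv_le[of "Suc n"] ln_power_le_powr[of ?x j]
    by (intro mult_right_mono mult_mono) (auto simp: add.commute)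
  also have "\<dots> = (4 * (real j + 1)) ^ j * (?x powr 2 * ?x powr (1/4) * ?x powr (- 3) * ?x powr (- (1/2)))"
    by (simp add: powr_realpow)
  also have "?x powr 2 * ?x powr (1/4) * ?x powr (- 3) * ?x powr (- (1/2)) = ?x powr (- (5/4))"
    unfolding powr_add[symmetric] by simp
  finally show "norm (norm (of_real (zinv (Suc n)) * (- of_real (ln (real (Suc n)))) ^ j * pw 3 (real (Suc n))) * ?x powr (- (1/2)))
     \<le> (4 * (real j + 1)) ^ j * ?x powr (- (5/4))" by simp
qed

lemma higher_deriv_inverse_zeta_sums:
  assumes s: "Re s \<ge> 1/2"
  shows "(\<lambda>n. of_real (zinv (Suc n)) * (- of_real (ln (real (Suc n)))) ^ j * pw 3 (real (Suc n)) * pw s (real (Suc n)))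
    sums (deriv ^^ j) (\<lambda>z. 1 / riemann_zeta z) (s + 3)"
proof -
  \<comment> \<open>The bound lies strictly between 3, the edge of absolute convergence given by
    \<open>norm_zinv_pw_le\<close>, and 7/2, the least real part of s + 3.\<close>
  let ?A = "{z. Re z > 13/4}"
  have "((\<lambda>N. (deriv ^^ j) (dirichlet_poly (\<lambda>n. of_real (zinv (Suc n))) N) (s + 3)) \<longlongrightarrow> (deriv ^^ j) (\<lambda>z. 1 / riemann_zeta z) (s + 3)) sequentially"
  proof (rule higher_deriv_complex_uniform_limit)
    have "uniform_limit ?A (\<lambda>N z. \<Sum>n<N. of_real (zinv (Suc n)) * pw z (real (Suc n)))
       (\<lambda>z. \<Sum>n. of_real (zinv (Suc n)) * pw z (real (Suc n))) sequentially"
    proof (rule Weierstrass_m_test)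
      show "summable (\<lambda>n. (real n + 1) powr (- (5/4)))" by (rule summable_pw_bound) simp
      fix n z assume "z \<in> ?A"
      then have "(real n + 1) powr (- (Re z - 2)) \<le> (real n + 1) powr (- (5/4))" by (intro powr_mono) auto
      then show "norm (of_real (zinv (Suc n)) * pw z (real (Suc n))) \<le> (real n + 1) powr (- (5/4))"
        using norm_zinv_pw_le[of n z] by linarith
    qed
    then show "uniform_limit ?A (dirichlet_poly (\<lambda>n. of_real (zinv (Suc n)))) (\<lambda>z. 1 / riemann_zeta z) sequentially"
      by (rule uniform_limit_cong'[THEN iffD1, rotated 2]) (auto simp: dirichlet_poly_def sums_unique[OF zinv_sums(1), symmetric] simp del: of_nat_Suc)
    show "eventually (\<lambda>N. dirichlet_poly (\<lambda>n. of_real (zinv (Suc n))) N holomorphic_on ?A) sequentially"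
      unfolding dirichlet_poly_def by (intro always_eventually allI holomorphic_intros)
    show "open ?A" by (rule open_halfspace_Re_gt)
  qed (use s in auto)
  moreover have "pw (s + 3) b = pw 3 b * pw s b" for b
    unfolding pw_def exp_add[symmetric] by (simp add: algebra_simps)
  ultimately show ?thesis
    unfolding higher_deriv_dirichlet_poly by (simp add: dirichlet_poly_def sums_def mult.assoc del: of_nat_Suc)
qed

text \<open>Since \<open>pw (s + 3) b = pw 3 b * pw s b\<close>, the shift goes into the
  coefficients, and the finite sum over j merges into a single absolutely convergent Dirichlet
  series in s.\<close>

lemma approximable_taylor_sum:
  assumes w: "rapidly_decreasing w"
  shows "approximable w (\<lambda>s. \<Sum>j<J. (deriv ^^ j) (\<lambda>z. 1 / riemann_zeta z) (s + 3) / fact j * h ^ j)"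
proof -
  define b where "b j n = of_real (zinv (Suc n)) * (- of_real (ln (real (Suc n)))) ^ j * pw 3 (real (Suc n))" for j n
  define c where "c n = (\<Sum>j<J. (h ^ j / fact j) * b j n)" for n
  have "summable (\<lambda>n. norm (c n) * (real n + 1) powr (- (1/2)))"
  proof (rule summable_comparison_test')
    show "summable (\<lambda>n. \<Sum>j<J. norm (h ^ j / fact j) * (norm (b j n) * (real n + 1) powr (- (1/2))))"
      unfolding b_def by (intro summable_sum summable_mult summable_zinv_ln)
    fix n
    have "norm (c n) \<le> (\<Sum>j<J. norm (h ^ j / fact j) * norm (b j n))"
      unfolding c_def by (rule sum_norm_le) (simp only: norm_mult order_refl)
    then have "norm (c n) * (real n + 1) powr (- (1/2)) \<le> (\<Sum>j<J. norm (h ^ j / fact j) * norm (b j n)) * (real n + 1) powr (- (1/2))"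
      by (rule mult_right_mono) simp
    then show "norm (norm (c n) * (real n + 1) powr (- (1/2))) \<le> (\<Sum>j<J. norm (h ^ j / fact j) * (norm (b j n) * (real n + 1) powr (- (1/2))))"
      by (simp add: sum_distrib_right mult.assoc)
  qed
  then have ap: "approximable w (\<lambda>s. \<Sum>n. c n * pw s (real (Suc n)))"
    by (rule approximable_dirichlet_series[OF w])
  have eq: "(\<Sum>n. c n * pw s (real (Suc n))) = (\<Sum>j<J. (deriv ^^ j) (\<lambda>z. 1 / riemann_zeta z) (s + 3) / fact j * h ^ j)" if "Re s \<ge> 1/2" for s
  proof (rule sums_unique[symmetric])
    have "(\<lambda>n. \<Sum>j<J. (h ^ j / fact j) * (b j n * pw s (real (Suc n)))) sums (\<Sum>j<J. (h ^ j / fact j) * (deriv ^^ j) (\<lambda>z. 1 / riemann_zeta z) (s + 3))"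
      unfolding b_def by (intro sums_sum sums_mult higher_deriv_inverse_zeta_sums that)
    moreover have "c n * pw s (real (Suc n)) = (\<Sum>j<J. (h ^ j / fact j) * (b j n * pw s (real (Suc n))))" for n
      by (simp only: c_def sum_distrib_right mult.assoc)
    ultimately show "(\<lambda>n. c n * pw s (real (Suc n))) sums (\<Sum>j<J. (deriv ^^ j) (\<lambda>z. 1 / riemann_zeta z) (s + 3) / fact j * h ^ j)"
      by (simp only:) (simp add: mult.commute)
  qed
  show ?thesis by (rule approximable_cong[OF ap]) (use eq in auto)
qed

text \<open>The approximants are the Taylor polynomials of \<open>1 / riemann_zeta\<close> around \<open>s + 3\<close>, whose
  coefficients are Dirichlet series; the disc of radius \<open>3\<close> lies in the half-plane \<open>Re z > 1/2\<close>.\<close>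

lemma approximable_inverse_zeta:
  assumes RH: "riemann_hypothesis" and w: "rapidly_decreasing w" and \<delta>: "0 < \<delta>" "\<delta> < 3"
  shows "approximable w (\<lambda>s. 1 / riemann_zeta (s + of_real \<delta>))"
proof -
  let ?F = "\<lambda>z. 1 / riemann_zeta z"
  note hol = inverse_zeta_holomorphic[OF RH]
  obtain C A where C: "C \<ge> 0" "\<And>z. 1/2 + \<delta>/2 \<le> Re z \<Longrightarrow> Re z \<le> 15/2 - \<delta>/2 \<Longrightarrow> norm (?F z) \<le> C * (1 + \<bar>Im z\<bar>) ^ A"
    using inverse_zeta_growth[OF RH, of "\<delta> / 2"] \<delta> by auto
  \<comment> \<open>Midway between \<open>norm h = 3 - \<delta>\<close> and 3: Cauchy's estimate on
    this circle stays where the growth bound with \<eta> = \<delta>/2 holds, and the ratio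
    \<open>q\<close> is below 1, so a geometric series bounds all Taylor sums at once.\<close>
  define r where "r = 3 - \<delta> / 2"
  define h :: complex where "h = of_real (\<delta> - 3)"
  have r: "r > 0" using \<delta> by (simp add: r_def)
  have nh: "norm h = 3 - \<delta>" using \<delta> by (simp add: h_def del: of_real_diff)
  define q where "q = norm h / r"
  have q: "0 \<le> q" "q < 1" using \<delta> by (auto simp: q_def nh r_def)
  define D where "D = C * 4 ^ A / (1 - q)"
  define E where "E J s = (\<Sum>j<J. (deriv ^^ j) ?F (s + 3) / fact j * h ^ j)" for J s
  have ball: "z \<in> {z. Re z > 1/2}" if "z \<in> ball (s + 3) 3" "Re s \<ge> 1/2" for s z
    using that abs_Re_le_cmod[of "s + 3 - z"] by (simp add: dist_norm)
  have lim: "(\<lambda>J. E J s) \<longlonglongrightarrow> ?F (s + of_real \<delta>)" if "Re s \<ge> 1/2" for s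
  proof -
    have "?F holomorphic_on ball (s + 3) 3" using hol by (rule holomorphic_on_subset) (use ball that in blast)
    moreover have "s + of_real \<delta> \<in> ball (s + 3) 3"
    proof -
      have "s + 3 - (s + of_real \<delta>) = - h" by (simp add: h_def)
      then show ?thesis using nh \<delta> by (simp add: dist_norm)
    qed
    ultimately have "(\<lambda>j. (deriv ^^ j) ?F (s + 3) / fact j * (s + of_real \<delta> - (s + 3)) ^ j) sums ?F (s + of_real \<delta>)"
      by (rule holomorphic_power_series)
    moreover have "s + of_real \<delta> - (s + 3) = h" by (simp add: h_def)
    ultimately show ?thesis by (simp add: E_def sums_def)
  qed
  have bd: "norm (E J (crit t)) \<le> D * (1 + \<bar>t\<bar>) ^ A" for J t
  proof -
    define B where "B = C * 4 ^ A * (1 + \<bar>t\<bar>) ^ A"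
    have B: "B \<ge> 0" using C by (simp add: B_def)
    have c: "cball (crit t + 3) r \<subseteq> {z. Re z > 1/2}"
    proof
      fix z assume "z \<in> cball (crit t + 3) r"
      then have "z \<in> ball (crit t + 3) 3" using \<delta> by (auto simp: r_def)
      then show "z \<in> {z. Re z > 1/2}" by (rule ball) simp
    qed
    have coeff: "norm ((deriv ^^ j) ?F (crit t + 3)) \<le> fact j * B / r ^ j" for j
    proof (rule Cauchy_inequality[OF _ _ r])
      show "?F holomorphic_on ball (crit t + 3) r"
        using hol by (rule holomorphic_on_subset) (use c ball_subset_cball in blast)
      show "continuous_on (cball (crit t + 3) r) ?F"
        using hol c by (intro holomorphic_on_imp_continuous_on) (rule holomorphic_on_subset)
      fix z assume z: "norm (crit t + 3 - z) = r"
      have Re: "\<bar>7/2 - Re z\<bar> \<le> r" using abs_Re_le_cmod[of "crit t + 3 - z"] z by simp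
      have Im: "\<bar>t - Im z\<bar> \<le> r" using abs_Im_le_cmod[of "crit t + 3 - z"] z by simp
      have r3: "r \<le> 3" using \<delta> by (simp add: r_def)
      have "norm (?F z) \<le> C * (1 + \<bar>Im z\<bar>) ^ A"
        using Re \<delta> by (intro C) (auto simp: r_def)
      also have "\<dots> \<le> C * (4 * (1 + \<bar>t\<bar>)) ^ A"
        using Im r3 C(1) by (intro mult_left_mono power_mono) auto
      also have "\<dots> = B" by (simp only: B_def power_mult_distrib mult.assoc)
      finally show "norm (?F z) \<le> B" .
    qed
    have "norm (E J (crit t)) \<le> (\<Sum>j<J. B * q ^ j)"
      unfolding E_def
    proof (rule sum_norm_le)
      fix j
      have "norm ((deriv ^^ j) ?F (crit t + 3) / fact j * h ^ j) = norm ((deriv ^^ j) ?F (crit t + 3)) / fact j * norm h ^ j"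
        by (simp add: norm_mult norm_divide norm_power)
      also have "\<dots> \<le> (fact j * B / r ^ j) / fact j * norm h ^ j"
        by (intro mult_right_mono divide_right_mono coeff) auto
      also have "\<dots> = B * q ^ j" by (simp add: q_def power_divide)
      finally show "norm ((deriv ^^ j) ?F (crit t + 3) / fact j * h ^ j) \<le> B * q ^ j" .
    qed
    also have "\<dots> = B * (\<Sum>j<J. q ^ j)" by (simp add: sum_distrib_left)
    also have "\<dots> \<le> B * (1 / (1 - q))"
    proof (intro mult_left_mono B)
      have "(\<Sum>j<J. q ^ j) \<le> (\<Sum>j. q ^ j)" using q by (intro sum_le_suminf summable_geometric) auto
      then show "(\<Sum>j<J. q ^ j) \<le> 1 / (1 - q)" using q by (simp add: suminf_geometric)
    qed
    finally show ?thesis by (simp add: B_def D_def)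
  qed
  show ?thesis
  proof (rule approximable_limit[where E = E, OF w _ lim lim bd])
    show "approximable w (E k)" for k unfolding E_def by (rule approximable_taylor_sum[OF w])
    show "D \<ge> 0" using C q by (simp add: D_def)
    show "(\<lambda>t. E k (crit t)) \<in> borel_measurable borel" for k
    proof -
      have "continuous_on {z. Re z > 1/2} ((deriv ^^ j) ?F)" for j
        by (intro holomorphic_on_imp_continuous_on holomorphic_higher_deriv hol open_halfspace_Re_gt)
      then have "continuous_on UNIV (\<lambda>t. (deriv ^^ j) ?F (crit t + 3))" for j
        by (rule continuous_on_compose2) (auto intro!: continuous_intros)
      then show ?thesis unfolding E_def
        by (intro borel_measurable_continuous_onI continuous_intros) auto
    qed
  qed auto
qed

section \<open>Decay on the critical line and the limit of vanishing shifts\<close>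

lemma crit_ne_1: "crit t \<noteq> 1"
  by (simp add: crit_def complex_eq_iff)

lemma norm_crit_minus_1: "1/2 \<le> norm (crit t - 1)"
  using abs_Re_le_cmod[of "crit t - 1"] by simp

lemma one_plus_abs_le_norm_crit: "1 + \<bar>t\<bar> \<le> 3 * norm (crit t)"
  using abs_Re_le_cmod[of "crit t"] abs_Im_le_cmod[of "crit t"] by simp

lemma zeta_crit_eq: "riemann_zeta (crit t) = zreg (crit t) / (crit t - 1)"
  using crit_ne_1[of t] by (simp add: zreg_def)

lemma mellin_crit_decay:
  assumes "f \<in> smooth01"
  shows "\<exists>C\<ge>0. \<forall>t. norm (mellin f (crit t)) * (1 + \<bar>t\<bar>) ^ k \<le> C"
proof -
  obtain C where C: "C \<ge> 0" "\<And>s. Re s \<ge> 1/2 \<Longrightarrow> norm (mellin f s) * norm s ^ k \<le> C"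
    using mellin_decay[OF assms] by blast
  have "norm (mellin f (crit t)) * (1 + \<bar>t\<bar>) ^ k \<le> 3 ^ k * C" for t
  proof -
    have "norm (mellin f (crit t)) * (1 + \<bar>t\<bar>) ^ k \<le> norm (mellin f (crit t)) * (3 * norm (crit t)) ^ k"
      using one_plus_abs_le_norm_crit[of t] by (intro mult_left_mono power_mono) auto
    also have "\<dots> = 3 ^ k * (norm (mellin f (crit t)) * norm (crit t) ^ k)" by (simp add: power_mult_distrib)
    also have "\<dots> \<le> 3 ^ k * C" by (intro mult_left_mono C) auto
    finally show ?thesis .
  qed
  then show ?thesis using C by (intro exI[of _ "3 ^ k * C"]) auto
qed

lemma mellin_crit_measurable:
  assumes f: "f \<in> smooth01" shows "(\<lambda>t. mellin f (crit t)) \<in> borel_measurable borel"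
proof -
  obtain B where B: "\<And>u. norm (f u) \<le> B" using smooth01_bounded[OF f] by blast
  have "continuous_on {s. Re s > 0} (mellin f)"
    by (intro holomorphic_on_imp_continuous_on mellin_holomorphic[OF smooth01_D(5)[OF f] B smooth01_D(3)[OF f]])
  then have "continuous_on UNIV (\<lambda>t. mellin f (crit t))"
    by (rule continuous_on_compose2) (auto intro!: continuous_intros)
  then show ?thesis by (rule borel_measurable_continuous_onI)
qed

lemma rapidly_decreasing_mellin: "f \<in> smooth01 \<Longrightarrow> rapidly_decreasing (\<lambda>t. mellin f (crit t))"
  unfolding rapidly_decreasing_def using mellin_crit_measurable mellin_crit_decay by blast

lemma rapidly_decreasing_zeta_mellin:
  assumes f: "f \<in> smooth01"
  shows "rapidly_decreasing (\<lambda>t. riemann_zeta (crit t) * mellin f (crit t))"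
  unfolding rapidly_decreasing_def
proof (intro conjI allI)
  have "continuous_on (- {1}) riemann_zeta"
    by (rule holomorphic_on_imp_continuous_on[OF riemann_zeta_holomorphic])
  then have "continuous_on UNIV (\<lambda>t. riemann_zeta (crit t))"
    by (rule continuous_on_compose2) (use crit_ne_1 in \<open>auto intro!: continuous_intros\<close>)
  then have "(\<lambda>t. riemann_zeta (crit t)) \<in> borel_measurable borel" by (rule borel_measurable_continuous_onI)
  then show "(\<lambda>t. riemann_zeta (crit t) * mellin f (crit t)) \<in> borel_measurable borel"
    using mellin_crit_measurable[OF f] by (rule borel_measurable_times)
  fix k
  obtain C where C: "C \<ge> 1" "\<And>t z. z \<in> cball (Complex 4 t) 9 \<Longrightarrow> norm (zreg z) \<le> C * (1 + \<bar>t\<bar>) ^ 9"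
    using zreg_growth by blast
  obtain C' where C': "C' \<ge> 0" "\<And>t. norm (mellin f (crit t)) * (1 + \<bar>t\<bar>) ^ (9 + k) \<le> C'"
    using mellin_crit_decay[OF f] by blast
  have "norm (riemann_zeta (crit t) * mellin f (crit t)) * (1 + \<bar>t\<bar>) ^ k \<le> 2 * C * C'" for t
  proof -
    have "norm (zreg (crit t)) \<le> C * (1 + \<bar>t\<bar>) ^ 9"
      by (rule C) (simp add: dist_norm crit_def cmod_def)
    then have "norm (riemann_zeta (crit t)) \<le> (C * (1 + \<bar>t\<bar>) ^ 9) / (1/2)"
      unfolding zeta_crit_eq norm_divide using norm_crit_minus_1[of t] C(1) by (intro frac_le) auto
    then have "norm (riemann_zeta (crit t) * mellin f (crit t)) * (1 + \<bar>t\<bar>) ^ k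
       \<le> ((C * (1 + \<bar>t\<bar>) ^ 9) / (1/2)) * norm (mellin f (crit t)) * (1 + \<bar>t\<bar>) ^ k"
      unfolding norm_mult by (intro mult_right_mono) auto
    also have "\<dots> = 2 * C * (norm (mellin f (crit t)) * (1 + \<bar>t\<bar>) ^ (9 + k))" by (simp add: power_add)
    also have "\<dots> \<le> 2 * C * C'" using C(1) by (intro mult_left_mono C') auto
    finally show ?thesis .
  qed
  then show "\<exists>C\<ge>0. \<forall>t. norm (riemann_zeta (crit t) * mellin f (crit t)) * (1 + \<bar>t\<bar>) ^ k \<le> C"
    using C C' by (intro exI[of _ "2 * C * C'"]) auto
qed

text \<open>Ensures that the zeros on the line form a null set. It remains to see that
  \<open>zreg\<close> is not constant: otherwise it would be 1, and the reciprocal of zeta would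
  equal s - 1 for Re s > 3, which is unbounded on Re s = 4 and contradicts
  \<open>norm_inverse_zeta_le\<close>.\<close>

lemma countable_zeta_zeros_crit: "countable {t. riemann_zeta (crit t) = 0}"
proof -
  let ?S = "{s::complex. Re s > - 6}"
  have "countable {z \<in> ?S. zreg z = 0}"
  proof (rule holomorphic_countable_zeros[OF zreg_holomorphic])
    show "open ?S" by (rule open_halfspace_Re_gt)
    show "connected ?S" by (intro convex_connected convex_halfspace_Re_gt)
    have "fsigma (\<Union>n::nat. {s::complex. Re s \<ge> - 6 + 1 / real (Suc n)})"
      by (intro fsigma.intros closed_halfspace_Re_ge)
    also have "(\<Union>n::nat. {s::complex. Re s \<ge> - 6 + 1 / real (Suc n)}) = ?S"
    proof (intro equalityI subsetI)
      fix s assume "s \<in> ?S"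
      then obtain n where "inverse (real (Suc n)) < Re s + 6" using reals_Archimedean[of "Re s + 6"] by auto
      then show "s \<in> (\<Union>n::nat. {s::complex. Re s \<ge> - 6 + 1 / real (Suc n)})"
        by (auto simp: inverse_eq_divide intro!: exI[of _ n])
    next
      fix s assume "s \<in> (\<Union>n::nat. {s::complex. Re s \<ge> - 6 + 1 / real (Suc n)})"
      then obtain n where "- 6 + 1 / real (Suc n) \<le> Re s" by auto
      moreover have "0 < 1 / real (Suc n)" by simp
      ultimately have "- 6 < Re s" by linarith
      then show "s \<in> ?S" by simp
    qed
    finally show "fsigma ?S" .
    show "\<not> zreg constant_on ?S"
    proof
      assume "zreg constant_on ?S"
      then obtain c where c: "\<And>z. z \<in> ?S \<Longrightarrow> zreg z = c" by (auto simp: constant_on_def)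
      have c1: "c = 1" using c[of 1] by (simp add: zreg_def)
      have "riemann_zeta s = 1 / (s - 1)" if "Re s > 3" for s
      proof -
        have "s \<noteq> 1" using that by auto
        then show ?thesis using c[of s] c1 that by (simp add: zreg_def field_simps)
      qed
      then have z: "1 / riemann_zeta s = s - 1" if "Re s > 3" for s using that by simp
      define S where "S = (\<Sum>n. (real n + 1) powr (- 2))"
      have bd: "norm (1 / riemann_zeta s) \<le> S" if "Re s = 4" for s
        unfolding S_def by (rule norm_inverse_zeta_le[OF that])
      have "\<bar>S\<bar> + 1 \<le> norm (Complex 4 (\<bar>S\<bar> + 1) - 1)"
        using abs_Im_le_cmod[of "Complex 4 (\<bar>S\<bar> + 1) - 1"] by simp
      also have "\<dots> \<le> S" using bd[of "Complex 4 (\<bar>S\<bar> + 1)"] z[of "Complex 4 (\<bar>S\<bar> + 1)"] by simp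
      finally show False by linarith
    qed
  qed
  moreover have "crit ` {t. riemann_zeta (crit t) = 0} \<subseteq> {z \<in> ?S. zreg z = 0}"
    using crit_ne_1 by (auto simp: zreg_def)
  ultimately have "countable (crit ` {t. riemann_zeta (crit t) = 0})" by (rule countable_subset[rotated])
  moreover have "inj_on crit {t. riemann_zeta (crit t) = 0}" by (auto simp: inj_on_def crit_def)
  ultimately show ?thesis by (rule countable_image_inj_on)
qed

text \<open>Dominated convergence with the majorant from \<open>zreg_ratio\<close>. At a zero on the
  line the quotient is 0 for every n and does not tend to 1, so convergence holds only almost
  everywhere. The shift 1/(n + 2) keeps \<delta> at most 1/2.\<close>

lemma shifted_ratio_tendsto:
  assumes RH: "riemann_hypothesis" and f: "f \<in> smooth01"
  shows "\<forall>\<epsilon>>0. \<exists>n0. \<forall>n\<ge>n0. 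
     integrable lborel (\<lambda>t. (norm (riemann_zeta (crit t) * mellin f (crit t) * (1 / riemann_zeta (crit t + of_real (1 / real (n + 2)))) - mellin f (crit t)))\<^sup>2) \<and>
     (\<integral>t. (norm (riemann_zeta (crit t) * mellin f (crit t) * (1 / riemann_zeta (crit t + of_real (1 / real (n + 2)))) - mellin f (crit t)))\<^sup>2 \<partial>lborel) < \<epsilon>"
proof -
  define R where "R n t = riemann_zeta (crit t) * (1 / riemann_zeta (crit t + of_real (1 / real (n + 2)))) - 1" for n t
  have eq: "riemann_zeta (crit t) * mellin f (crit t) * (1 / riemann_zeta (crit t + of_real (1 / real (n + 2)))) - mellin f (crit t)
     = mellin f (crit t) * R n t" for n t
    by (simp add: R_def algebra_simps)
  obtain C A where C: "C \<ge> 0" "\<And>t \<delta>. 0 \<le> \<delta> \<Longrightarrow> \<delta> \<le> 1/2 \<Longrightarrow>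
    norm (zreg (Complex (1/2) t)) \<le> C * (1 + \<bar>t\<bar>) ^ A * norm (zreg (Complex (1/2 + \<delta>) t))"
    using zreg_ratio[OF RH] by blast
  have Rb: "norm (R n t) \<le> (2 * C + 1) * (1 + \<bar>t\<bar>) ^ A" for n t
  proof -
    define \<delta> where "\<delta> = 1 / real (n + 2)"
    have \<delta>: "0 < \<delta>" "\<delta> \<le> 1/2" by (auto simp: \<delta>_def divide_simps)
    have ct: "crit t + of_real \<delta> = Complex (1/2 + \<delta>) t" by (simp add: crit_def complex_eq_iff)
    have nz: "zreg (crit t + of_real \<delta>) \<noteq> 0" using \<delta> by (intro zreg_nonzero[OF RH]) simp
    have "riemann_zeta (crit t) * (1 / riemann_zeta (crit t + of_real \<delta>))
      = (zreg (crit t) / zreg (crit t + of_real \<delta>)) * ((crit t + of_real \<delta> - 1) / (crit t - 1))"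
      unfolding inverse_zeta_eq zeta_crit_eq by simp
    \<comment> \<open>The factor 2 bounds the quotient of the removed pole factors, as
      \<open>norm (crit t - 1)\<close> is at least 1/2 and hence at least \<delta>.\<close>
    also have "norm \<dots> \<le> (C * (1 + \<bar>t\<bar>) ^ A) * 2"
      unfolding norm_mult norm_divide
    proof (rule mult_mono)
      show "norm (zreg (crit t)) / norm (zreg (crit t + of_real \<delta>)) \<le> C * (1 + \<bar>t\<bar>) ^ A"
      proof -
        have "norm (zreg (crit t)) \<le> C * (1 + \<bar>t\<bar>) ^ A * norm (zreg (crit t + of_real \<delta>))"
          using C(2)[of \<delta> t] \<delta> unfolding ct by (simp add: crit_def)
        then show ?thesis using nz by (subst pos_divide_le_eq) auto
      qed
      have "norm (crit t + of_real \<delta> - 1) \<le> norm (crit t - 1) + norm (of_real \<delta> :: complex)"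
        using norm_triangle_ineq[of "crit t - 1" "of_real \<delta>"] by (simp add: algebra_simps)
      also have "\<dots> \<le> 2 * norm (crit t - 1)" using \<delta> norm_crit_minus_1[of t] by simp
      finally show "norm (crit t + of_real \<delta> - 1) / norm (crit t - 1) \<le> 2"
        using norm_crit_minus_1[of t] by (subst pos_divide_le_eq) auto
    qed (use C in auto)
    finally have "norm (R n t) \<le> (C * (1 + \<bar>t\<bar>) ^ A) * 2 + 1"
      unfolding R_def \<delta>_def[symmetric] by (intro order_trans[OF norm_triangle_ineq4]) simp
    also have "\<dots> \<le> (C * (1 + \<bar>t\<bar>) ^ A) * 2 + (1 + \<bar>t\<bar>) ^ A" by simp
    also have "\<dots> = (2 * C + 1) * (1 + \<bar>t\<bar>) ^ A" by (simp add: algebra_simps)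
    finally show ?thesis .
  qed
  have D: "2 * C + 1 \<ge> 0" using C by simp
  note w = rapidly_decreasing_mellin[OF f]
  obtain g where g1: "integrable lborel g" and g2: "\<forall>z t. norm z \<le> (2 * C + 1) * (1 + \<bar>t\<bar>) ^ A \<longrightarrow> (norm (mellin f (crit t) * z))\<^sup>2 \<le> g t"
    using weighted_square_bound[OF w D, of A] by (elim exE conjE)
  have g: "(norm (mellin f (crit t) * R n t))\<^sup>2 \<le> g t" for n t using g2 Rb[of n t] by simp
  have cont: "continuous_on UNIV (\<lambda>t. R n t)" for n
  proof -
    have "continuous_on (- {1}) riemann_zeta"
      by (rule holomorphic_on_imp_continuous_on[OF riemann_zeta_holomorphic])
    then have 1: "continuous_on UNIV (\<lambda>t. riemann_zeta (crit t))"
      by (rule continuous_on_compose2) (use crit_ne_1 in \<open>auto intro!: continuous_intros\<close>)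
    have "continuous_on {z. Re z > 1/2} (\<lambda>z. 1 / riemann_zeta z)"
      by (rule holomorphic_on_imp_continuous_on[OF inverse_zeta_holomorphic[OF RH]])
    then have 2: "continuous_on UNIV (\<lambda>t. 1 / riemann_zeta (crit t + of_real (1 / real (n + 2))))"
      by (rule continuous_on_compose2) (auto intro!: continuous_intros)
    show ?thesis unfolding R_def by (intro continuous_intros 1 2)
  qed
  then have Rm [measurable]: "(\<lambda>t. R n t) \<in> borel_measurable borel" for n by (rule borel_measurable_continuous_onI)
  have [measurable]: "(\<lambda>t. mellin f (crit t)) \<in> borel_measurable borel" by (rule mellin_crit_measurable[OF f])
  have Rlim: "(\<lambda>n. R n t) \<longlonglongrightarrow> 0" if "riemann_zeta (crit t) \<noteq> 0" for t
  proof -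
    have "isCont riemann_zeta (crit t)"
      using holomorphic_on_imp_continuous_on[OF riemann_zeta_holomorphic] crit_ne_1[of t]
      by (simp add: continuous_on_eq_continuous_at open_Compl)
    moreover have "(\<lambda>n. crit t + of_real (1 / real (n + 2))) \<longlonglongrightarrow> crit t + of_real 0"
    proof (intro tendsto_intros)
      show "(\<lambda>n. 1 / real (n + 2)) \<longlonglongrightarrow> 0"
        by (rule LIMSEQ_ignore_initial_segment[OF lim_inverse_n'])
    qed
    ultimately have "(\<lambda>n. riemann_zeta (crit t + of_real (1 / real (n + 2)))) \<longlonglongrightarrow> riemann_zeta (crit t)"
      by (intro isCont_tendsto_compose[of "crit t" riemann_zeta]) auto
    then have "(\<lambda>n. R n t) \<longlonglongrightarrow> riemann_zeta (crit t) * (1 / riemann_zeta (crit t)) - 1"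
      unfolding R_def by (intro tendsto_intros that)
    then show ?thesis using that by simp
  qed
  have int: "integrable lborel (\<lambda>t. (norm (mellin f (crit t) * R n t))\<^sup>2)" for n
    by (rule weighted_square_integrable[OF w Rm Rb D])
  have "(\<lambda>n. \<integral>t. (norm (mellin f (crit t) * R n t))\<^sup>2 \<partial>lborel) \<longlonglongrightarrow> (\<integral>t. 0 \<partial>(lborel :: real measure))"
  proof (rule integral_dominated_convergence[where w = g])
    have "AE t in lborel. t \<notin> {t. riemann_zeta (crit t) = 0}"
      by (rule AE_not_in[OF countable_imp_null_set_lborel[OF countable_zeta_zeros_crit]])
    then show "AE t in lborel. (\<lambda>n. (norm (mellin f (crit t) * R n t))\<^sup>2) \<longlonglongrightarrow> 0"
    proof eventually_elim
      fix t assume "t \<notin> {t. riemann_zeta (crit t) = 0}"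
      then have "(\<lambda>n. (norm (mellin f (crit t) * R n t))\<^sup>2) \<longlonglongrightarrow> (norm (mellin f (crit t) * 0))\<^sup>2"
        by (intro tendsto_intros Rlim) simp
      then show "(\<lambda>n. (norm (mellin f (crit t) * R n t))\<^sup>2) \<longlonglongrightarrow> 0" by simp
    qed
    show "AE t in lborel. norm ((norm (mellin f (crit t) * R n t))\<^sup>2) \<le> g t" for n
      using g by (intro AE_I2) simp
  qed (use g1 in auto)
  then have lim: "(\<lambda>n. \<integral>t. (norm (mellin f (crit t) * R n t))\<^sup>2 \<partial>lborel) \<longlonglongrightarrow> 0" by simp
  show ?thesis unfolding eq
  proof (intro allI impI)
    fix \<epsilon> :: real assume "\<epsilon> > 0"
    then have "eventually (\<lambda>n. (\<integral>t. (norm (mellin f (crit t) * R n t))\<^sup>2 \<partial>lborel) < \<epsilon>) sequentially"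
      by (rule order_tendstoD(2)[OF lim])
    then obtain n0 where n0: "\<forall>n\<ge>n0. (\<integral>t. (norm (mellin f (crit t) * R n t))\<^sup>2 \<partial>lborel) < \<epsilon>"
      unfolding eventually_sequentially by blast
    show "\<exists>n0. \<forall>n\<ge>n0. integrable lborel (\<lambda>t. (norm (mellin f (crit t) * R n t))\<^sup>2) \<and>
       (\<integral>t. (norm (mellin f (crit t) * R n t))\<^sup>2 \<partial>lborel) < \<epsilon>"
      using n0 int by blast
  qed
qed

lemma inverse_zeta_tendsto_0: "(\<lambda>n. 1 / riemann_zeta (1 + of_real (1 / real (n + 2)))) \<longlonglongrightarrow> 0"
proof -
  have l: "(\<lambda>n. 1 + complex_of_real (1 / real (n + 2))) \<longlonglongrightarrow> 1 + of_real 0"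
  proof (intro tendsto_intros)
    show "(\<lambda>n. 1 / real (n + 2)) \<longlonglongrightarrow> 0"
      by (rule LIMSEQ_ignore_initial_segment[OF lim_inverse_n'])
  qed
  have "continuous_on {s. Re s > - 6} zreg" by (rule holomorphic_on_imp_continuous_on[OF zreg_holomorphic])
  then have "isCont zreg 1" by (simp add: continuous_on_eq_continuous_at open_halfspace_Re_gt)
  then have z: "(\<lambda>n. zreg (1 + of_real (1 / real (n + 2)))) \<longlonglongrightarrow> zreg 1"
    using l by (intro isCont_tendsto_compose[of 1 zreg]) auto
  have "zreg 1 \<noteq> 0" by (simp add: zreg_def)
  then have "(\<lambda>n. (1 + complex_of_real (1 / real (n + 2)) - 1) / zreg (1 + of_real (1 / real (n + 2)))) \<longlonglongrightarrow> (1 + of_real 0 - 1) / zreg 1"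
    by (intro tendsto_divide tendsto_diff l z tendsto_const)
  then show ?thesis unfolding inverse_zeta_eq by simp
qed

subsection \<open>Approximation of the constant function\<close>

text \<open>Contains the standard cutoff exp (- e / (x (1 - x))) together with all its derivatives,
  whose form \<open>p\<close> and \<open>k\<close> record; \<open>e\<close> stays a parameter so
  that it can tend to 0.\<close>

definition bump :: "real \<Rightarrow> real poly \<Rightarrow> nat \<Rightarrow> real \<Rightarrow> real" where
  "bump e p k x = (if 0 < x \<and> x < 1 then poly p x / (x * (1 - x)) ^ k * exp (- e / (x * (1 - x))) else 0)"

lemma exp_minus_le_power:
  fixes y :: real assumes "y > 0" "m > 0"
  shows "exp (- y) \<le> (real m / y) ^ m"
proof -
  have "(y / real m) ^ m \<le> exp (y / real m) ^ m"
    using exp_ge_add_one_self[of "y / real m"] assms by (intro power_mono) (linarith, simp)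
  also have "\<dots> = exp y" using assms by (simp flip: exp_of_nat_mult)
  finally have "inverse (exp y) \<le> inverse ((y / real m) ^ m)"
    using assms by (intro le_imp_inverse_le) auto
  then show ?thesis by (simp only: exp_minus power_inverse[symmetric] inverse_divide)
qed

text \<open>Vanishing to second order at both end points yields the derivative 0 there. In
  \<open>exp_minus_le_power\<close> the exponent m = k + 2 cancels the denominator and leaves the
  square of x (1 - x).\<close>

lemma bump_bound:
  assumes e: "e > 0"
  shows "\<exists>C\<ge>0. \<forall>x. \<bar>bump e p k x\<bar> \<le> C * (x - 0)\<^sup>2 \<and> \<bar>bump e p k x\<bar> \<le> C * (x - 1)\<^sup>2"
proof -
  have "compact (poly p ` {0..1})"
    by (intro compact_continuous_image continuous_intros) auto
  then have "bounded (poly p ` {0..1})" by (rule compact_imp_bounded)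
  then obtain P where P: "\<forall>y \<in> poly p ` {0..1}. norm y \<le> P" unfolding bounded_iff by blast
  have "norm (poly p 0) \<le> P" using P by auto
  then have P0: "P \<ge> 0" using norm_ge_zero[of "poly p 0"] by linarith
  define m where "m = k + 2"
  define C where "C = P * (real m / e) ^ m"
  have C: "C \<ge> 0" using P0 e by (simp add: C_def)
  have "\<bar>bump e p k x\<bar> \<le> C * (x - 0)\<^sup>2 \<and> \<bar>bump e p k x\<bar> \<le> C * (x - 1)\<^sup>2" for x
  proof (cases "0 < x \<and> x < 1")
    case True
    define q where "q = x * (1 - x)"
    have q: "q > 0" "q \<le> x" "q \<le> 1 - x" using True by (auto simp: q_def mult_left_le mult_left_le_one_le)
    have "exp (- e / q) \<le> (real m / (e / q)) ^ m"
      using exp_minus_le_power[of "e / q" m] e q by (simp add: m_def)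
    also have "\<dots> = (real m / e) ^ m * q ^ m" by (simp add: power_mult_distrib power_divide)
    finally have E: "exp (- e / q) \<le> (real m / e) ^ m * q ^ m" .
    have "\<bar>bump e p k x\<bar> = \<bar>poly p x\<bar> / q ^ k * exp (- e / q)"
      unfolding bump_def q_def[symmetric] using True q by (simp add: abs_mult)
    also have "\<dots> \<le> P / q ^ k * ((real m / e) ^ m * q ^ m)"
    proof (rule mult_mono)
      have "norm (poly p x) \<le> P" using P True by auto
      then show "\<bar>poly p x\<bar> / q ^ k \<le> P / q ^ k" using q by (intro divide_right_mono) simp_all
      show "0 \<le> P / q ^ k" using q P0 by simp
    qed (rule E, simp)
    also have "q ^ m = q ^ k * q\<^sup>2" by (simp only: m_def power_add)
    also have "P / q ^ k * ((real m / e) ^ m * (q ^ k * q\<^sup>2)) = C * q\<^sup>2" using q by (simp add: C_def)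
    finally have b: "\<bar>bump e p k x\<bar> \<le> C * q\<^sup>2" .
    have "q\<^sup>2 \<le> (x - 0)\<^sup>2" using q by (intro power_mono) auto
    moreover have "q\<^sup>2 \<le> (1 - x)\<^sup>2" using q by (intro power_mono) auto
    then have "q\<^sup>2 \<le> (x - 1)\<^sup>2" by (simp add: power2_commute)
    ultimately show ?thesis using b C by (meson mult_left_mono order_trans)
  next
    case False
    then have "bump e p k x = 0" by (auto simp: bump_def)
    then show ?thesis using C by simp
  qed
  then show ?thesis using C by blast
qed

lemma has_derivative_zero_of_quadratic_bound:
  fixes f :: "real \<Rightarrow> real"
  assumes "\<And>x. \<bar>f x\<bar> \<le> C * (x - a)\<^sup>2"
  shows "(f has_real_derivative 0) (at a)"
  unfolding DERIV_def
proof (rule Lim_null_comparison)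
  have fa: "f a = 0" using assms[of a] by simp
  show "eventually (\<lambda>h. norm ((f (a + h) - f a) / h) \<le> C * \<bar>h\<bar>) (at 0)"
  proof (intro eventually_at_topological[THEN iffD2] exI[of _ UNIV] conjI ballI impI)
    fix h :: real assume h: "h \<noteq> 0"
    have "\<bar>f (a + h)\<bar> \<le> C * h\<^sup>2" using assms[of "a + h"] by simp
    also have "\<dots> = C * \<bar>h\<bar> * \<bar>h\<bar>" by (simp add: power2_eq_square)
    finally show "norm ((f (a + h) - f a) / h) \<le> C * \<bar>h\<bar>" using h by (simp add: fa divide_le_eq)
  qed auto
  show "((\<lambda>h. C * \<bar>h\<bar>) \<longlongrightarrow> 0) (at 0)" by (rule tendsto_eq_intros refl | simp)+
qed

lemma bump_eq:
  assumes "0 < x" "x < 1"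
  shows "bump e p k x = poly p x * exp (- (real k * ln (x * (1 - x))) - e / (x * (1 - x)))"
proof -
  have "x * (1 - x) > 0" using assms by simp
  then show ?thesis using assms
    by (simp only: bump_def exp_diff exp_minus exp_of_nat_mult exp_ln minus_divide_left[symmetric]) (simp add: divide_inverse)
qed

text \<open>Inside the interval the product rule is put over the common denominator
  \<open>Q ^ (k + 2)\<close> with Q = x (1 - x), and the numerator is \<open>p'\<close>; at the end
  points \<open>bump_bound\<close> takes over.\<close>

lemma bump_has_derivative:
  assumes e: "e > 0"
  shows "\<exists>p'. \<forall>x. (bump e p k has_real_derivative bump e p' (k + 2) x) (at x)"
proof -
  define Q :: "real poly" where "Q = [:0, 1, -1:]"
  define p' where "p' = pderiv p * Q\<^sup>2 - smult (real k) (p * pderiv Q * Q) + smult e (p * pderiv Q)"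
  have Qx: "poly Q x = x * (1 - x)" for x by (simp add: Q_def algebra_simps)
  have Q'x: "poly (pderiv Q) x = 1 - 2 * x" for x by (simp add: Q_def pderiv_pCons)
  have "(bump e p k has_real_derivative bump e p' (k + 2) x) (at x)" for x
  proof -
    obtain C where C: "\<And>x. \<bar>bump e p k x\<bar> \<le> C * (x - 0)\<^sup>2" "\<And>x. \<bar>bump e p k x\<bar> \<le> C * (x - 1)\<^sup>2"
      using bump_bound[OF e, of p k] by blast
    consider "x = 0" | "x = 1" | "x < 0 \<or> x > 1" | "0 < x" "x < 1" by linarith
    then show ?thesis
    proof cases
      case 1
      then show ?thesis using has_derivative_zero_of_quadratic_bound[OF C(1)] by (simp add: bump_def[of _ p'])
    next
      case 2
      then show ?thesis using has_derivative_zero_of_quadratic_bound[OF C(2)] by (simp add: bump_def[of _ p'])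
    next
      case 3
      have "((\<lambda>x. 0) has_real_derivative 0) (at x)" by simp
      moreover have "open ({..<0} \<union> {1<..} :: real set)" by auto
      ultimately have "(bump e p k has_real_derivative 0) (at x)"
        by (rule has_field_derivative_transform_within_open) (use 3 in \<open>auto simp: bump_def\<close>)
      then show ?thesis using 3 by (auto simp: bump_def[of _ p'])
    next
      case 4
      define q where "q = x * (1 - x)"
      have q: "q > 0" using 4 by (simp add: q_def)
      then have q0: "x * (1 - x) > 0" "x * (1 - x) \<noteq> 0" unfolding q_def by auto
      have dq: "((\<lambda>y. y * (1 - y)) has_real_derivative (1 - 2 * x)) (at x)"
        by (auto intro!: derivative_eq_intros simp: algebra_simps)
      define E where "E = exp (- (real k * ln q) - e / q)"
      have dl: "((\<lambda>y. ln (y * (1 - y))) has_real_derivative (1 / q * (1 - 2 * x))) (at x)"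
        using DERIV_chain2[OF DERIV_ln_divide[OF q0(1)] dq] by (simp only: q_def)
      have di: "((\<lambda>y. e / (y * (1 - y))) has_real_derivative ((0 * q - e * (1 - 2 * x)) / (q * q))) (at x)"
        using DERIV_divide[OF DERIV_const dq q0(2), of e] by (simp only: q_def)
      have de: "((\<lambda>y. exp (- (real k * ln (y * (1 - y))) - e / (y * (1 - y)))) has_real_derivative
          (E * (- (real k * (1 / q * (1 - 2 * x))) - (0 * q - e * (1 - 2 * x)) / (q * q)))) (at x)"
        unfolding E_def using DERIV_chain2[OF DERIV_exp DERIV_diff[OF DERIV_minus[OF DERIV_cmult[OF dl]] di]]
        by (simp only: q_def)
      have d: "((\<lambda>y. poly p y * exp (- (real k * ln (y * (1 - y))) - e / (y * (1 - y)))) has_real_derivative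
          (poly (pderiv p) x * E + (E * (- (real k * (1 / q * (1 - 2 * x))) - (0 * q - e * (1 - 2 * x)) / (q * q))) * poly p x)) (at x)"
        using DERIV_mult[OF poly_DERIV de] by (simp only: E_def q_def)
      have "bump e p' (k + 2) x = poly p' x * (E / q\<^sup>2)"
      proof -
        have "exp (- (real (k + 2) * ln q) - e / q) = E / exp (2 * ln q)"
          unfolding E_def exp_diff[symmetric] by (simp add: algebra_simps)
        also have "exp (2 * ln q) = q\<^sup>2" using q by (simp add: exp_double)
        finally show ?thesis using bump_eq[OF 4, of e p' "k + 2"] by (simp only: q_def)
      qed
      also have "poly p' x = poly (pderiv p) x * q\<^sup>2 - real k * (poly p x * (1 - 2 * x) * q) + e * (poly p x * (1 - 2 * x))"
        by (simp add: p'_def Qx Q'x q_def)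
      also have "(poly (pderiv p) x * q\<^sup>2 - real k * (poly p x * (1 - 2 * x) * q) + e * (poly p x * (1 - 2 * x))) * (E / q\<^sup>2)
         = poly (pderiv p) x * E + (E * (- (real k * (1 / q * (1 - 2 * x))) - (0 * q - e * (1 - 2 * x)) / (q * q))) * poly p x"
      proof -
        define P P' x' K where "P = poly p x" and "P' = poly (pderiv p) x" and "x' = 1 - 2 * x" and "K = real k"
        show ?thesis unfolding P_def[symmetric] P'_def[symmetric] x'_def[symmetric] K_def[symmetric]
          using q by (simp add: field_simps power2_eq_square)
      qed
      finally have "((\<lambda>y. poly p y * exp (- (real k * ln (y * (1 - y))) - e / (y * (1 - y)))) has_real_derivative bump e p' (k + 2) x) (at x)"
        using d by simp
      then show ?thesis
        by (rule has_field_derivative_transform_within_open[where S = "{0<..<1}"]) (use 4 bump_eq in auto)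
    qed
  qed
  then show ?thesis by blast
qed

lemma bump_smooth01:
  assumes e: "e > 0" shows "(\<lambda>x. complex_of_real (bump e p k x)) \<in> smooth01"
proof -
  have "smooth (\<lambda>x. complex_of_real (bump e p k x))"
  proof (rule smooth_coinduct[of _ "range (\<lambda>(p, k) x. complex_of_real (bump e p k x))"])
    show "(\<lambda>x. complex_of_real (bump e p k x)) \<in> range (\<lambda>(p, k) x. complex_of_real (bump e p k x))"
      by (rule range_eqI[of _ _ "(p, k)"]) simp
    fix f assume "f \<in> range (\<lambda>(p, k) x. complex_of_real (bump e p k x))"
    then obtain p k where f: "f = (\<lambda>x. complex_of_real (bump e p k x))" by (elim rangeE) (auto split: prod.splits)
    obtain p' where p': "\<forall>x. (bump e p k has_real_derivative bump e p' (k + 2) x) (at x)"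
      using bump_has_derivative[OF e, of p k] by (elim exE)
    have "(f has_vector_derivative of_real (bump e p' (k + 2) x)) (at x)" for x
      unfolding f by (rule has_vector_derivative_of_real[OF spec[OF p', of x]])
    then show "\<exists>g\<in>range (\<lambda>(p, k) x. complex_of_real (bump e p k x)). \<forall>x. (f has_vector_derivative g x) (at x)"
      by (intro bexI[of _ "(\<lambda>(p, k) x. complex_of_real (bump e p k x)) (p', k + 2)"] allI rangeI) simp
  qed
  then show ?thesis by (auto simp: smooth01_def bump_def)
qed

text \<open>Only density of \<open>smooth01\<close> near the constant \<open>1\<close> is needed; in \<open>S0_le1\<close> itself this fails,
  since its elements are orthogonal to the constants.\<close>

lemma smooth01_approximates_1:
  assumes "\<epsilon> > 0"
  shows "\<exists>f\<in>smooth01. integrable (lebesgue_on {0<..<1}) (\<lambda>u. (norm (1 - f u))\<^sup>2) \<and>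
     (\<integral>u. (norm (1 - f u))\<^sup>2 \<partial>lebesgue_on {0<..<1}) < \<epsilon>"
proof -
  let ?M = "lebesgue_on {0<..<1::real}"
  define f where "f n x = complex_of_real (bump (1 / real (Suc n)) 1 0 x)" for n x
  have f: "f n \<in> smooth01" for n unfolding f_def by (rule bump_smooth01) simp
  have m: "f n \<in> borel_measurable ?M" for n
    by (intro measurable_restrict_space1 measurable_completion) (simp add: smooth01_D(5)[OF f])
  have bd: "norm (1 - f n u) \<le> 1" for n u
  proof -
    define b where "b = bump (1 / real (Suc n)) 1 0 u"
    have b: "0 \<le> b" "b \<le> 1" unfolding b_def bump_def by (auto simp del: of_nat_Suc)
    have "1 - f n u = of_real (1 - b)" unfolding f_def b_def by (simp del: of_nat_Suc)
    then have "norm (1 - f n u) = \<bar>1 - b\<bar>" by (metis norm_of_real)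
    then show ?thesis using b by linarith
  qed
  have lim: "(\<lambda>n. (norm (1 - f n u))\<^sup>2) \<longlonglongrightarrow> 0" if u: "u \<in> {0<..<1}" for u
  proof -
    have "(\<lambda>n. exp (- (1 / real (Suc n)) * (1 / (u * (1 - u))))) \<longlonglongrightarrow> exp (- 0 * (1 / (u * (1 - u))))"
      by (intro tendsto_intros LIMSEQ_Suc[OF lim_inverse_n'])
    moreover have "bump (1 / real (Suc n)) 1 0 u = exp (- (1 / real (Suc n)) * (1 / (u * (1 - u))))" for n
      using u by (simp add: bump_def)
    ultimately have "(\<lambda>n. bump (1 / real (Suc n)) 1 0 u) \<longlonglongrightarrow> 1" by simp
    then have "(\<lambda>n. (norm (1 - complex_of_real (bump (1 / real (Suc n)) 1 0 u)))\<^sup>2) \<longlonglongrightarrow> (norm (1 - complex_of_real 1))\<^sup>2"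
      by (intro tendsto_intros)
    then show ?thesis by (simp add: f_def)
  qed
  have fin: "finite_measure ?M" by (rule finite_measure_lebesgue_on) auto
  have mm: "(\<lambda>u. (norm (1 - f n u))\<^sup>2) \<in> borel_measurable ?M" for n using m[of n] by measurable
  have bd2: "AE u in ?M. norm ((norm (1 - f n u))\<^sup>2) \<le> 1" for n
    using bd by (intro AE_I2) (simp add: power_le_one)
  have int: "integrable ?M (\<lambda>u. (norm (1 - f n u))\<^sup>2)" for n
    by (rule finite_measure.integrable_const_bound[OF fin bd2 mm])
  have "(\<lambda>n. \<integral>u. (norm (1 - f n u))\<^sup>2 \<partial>?M) \<longlonglongrightarrow> (\<integral>u. 0 \<partial>?M)"
  proof (rule integral_dominated_convergence[where w = "\<lambda>_. 1"])
    show "AE u in ?M. (\<lambda>n. (norm (1 - f n u))\<^sup>2) \<longlonglongrightarrow> 0" using lim by (intro AE_I2) simp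
    show "integrable ?M (\<lambda>_. 1::real)" using fin by (simp add: finite_measure.integrable_const)
  qed (use mm bd2 in auto)
  then have "(\<lambda>n. \<integral>u. (norm (1 - f n u))\<^sup>2 \<partial>?M) \<longlonglongrightarrow> 0" by simp
  from order_tendstoD(2)[OF this assms] obtain n where "(\<integral>u. (norm (1 - f n u))\<^sup>2 \<partial>?M) < \<epsilon>"
    by (auto simp: eventually_sequentially)
  then show ?thesis using f int by blast
qed

section \<open>Combining the approximations under the Riemann Hypothesis\<close>

text \<open>On the critical line the transform of the error splits into three parts:
  \<open>?e1\<close> from the shift, \<open>?e2\<close> from the Dirichlet polynomial, and
  \<open>w t * d\<close> from the correction of the mean. Each is made small in L2, and Plancherel's
  inequality transfers this to (0,1).\<close>

lemma S0_approximates_smooth01: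
  assumes RH: "riemann_hypothesis" and f: "f \<in> smooth01" and \<epsilon>: "\<epsilon> > 0"
  shows "\<exists>\<phi>\<in>S0_le1. integrable (lebesgue_on {0<..<1}) (\<lambda>u. (norm (f u - T_op \<phi> u))\<^sup>2) \<and>
    (\<integral>u. (norm (f u - T_op \<phi> u))\<^sup>2 \<partial>lebesgue_on {0<..<1}) < \<epsilon>"
proof -
  define w where "w t = riemann_zeta (crit t) * mellin f (crit t)" for t
  have w: "rapidly_decreasing w"
    unfolding w_def by (rule rapidly_decreasing_zeta_mellin[OF f])
  then have wm [measurable]: "w \<in> borel_measurable borel" by (simp add: rapidly_decreasing_def)
  define W where "W = (\<integral>t. (norm (w t * 1))\<^sup>2 \<partial>lborel)"
  have iw: "integrable lborel (\<lambda>t. (norm (w t * 1))\<^sup>2)"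
    by (rule weighted_square_integrable[OF w, where D = 1 and A = 0]) auto
  have W0: "W \<ge> 0" unfolding W_def by (rule Bochner_Integration.integral_nonneg) simp
  \<comment> \<open>The three squared errors enter with weights 2, 4 and 4, a total of 10 \<eta> <
    \<epsilon>.\<close>
  define \<eta> where "\<eta> = \<epsilon> / 12"
  have \<eta>: "\<eta> > 0" using \<epsilon> by (simp add: \<eta>_def)
  \<comment> \<open>Chosen so that norm d < 2 \<kappa> gives
    \<open>(norm d)\<^sup>2 * W \<le> \<eta>\<close>; W + 1 avoids division by 0.\<close>
  define \<kappa> where "\<kappa> = sqrt (\<eta> / (W + 1)) / 2"
  have \<kappa>: "\<kappa> > 0" using \<eta> W0 by (simp add: \<kappa>_def)
  define E where "E n s = 1 / riemann_zeta (s + of_real (1 / real (n + 2)))" for n :: nat and s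
  let ?e1 = "\<lambda>n t. (norm (w t * E n (crit t) - mellin f (crit t)))\<^sup>2"
  let ?e2 = "\<lambda>c N n t. (norm (w t * (dirichlet_poly c N (crit t) - E n (crit t))))\<^sup>2"
  obtain n0 where n0: "\<forall>n\<ge>n0. integrable lborel (\<lambda>t. ?e1 n t) \<and>
     (\<integral>t. ?e1 n t \<partial>lborel) < \<eta>"
    using shifted_ratio_tendsto[OF RH f, rule_format, OF \<eta>] unfolding w_def E_def by (elim exE)
  have "eventually (\<lambda>n. norm (E n 1) < \<kappa>) sequentially"
    using tendstoD[OF inverse_zeta_tendsto_0 \<kappa>] by (simp add: E_def dist_norm)
  then obtain n1 where n1: "\<forall>n\<ge>n1. norm (E n 1) < \<kappa>" unfolding eventually_sequentially by blast
  define n where "n = max n0 n1"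
  have En: "integrable lborel (\<lambda>t. ?e1 n t)"
     "(\<integral>t. ?e1 n t \<partial>lborel) < \<eta>" "norm (E n 1) < \<kappa>"
    using n0 n1 by (auto simp: n_def)
  have "approximable w (E n)"
    unfolding E_def by (rule approximable_inverse_zeta[OF RH w]) (auto simp: divide_simps)
  then obtain c N where cN0: "integrable lborel (\<lambda>t. ?e2 c N n t) \<and>
     (\<integral>t. ?e2 c N n t \<partial>lborel) < min \<eta> \<kappa> \<and>
     norm (dirichlet_poly c N 1 - E n 1) < min \<eta> \<kappa>"
    unfolding approximable_def using \<eta> \<kappa> by (elim allE[of _ "min \<eta> \<kappa>"]) auto
  define d where "d = dirichlet_poly c N 1"
  have cN: "integrable lborel (\<lambda>t. ?e2 c N n t)"
     "(\<integral>t. ?e2 c N n t \<partial>lborel) < \<eta>"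
     "norm d < 2 * \<kappa>"
    using cN0 En(3) norm_triangle_ineq[of "d - E n 1" "E n 1"] by (auto simp: d_def)
  have d2: "(norm d)\<^sup>2 * W \<le> \<eta>"
  proof -
    have "(norm d)\<^sup>2 \<le> (2 * \<kappa>)\<^sup>2" using cN(3) by (intro power_mono) auto
    also have "\<dots> = \<eta> / (W + 1)" using \<eta> W0 by (simp add: \<kappa>_def)
    finally have "(norm d)\<^sup>2 * W \<le> \<eta> / (W + 1) * W" using W0 by (rule mult_right_mono)
    also have "\<dots> \<le> \<eta>" using \<eta> W0 by (simp add: field_simps)
    finally show ?thesis .
  qed
  \<comment> \<open>The factor 1 in the last term gives it the shape of \<open>smooth_scale\<close>
    and \<open>mellin_scale\<close>.\<close>
  define \<phi> where "\<phi> u = (\<Sum>k<N. c k * f (real (Suc k) * u)) + (- d) * f (1 * u)" for u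
  have \<phi>01: "\<phi> \<in> smooth01"
  proof -
    have "smooth \<phi>"
      unfolding \<phi>_def by (intro smooth_add smooth_sum smooth_scale smooth01_D(1)[OF f])
    moreover have "\<phi> x = 0" if "x \<notin> {0<..<1}" for x
    proof -
      have "f (real (Suc k) * x) = 0" for k
        using smooth01_dilate[OF f, of "real (Suc k)"] that by (simp add: smooth01_def del: of_nat_Suc)
      then show ?thesis using that smooth01_D(2,3)[OF f, of x] by (auto simp: \<phi>_def)
    qed
    ultimately show ?thesis by (simp add: smooth01_def)
  qed
  have m\<phi>: "mellin \<phi> s = (dirichlet_poly c N s - d) * mellin f s" if s: "Re s > 0" for s
  proof -
    have int: "integrable lborel (\<lambda>x. f (a * exp x) * exp (s * of_real x))" if a: "a \<ge> 1" for a
      using smooth01_mellin_integrable[OF smooth01_dilate[OF f a] s] .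
    have i1: "integrable lborel (\<lambda>x. \<Sum>k<N. c k * (f (real (Suc k) * exp x) * exp (s * of_real x)))"
      by (intro Bochner_Integration.integrable_sum integrable_mult_right int) simp
    have i2: "integrable lborel (\<lambda>x. - d * (f (1 * exp x) * exp (s * of_real x)))"
      by (intro integrable_mult_right int) simp
    have "mellin \<phi> s = (\<integral>x. (\<Sum>k<N. c k * (f (real (Suc k) * exp x) * exp (s * of_real x))) + (- d) * (f (1 * exp x) * exp (s * of_real x)) \<partial>lborel)"
      unfolding mellin_def \<phi>_def by (simp only: distrib_right sum_distrib_right mult.assoc)
    also have "\<dots> = (\<Sum>k<N. c k * mellin (\<lambda>u. f (real (Suc k) * u)) s) + (- d) * mellin (\<lambda>u. f (1 * u)) s"
      unfolding Bochner_Integration.integral_add[OF i1 i2] mellin_def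
      by (subst Bochner_Integration.integral_sum) (auto intro!: integrable_mult_right int simp del: of_nat_Suc)
    also have "\<dots> = (\<Sum>k<N. c k * (pw s (real (Suc k)) * mellin f s)) + (- d) * (pw s 1 * mellin f s)"
      by (subst (1 2) mellin_scale) auto
    also have "\<dots> = (dirichlet_poly c N s - d) * mellin f s"
      by (simp add: dirichlet_poly_def sum_distrib_right left_diff_distrib pw_def mult.assoc del: of_nat_Suc)
    finally show ?thesis .
  qed
  have "mellin \<phi> 1 = 0" using m\<phi>[of 1] by (simp add: d_def)
  then have \<phi>0: "integral {0..1} \<phi> = 0" using mellin_1[OF \<phi>01] by simp
  have \<phi>S: "\<phi> \<in> S0_le1" using \<phi>01 \<phi>0 by (simp add: S0_le1_iff)
  obtain B where B: "\<And>u. norm (T_op \<phi> u) \<le> B" using T_op_bounded[OF \<phi>01 \<phi>0] by blast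
  obtain B' where B': "\<And>u. norm (f u) \<le> B'" using smooth01_bounded[OF f] by blast
  define g where "g u = f u - T_op \<phi> u" for u
  have gm: "g \<in> borel_measurable borel"
    unfolding g_def by (intro borel_measurable_diff smooth01_D(5)[OF f] T_op_measurable[OF \<phi>01])
  have gb: "norm (g u) \<le> B' + B" for u
    unfolding g_def by (intro order_trans[OF norm_triangle_ineq4] add_mono B B')
  have g0: "g u = 0" if "u \<ge> 1" for u
    using that smooth01_D(3)[OF f] T_op_zero[OF \<phi>01, of u] by (simp add: g_def)
  note N = exp_substitution_norm_square[OF gm g0 gb]
  \<comment> \<open>The factor exp (x / 2) carries the L2 norm of \<open>g\<close> over to the line
    and places its Fourier transform on Re s = 1/2.\<close>
  define h where "h x = g (exp x) * exp (of_real (x / 2))" for x :: real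
  have hc: "h x = g (exp x) * exp (complex_of_real (1/2) * of_real x)" for x by (simp add: h_def)
  have ih: "integrable lborel h"
    unfolding hc[abs_def] by (rule mellin_integrable[OF gm gb g0]) auto
  have h2: "(norm (h x))\<^sup>2 = exp x * (norm (g (exp x)))\<^sup>2" for x
  proof -
    have "(exp (x / 2))\<^sup>2 = exp x" unfolding power2_eq_square exp_add[symmetric] by simp
    then show ?thesis by (simp add: h_def norm_mult power_mult_distrib)
  qed
  have hb: "norm (h x) \<le> B' + B" for x
  proof (cases "x < 0")
    case True
    then have "norm (h x) \<le> norm (g (exp x)) * 1" unfolding h_def norm_mult by (intro mult_left_mono) auto
    then show ?thesis using gb[of "exp x"] by simp
  next
    case False
    then have "h x = 0" using g0 by (simp add: h_def)
    then show ?thesis using gb[of 0] norm_ge_zero[of "g 0"] by (simp only: norm_zero)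
  qed
  have hcont: "continuous_on UNIV h"
  proof -
    have "continuous_on UNIV (\<lambda>x. T_op \<phi> (exp x))"
      by (rule continuous_on_compose2[OF T_op_continuous[OF \<phi>01]]) (auto intro!: continuous_intros)
    moreover have "continuous_on UNIV (\<lambda>x. f (exp x))"
      by (rule continuous_on_compose2[OF smooth01_D(4)[OF f]]) (auto intro!: continuous_intros)
    ultimately show ?thesis unfolding h_def g_def by (intro continuous_intros) auto
  qed
  have Fh: "fourier h t = - ((w t * E n (crit t) - mellin f (crit t)) + (w t * (dirichlet_poly c N (crit t) - E n (crit t)) + w t * (- d)))" for t
  proof -
    have "fourier h t = mellin g (crit t)"
      unfolding fourier_def mellin_def
    proof (rule Bochner_Integration.integral_cong[OF refl])
      fix x
      have "exp (complex_of_real (x / 2)) * cis (t * x) = exp (crit t * of_real x)"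
        unfolding cis_conv_exp exp_add[symmetric] by (simp add: crit_def Complex_eq algebra_simps)
      then show "h x * cis (t * x) = g (exp x) * exp (crit t * of_real x)" by (simp add: h_def mult.assoc)
    qed
    also have "\<dots> = mellin f (crit t) - mellin (T_op \<phi>) (crit t)"
    proof -
      have 1: "integrable lborel (\<lambda>x. f (exp x) * exp (crit t * of_real x))"
        by (rule smooth01_mellin_integrable[OF f]) simp
      have 2: "integrable lborel (\<lambda>x. T_op \<phi> (exp x) * exp (crit t * of_real x))"
        by (rule mellin_integrable[OF T_op_measurable[OF \<phi>01] B T_op_zero[OF \<phi>01]]) auto
      show ?thesis unfolding mellin_def g_def left_diff_distrib by (rule Bochner_Integration.integral_diff[OF 1 2])
    qed
    also have "mellin (T_op \<phi>) (crit t) = riemann_zeta (crit t) * ((dirichlet_poly c N (crit t) - d) * mellin f (crit t))"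
      using mellin_T_op[OF \<phi>01 \<phi>0, of "crit t"] m\<phi>[of "crit t"] crit_ne_1[of t] by simp
    also have "mellin f (crit t) - \<dots> = - ((w t * E n (crit t) - mellin f (crit t)) + (w t * (dirichlet_poly c N (crit t) - E n (crit t)) + w t * (- d)))"
      by (simp add: w_def algebra_simps)
    finally show ?thesis .
  qed
  let ?S = "\<lambda>t. 2 * ?e1 n t + (4 * ?e2 c N n t + 4 * (norm d)\<^sup>2 * (norm (w t * 1))\<^sup>2)"
  have Fle: "(norm (fourier h t))\<^sup>2 \<le> ?S t" for t
  proof -
    have "(norm (fourier h t))\<^sup>2 \<le> 2 * ?e1 n t + 2 * (norm (w t * (dirichlet_poly c N (crit t) - E n (crit t)) + w t * (- d)))\<^sup>2"
      unfolding Fh norm_minus_cancel by (rule norm_add_square_le)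
    also have "(norm (w t * (dirichlet_poly c N (crit t) - E n (crit t)) + w t * (- d)))\<^sup>2
      \<le> 2 * ?e2 c N n t + 2 * (norm (w t * (- d)))\<^sup>2"
      by (rule norm_add_square_le)
    also have "(norm (w t * (- d)))\<^sup>2 = (norm d)\<^sup>2 * (norm (w t * 1))\<^sup>2"
      by (simp add: norm_mult power_mult_distrib)
    finally show ?thesis by simp
  qed
  have iS: "integrable lborel ?S" using En(1) cN(1) iw by simp
  have hm: "h \<in> borel_measurable borel" by (rule borel_measurable_continuous_onI[OF hcont])
  have iF: "integrable lborel (\<lambda>t. (norm (fourier h t))\<^sup>2)"
  proof (rule Bochner_Integration.integrable_bound[OF iS])
    show "(\<lambda>t. (norm (fourier h t))\<^sup>2) \<in> borel_measurable lborel"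
      using fourier_measurable[OF hm] by measurable
    show "AE t in lborel. norm ((norm (fourier h t))\<^sup>2) \<le> norm (?S t)"
    proof (rule AE_I2)
      fix t
      have "norm ((norm (fourier h t))\<^sup>2) = (norm (fourier h t))\<^sup>2" by simp
      also have "\<dots> \<le> ?S t" by (rule Fle)
      also have "\<dots> \<le> norm (?S t)" unfolding real_norm_def by (rule abs_ge_self)
      finally show "norm ((norm (fourier h t))\<^sup>2) \<le> norm (?S t)" .
    qed
  qed
  have "(\<integral>t. (norm (fourier h t))\<^sup>2 \<partial>lborel) \<le> integral\<^sup>L lborel ?S"
    by (rule integral_mono[OF iF iS Fle])
  also have "\<dots> = 2 * (\<integral>t. ?e1 n t \<partial>lborel)
     + (4 * (\<integral>t. ?e2 c N n t \<partial>lborel) + 4 * (norm d)\<^sup>2 * W)"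
    unfolding W_def
    by (subst Bochner_Integration.integral_add, use En(1) in simp, use cN(1) iw in simp)
       (subst Bochner_Integration.integral_add, use cN(1) in simp, use iw in simp, simp)
  also have "\<dots> < 2 * \<eta> + (4 * \<eta> + 4 * \<eta>)"
    using En(2) cN(2) d2 by (intro add_strict_mono add_strict_mono add_less_le_mono) auto
  finally have F: "(\<integral>t. (norm (fourier h t))\<^sup>2 \<partial>lborel) < \<epsilon>" using \<eta> by (simp add: \<eta>_def)
  \<comment> \<open>The factor 2 pi of Plancherel's inequality is at least 1 and is given
    away.\<close>
  have "(\<integral>x. (norm (h x))\<^sup>2 \<partial>lborel) \<le> 2 * pi * (\<integral>x. (norm (h x))\<^sup>2 \<partial>lborel)"
  proof -
    have "0 \<le> (\<integral>x. (norm (h x))\<^sup>2 \<partial>lborel)" by (rule Bochner_Integration.integral_nonneg) simp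
    moreover have "1 \<le> 2 * pi" using pi_ge_two by linarith
    ultimately show ?thesis using mult_right_mono[of 1 "2 * pi"] by fastforce
  qed
  also have "\<dots> \<le> (\<integral>t. (norm (fourier h t))\<^sup>2 \<partial>lborel)"
    by (rule plancherel_le(2)[OF ih hcont hb iF])
  also note F
  finally have "(\<integral>x. exp x * (norm (g (exp x)))\<^sup>2 \<partial>lborel) < \<epsilon>" unfolding h2 .
  then have "(\<integral>u. (norm (g u))\<^sup>2 \<partial>lebesgue_on {0<..<1}) < \<epsilon>" by (simp only: N(3))
  with \<phi>S N(2) show ?thesis unfolding g_def by (intro bexI[of _ \<phi>] conjI)
qed

theorem theorem2p6:
  shows "riemann_hypothesis \<longleftrightarrow> (\<lambda>u. 1) \<in> L2_closure (lebesgue_on {0<..<1}) (T_op ` S0_le1)"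
proof
  assume RH: "riemann_hypothesis"
  let ?M = "lebesgue_on {0<..<1::real}"
  have fin: "finite_measure ?M" by (rule finite_measure_lebesgue_on) auto
  have one: "(\<lambda>u. 1) \<in> L2_space ?M"
    using fin by (simp add: L2_space_def finite_measure.integrable_const)
  have "\<exists>g \<in> T_op ` S0_le1 \<inter> L2_space ?M. L2_dist ?M (\<lambda>u. 1) g < \<epsilon>" if \<epsilon>: "\<epsilon> > 0" for \<epsilon>
  proof -
    \<comment> \<open>Two squared errors below \<open>\<epsilon>\<^sup>2 / 4\<close>, each doubled
      by \<open>norm_add_square_le\<close>, add up to less than
      \<open>\<epsilon>\<^sup>2\<close>.\<close>
    have e4: "\<epsilon>\<^sup>2 / 4 > 0" using \<epsilon> by simp
    obtain f where f: "f \<in> smooth01" "integrable ?M (\<lambda>u. (norm (1 - f u))\<^sup>2)"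
      "(\<integral>u. (norm (1 - f u))\<^sup>2 \<partial>?M) < \<epsilon>\<^sup>2 / 4"
      using smooth01_approximates_1[OF e4] by blast
    obtain \<phi> where \<phi>: "\<phi> \<in> S0_le1" "integrable ?M (\<lambda>u. (norm (f u - T_op \<phi> u))\<^sup>2)"
      "(\<integral>u. (norm (f u - T_op \<phi> u))\<^sup>2 \<partial>?M) < \<epsilon>\<^sup>2 / 4"
      using S0_approximates_smooth01[OF RH f(1) e4] by blast
    have T: "T_op \<phi> \<in> L2_space ?M" by (rule T_op_in_L2[OF \<phi>(1)])
    then have Tm: "T_op \<phi> \<in> borel_measurable ?M" by (simp add: L2_space_def)
    let ?S = "\<lambda>u. 2 * (norm (1 - f u))\<^sup>2 + 2 * (norm (f u - T_op \<phi> u))\<^sup>2"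
    have S: "integrable ?M ?S" using f(2) \<phi>(2) by simp
    have le: "(norm (1 - T_op \<phi> u))\<^sup>2 \<le> ?S u" for u
      using norm_add_square_le[of "1 - f u" "f u - T_op \<phi> u"] by simp
    have int: "integrable ?M (\<lambda>u. (norm (1 - T_op \<phi> u))\<^sup>2)"
    proof (rule Bochner_Integration.integrable_bound[OF S])
      show "(\<lambda>u. (norm (1 - T_op \<phi> u))\<^sup>2) \<in> borel_measurable ?M" using Tm by measurable
      show "AE u in ?M. norm ((norm (1 - T_op \<phi> u))\<^sup>2) \<le> norm (?S u)"
        by (rule AE_I2) (use le in simp)
    qed
    have "(\<integral>u. (norm (1 - T_op \<phi> u))\<^sup>2 \<partial>?M) \<le> integral\<^sup>L ?M ?S"
      by (rule integral_mono[OF int S le])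
    also have "\<dots> = 2 * (\<integral>u. (norm (1 - f u))\<^sup>2 \<partial>?M) + 2 * (\<integral>u. (norm (f u - T_op \<phi> u))\<^sup>2 \<partial>?M)"
      using f(2) \<phi>(2) by simp
    also have "\<dots> < \<epsilon>\<^sup>2" using f(3) \<phi>(3) by simp
    finally have "sqrt (\<integral>u. (norm (1 - T_op \<phi> u))\<^sup>2 \<partial>?M) < sqrt (\<epsilon>\<^sup>2)"
      by (rule real_sqrt_less_mono)
    then have "L2_dist ?M (\<lambda>u. 1) (T_op \<phi>) < \<epsilon>" using \<epsilon> by (simp add: L2_dist_def)
    then show ?thesis using \<phi>(1) T by blast
  qed
  then show "(\<lambda>u. 1) \<in> L2_closure ?M (T_op ` S0_le1)"
    using one by (auto simp: L2_closure_def)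
next
  assume "(\<lambda>u. 1) \<in> L2_closure (lebesgue_on {0<..<1}) (T_op ` S0_le1)"
  then show "riemann_hypothesis" by (rule closure_imp_riemann_hypothesis)
qed

end
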